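(* For every fixed $k\ge 2$, $k$-fold \textsc{Real Forrelation} requires $\Omega\left(\sqrt{N}/\log^{7/2}N\right)$ classical randomized queries, where $N=2^n$.
   Context: In $k$-fold \textsc{Real Forrelation}, one is given oracle access to functions $f_1,\ldots,f_{k-2}:\{0,1\}^n\to\{-1,1\}$ and $f_{k-1},f_k:\{0,1\}^n\to\mathbb{R}$ (each query returns one value of one of the functions). One is promised that each $f_i(x_i)$, for $i\in[k-2]$ and $x_i\in\{0,1\}^n$, is chosen uniformly and independently from $\{-1,1\}$, and also that one of the following holds. (i) Uniform measure $\mathcal{U}$: each $f_{k-1}(x_{k-1})$ and $f_k(x_k)$ is an independent $\mathcal{N}(0,1)$ Gaussian. (ii) Forrelated measure $\mathcal{F}$: each $f_{k-1}(x_{k-1})$ is an independent $\mathcal{N}(0,1)$ Gaussian, and each $f_k(x_k)$ is set equal to $$\frac{1}{2^{(k-1)n/2}}\sum_{x_1,\ldots,x_{k-1}\in\{0,1\}^n}f_1(x_1)(-1)^{x_1\cdot x_2}\cdots(-1)^{x_{k-2}\cdot x_{k-1}}f_{k-1}(x_{k-1})(-1)^{x_{k-1}\cdot x_k}.$$ The problem is to decide whether (i) or (ii) holds, with constant bias (the acceptance probabilities in the two cases, over the random input and the algorithm's randomness, differ by at least a positive constant). *)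

theory Defs
  imports "HOL-Probability.Probability"
begin

definition cube :: "nat \<Rightarrow> (nat \<Rightarrow> nat) set" where
  "cube n = ({..<n} \<rightarrow>\<^sub>E {0, 1})"

definition dotp :: "nat \<Rightarrow> (nat \<Rightarrow> nat) \<Rightarrow> (nat \<Rightarrow> nat) \<Rightarrow> nat" where
  "dotp n x y = (\<Sum>j<n. x j * y j)"

definition rademacher :: "real measure" where
  "rademacher = distr (measure_pmf (pmf_of_set {- 1, 1})) borel (\<lambda>x. x)"

definition std_gaussian :: "real measure" where
  "std_gaussian = density lborel std_normal_density"

(* The functions f_1, ..., f_k are stored as one function f on pairs, with f (i, x) = f_i(x);
   such a pair (i, x) is also what an algorithm may query. *)
type_synonym point = "nat \<times> (nat \<Rightarrow> nat)"

definition points :: "nat \<Rightarrow> nat \<Rightarrow> point set" where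
  "points m n = {1..m} \<times> cube n"

definition coord_law :: "nat \<Rightarrow> point \<Rightarrow> real measure" where
  "coord_law k p = (if fst p \<le> k - 2 then rademacher else std_gaussian)"

definition uniform_law :: "nat \<Rightarrow> nat \<Rightarrow> (point \<Rightarrow> real) measure" where
  "uniform_law k n = Pi\<^sub>M (points k n) (coord_law k)"

definition forrelation :: "nat \<Rightarrow> nat \<Rightarrow> (point \<Rightarrow> real) \<Rightarrow> (nat \<Rightarrow> nat) \<Rightarrow> real" where
  "forrelation k n f y =
     1 / 2 powr (real ((k - 1) * n) / 2) *
     (\<Sum>x \<in> {1..k - 1} \<rightarrow>\<^sub>E cube n.
        (\<Prod>i\<in>{1..k - 1}. f (i, x i)) *
        (\<Prod>i\<in>{1..<k - 1}. (- 1) ^ dotp n (x i) (x (i + 1))) *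
        (- 1) ^ dotp n (x (k - 1)) y)"

definition extend_forrelated :: "nat \<Rightarrow> nat \<Rightarrow> (point \<Rightarrow> real) \<Rightarrow> point \<Rightarrow> real" where
  "extend_forrelated k n f =
     (\<lambda>p\<in>points k n. if fst p = k then forrelation k n f (snd p) else f p)"

definition forrelated_law :: "nat \<Rightarrow> nat \<Rightarrow> (point \<Rightarrow> real) measure" where
  "forrelated_law k n =
     distr (Pi\<^sub>M (points (k - 1) n) (coord_law k)) (Pi\<^sub>M (points k n) (\<lambda>_. borel))
       (extend_forrelated k n)"

(* An adaptive algorithm draws a seed, then chooses query number t (counting from 0) from the
   seed and the t earlier answers, and finally accepts or rejects from the seed and all answers.
   The earlier answers are an element of the product of t copies of the reals. *)
record 'r algorithm =
  seed :: "'r measure"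
  next_query :: "nat \<Rightarrow> 'r \<times> (nat \<Rightarrow> real) \<Rightarrow> point"
  accept :: "'r \<times> (nat \<Rightarrow> real) \<Rightarrow> bool"

(* Exactly T queries are made, which is no restriction compared with at most T: queries may be
   repeated and their answers ignored. *)
definition randomized_algorithm :: "nat \<Rightarrow> nat \<Rightarrow> nat \<Rightarrow> 'r algorithm \<Rightarrow> bool" where
  "randomized_algorithm k n T A \<longleftrightarrow>
     prob_space (seed A) \<and>
     (\<forall>t<T. next_query A t \<in>
        seed A \<Otimes>\<^sub>M Pi\<^sub>M {..<t} (\<lambda>_. borel) \<rightarrow>\<^sub>M count_space (points k n)) \<and>
     accept A \<in> seed A \<Otimes>\<^sub>M Pi\<^sub>M {..<T} (\<lambda>_. borel) \<rightarrow>\<^sub>M count_space UNIV"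

primrec answers :: "'r algorithm \<Rightarrow> 'r \<Rightarrow> (point \<Rightarrow> real) \<Rightarrow> nat \<Rightarrow> (nat \<Rightarrow> real)" where
  "answers A r f 0 = (\<lambda>_. undefined)"
| "answers A r f (Suc t) =
     (answers A r f t)(t := f (next_query A t (r, answers A r f t)))"

definition accept_prob :: "nat \<Rightarrow> 'r algorithm \<Rightarrow> (point \<Rightarrow> real) measure \<Rightarrow> real" where
  "accept_prob T A D =
     \<P>(w in seed A \<Otimes>\<^sub>M D. accept A (fst w, answers A (fst w) (snd w) T))"

definition decides_real_forrelation ::
  "nat \<Rightarrow> nat \<Rightarrow> real \<Rightarrow> nat \<Rightarrow> 'r algorithm \<Rightarrow> bool" where
  "decides_real_forrelation k n \<epsilon> T A \<longleftrightarrow>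
     randomized_algorithm k n T A \<and>
     \<epsilon> \<le> \<bar>accept_prob T A (forrelated_law k n) - accept_prob T A (uniform_law k n)\<bar>"

end

theory Submission
  imports Defs
begin

text \<open>Fix the seed of the algorithm and the sign functions. Under the forrelated law the values on the last two
  levels are inner products of one standard Gaussian vector with unit vectors, and for typical signs these vectors are nearly
  orthogonal: by sub-Gaussian tails all their inner products are at most \<open>\<epsilon> = 10 ln N / sqrt N\<close>. If the points of
  \<open>V\<close> are queried, the joint density of their values \<open>b\<close> relative to independent Gaussians is at least
  \<open>exp (b \<bullet> E b / 2 - \<parallel>E b\<parallel>\<^sup>2)\<close>, where \<open>I + E\<close> is the Gram matrix, as long as \<open>card V * \<epsilon> \<le> 1 / 2\<close>. Splitting
  according to the set of queried points, the forrelated probability of an event is therefore at least the uniform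
  expectation of this exponential on the event, with \<open>V\<close> the set of queries actually made.

  Under the uniform law each fresh answer is independent of the past, so \<open>b \<bullet> E b / 2\<close> is a martingale in the number of
  queries whose increments are the fresh answer times its covariance with the earlier ones, itself a martingale with increments
  at most \<open>\<epsilon>\<close> times a fresh answer. Exponential supermartingale bounds give that the exponent is close to \<open>0\<close> with
  probability close to \<open>1\<close> once \<open>T * \<epsilon>\<close> is below a power of \<open>1 / ln N\<close>. The resulting one-sided comparison, applied to
  acceptance and to rejection, bounds the bias.\<close>

section \<open>Resampling one coordinate of a product measure\<close>

text \<open>The obstacle is adaptivity: the queried set depends on the answers, so no single density
  comparison covers a run. All tail bounds are therefore proved under the uniform law, where a fresh
  answer is independent of the past, and only a lower bound on the forrelated density is carried
  over.

  The logarithms, with L = ln N, arise as follows. The level \<epsilon> contains one factor sqrt L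
  from the flatness of the layer before the last sign layer and one from the union bound over pairs
  of points. The covariance of a point with the earlier answers must be small at every point and
  time, because the next query cannot be foreseen; this union bound leads to a^2 = 8 L T
  \<epsilon>^2. The quadratic part of the exponent then has quadratic variation at most w = T a^2 =
  8 L (T \<epsilon>)^2. For T = sqrt N / L powr (7 / 2) this is 800 / L^4, so the quadratic part is
  below 1 / L with high probability and the bias is O(1 / L). This is the origin of the exponent 7 /
  2; the constant 1 then serves for every k and every bias, which only affect how large n has to
  be.\<close>

lemma measurable_PiM_upd:
  assumes "j \<in> J" "u \<in> N \<rightarrow>\<^sub>M M j" "g \<in> N \<rightarrow>\<^sub>M Pi\<^sub>M J M"
  shows "(\<lambda>x. (g x)(j := u x)) \<in> N \<rightarrow>\<^sub>M Pi\<^sub>M J M"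
proof -
  have "insert j J = J" using assms by auto
  then show ?thesis
    using assms by (intro measurable_fun_upd[where J=J]) auto
qed

text \<open>Independence of one coordinate is used in this form. The inner integral no longer
  depends on \<open>x i\<close>, so averaging it over \<open>x i\<close> as well changes nothing.
  Keeping the full index set \<open>I\<close> lets \<open>f\<close> be a function of the whole
  input, such as a quantity computed from an adaptive run.\<close>

lemma nn_integral_PiM_resample:
  assumes "finite I" "i \<in> I" "\<And>j. prob_space (M j)"
    and f[measurable]: "f \<in> borel_measurable (Pi\<^sub>M I M)"
  shows "(\<integral>\<^sup>+x. f x \<partial>Pi\<^sub>M I M) = (\<integral>\<^sup>+x. \<integral>\<^sup>+z. f (x(i := z)) \<partial>M i \<partial>Pi\<^sub>M I M)"
proof -
  interpret product_prob_space M I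
    by (rule product_prob_spaceI) (rule assms(3))
  define K where "K = I - {i}"
  have K: "finite K" "i \<notin> K" "insert i K = I" using assms by (auto simp: K_def)
  have f'[measurable]: "f \<in> borel_measurable (Pi\<^sub>M (insert i K) M)" using f K by simp
  have 1: "(\<integral>\<^sup>+x. f x \<partial>Pi\<^sub>M I M) = (\<integral>\<^sup>+x. \<integral>\<^sup>+z. f (x(i := z)) \<partial>M i \<partial>Pi\<^sub>M K M)"
    using product_nn_integral_insert[OF K(1,2) f'] K(3) by simp
  have m: "(\<lambda>x. \<integral>\<^sup>+z. f (x(i := z)) \<partial>M i) \<in> borel_measurable (Pi\<^sub>M (insert i K) M)"
  proof -
    have "(\<lambda>p. (fst p)(i := snd p)) \<in> Pi\<^sub>M (insert i K) M \<Otimes>\<^sub>M M i \<rightarrow>\<^sub>M Pi\<^sub>M (insert i K) M"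
      by (rule measurable_PiM_upd) auto
    then have [measurable]: "(\<lambda>p. f ((fst p)(i := snd p))) \<in> borel_measurable (Pi\<^sub>M (insert i K) M \<Otimes>\<^sub>M M i)"
      by (rule measurable_compose) (rule f')
    show ?thesis
      using M.borel_measurable_nn_integral[of "\<lambda>x z. f (x(i := z))" "Pi\<^sub>M (insert i K) M" i]
      by (simp add: case_prod_beta')
  qed
  have 2: "(\<integral>\<^sup>+x. \<integral>\<^sup>+z. f (x(i := z)) \<partial>M i \<partial>Pi\<^sub>M I M) =
      (\<integral>\<^sup>+x. \<integral>\<^sup>+y. \<integral>\<^sup>+z. f (x(i := z)) \<partial>M i \<partial>M i \<partial>Pi\<^sub>M K M)"
    using product_nn_integral_insert[OF K(1,2) m] K(3) by simp
  show ?thesis unfolding 1 2 by (simp add: M.emeasure_space_1)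
qed

section \<open>Gaussian product measures\<close>

abbreviation gauss :: "'a set \<Rightarrow> ('a \<Rightarrow> real) measure" where
  "gauss J \<equiv> Pi\<^sub>M J (\<lambda>_. std_gaussian)"

lemma sets_std_gaussian[measurable_cong, simp]: "sets std_gaussian = sets borel"
  by (simp add: std_gaussian_def)

lemma space_std_gaussian[simp]: "space std_gaussian = UNIV"
  by (simp add: std_gaussian_def)

lemma prob_space_std_gaussian: "prob_space std_gaussian"
  unfolding std_gaussian_def by (rule prob_space_normal_density) simp

lemma nn_integral_std_gaussian:
  assumes [measurable]: "F \<in> borel_measurable borel"
  shows "(\<integral>\<^sup>+x. F x \<partial>std_gaussian) = (\<integral>\<^sup>+x. ennreal (std_normal_density x) * F x \<partial>lborel)"
  unfolding std_gaussian_def by (subst nn_integral_density) auto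

text \<open>The weight is the density of the law of \<open>m + s * z\<close> relative to the
  standard Gaussian. Its exponent is left unsimplified because a Gram--Schmidt step adds exactly
  this expression to the quadratic form in \<open>gauss_project_density\<close>.\<close>

lemma std_gaussian_affine:
  fixes m s :: real
  assumes [measurable]: "F \<in> borel_measurable borel" and s: "s > 0"
  shows "(\<integral>\<^sup>+z. F (m + s * z) \<partial>std_gaussian) =
    (\<integral>\<^sup>+z. F z * ennreal (exp ((z\<^sup>2 - ((z - m) / s)\<^sup>2) / 2) / s) \<partial>std_gaussian)"
proof -
  have "(\<integral>\<^sup>+z. F z * ennreal (exp ((z\<^sup>2 - ((z - m) / s)\<^sup>2) / 2) / s) \<partial>std_gaussian) =
    (\<integral>\<^sup>+z. ennreal (std_normal_density z) * (F z * ennreal (exp ((z\<^sup>2 - ((z - m) / s)\<^sup>2) / 2) / s)) \<partial>lborel)"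
    by (rule nn_integral_std_gaussian) measurable
  also have "\<dots> = (\<integral>\<^sup>+z. F z * ennreal (std_normal_density ((z - m) / s) / s) \<partial>lborel)"
  proof (rule nn_integral_cong)
    fix z :: real
    have "std_normal_density z * (exp ((z\<^sup>2 - ((z - m) / s)\<^sup>2) / 2) / s) = std_normal_density ((z - m) / s) / s"
      by (simp add: std_normal_density_def flip: exp_add) (simp add: field_simps)
    then show "ennreal (std_normal_density z) * (F z * ennreal (exp ((z\<^sup>2 - ((z - m) / s)\<^sup>2) / 2) / s))
        = F z * ennreal (std_normal_density ((z - m) / s) / s)"
      using s by (simp add: mult.left_commute flip: ennreal_mult')
  qed
  also have "\<dots> = ennreal \<bar>s\<bar> * (\<integral>\<^sup>+z. F (m + s * z) * ennreal (std_normal_density z / s) \<partial>lborel)"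
    using s by (subst nn_integral_real_affine[where c=s and t=m]) auto
  also have "\<dots> = (\<integral>\<^sup>+z. ennreal s * (F (m + s * z) * ennreal (std_normal_density z / s)) \<partial>lborel)"
    using s by (subst nn_integral_cmult) auto
  also have "\<dots> = (\<integral>\<^sup>+z. ennreal (std_normal_density z) * F (m + s * z) \<partial>lborel)"
  proof (rule nn_integral_cong)
    fix z :: real
    have "ennreal s * ennreal (std_normal_density z / s) = ennreal (std_normal_density z)"
      using s by (simp flip: ennreal_mult')
    then show "ennreal s * (F (m + s * z) * ennreal (std_normal_density z / s)) = ennreal (std_normal_density z) * F (m + s * z)"
      by (metis mult.commute mult.left_commute)
  qed
  also have "\<dots> = (\<integral>\<^sup>+z. F (m + s * z) \<partial>std_gaussian)"
    by (rule nn_integral_std_gaussian[symmetric]) measurable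
  finally show ?thesis by simp
qed

lemma std_gaussian_shift:
  assumes "F \<in> borel_measurable borel"
  shows "(\<integral>\<^sup>+z. F (z + m) \<partial>std_gaussian) = (\<integral>\<^sup>+z. F z * ennreal (exp (m * z - m\<^sup>2 / 2)) \<partial>std_gaussian)"
proof -
  have "(z\<^sup>2 - ((z - m) / 1)\<^sup>2) / 2 = m * z - m\<^sup>2 / 2" for z :: real
    by (simp add: power2_eq_square field_simps)
  then show ?thesis
    using std_gaussian_affine[OF assms zero_less_one, of m] by (simp only: add.commute mult_1 div_by_1)
qed

lemma nn_integral_exp_std_gaussian:
  "(\<integral>\<^sup>+z. ennreal (exp (m * z - m\<^sup>2 / 2)) \<partial>std_gaussian) = 1"
  using std_gaussian_shift[of "\<lambda>_. 1" m] prob_space.emeasure_space_1[OF prob_space_std_gaussian]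
  by simp

lemma measurable_gauss_upd:
  assumes "j \<in> J" "u \<in> borel_measurable N" "g \<in> N \<rightarrow>\<^sub>M gauss J"
  shows "(\<lambda>x. (g x)(j := u x)) \<in> N \<rightarrow>\<^sub>M gauss J"
  using assms by (intro measurable_PiM_upd) (auto cong: measurable_cong_sets)

lemma measurable_gaussI:
  assumes "\<And>j. j \<in> J \<Longrightarrow> (\<lambda>x. f x j) \<in> borel_measurable N"
    and "\<And>x j. x \<in> space N \<Longrightarrow> j \<notin> J \<Longrightarrow> f x j = undefined"
  shows "f \<in> N \<rightarrow>\<^sub>M gauss J"
proof (rule measurable_PiM_single')
  show "f \<in> space N \<rightarrow> (\<Pi>\<^sub>E i\<in>J. space std_gaussian)" using assms(2) by (auto simp: PiE_def extensional_def)
qed (use assms in \<open>auto cong: measurable_cong_sets\<close>)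

lemma gauss_component: "j \<in> J \<Longrightarrow> (\<lambda>g. g j) \<in> borel_measurable (gauss J)"
  using measurable_component_singleton[of j J "\<lambda>_. std_gaussian"] by (simp cong: measurable_cong_sets)

lemma measurable_gauss_shift:
  assumes "\<And>j. j \<in> J \<Longrightarrow> (\<lambda>x. s x j) \<in> borel_measurable N" "K \<subseteq> J" "g \<in> N \<rightarrow>\<^sub>M gauss J"
  shows "(\<lambda>x j. if j \<in> K then g x j + s x j else g x j) \<in> N \<rightarrow>\<^sub>M gauss J"
proof (rule measurable_gaussI)
  fix j assume j: "j \<in> J"
  have "(\<lambda>x. g x j) \<in> borel_measurable N"
    using measurable_compose[OF assms(3) gauss_component[OF j]] .
  then show "(\<lambda>x. if j \<in> K then g x j + s x j else g x j) \<in> borel_measurable N"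
    using assms(1)[OF j] by (cases "j \<in> K") auto
next
  fix x j assume "x \<in> space N" "j \<notin> J"
  then show "(if j \<in> K then g x j + s x j else g x j) = undefined"
    using assms(2) measurable_space[OF assms(3)] by (auto simp: space_PiM PiE_def extensional_def)
qed

text \<open>The Cameron--Martin formula.\<close>
lemma gauss_shift:
  assumes "finite J" "K \<subseteq> J" "F \<in> borel_measurable (gauss J)"
  shows "(\<integral>\<^sup>+g. F (\<lambda>j. if j \<in> K then g j + s j else g j) \<partial>gauss J) =
    (\<integral>\<^sup>+g. F g * ennreal (exp (\<Sum>j\<in>K. s j * g j - (s j)\<^sup>2 / 2)) \<partial>gauss J)"
proof -
  have "finite K" using assms finite_subset by auto
  then show ?thesis using assms(2,3)
  proof (induction K arbitrary: F)
    case (insert i K)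
    note [measurable] = insert.prems(2)
    have i: "i \<in> J" using insert by auto
    let ?sh = "\<lambda>g j. if j \<in> K then g j + s j else g j"
    define e where "e g = ennreal (exp (s i * g i - (s i)\<^sup>2 / 2))" for g
    have sh[measurable]: "?sh \<in> gauss J \<rightarrow>\<^sub>M gauss J"
      by (rule measurable_gauss_shift) (use insert in auto)
    have upd[measurable]: "(\<lambda>g. g(i := g i + s i)) \<in> gauss J \<rightarrow>\<^sub>M gauss J"
      by (rule measurable_gauss_upd[OF i]) (use i in measurable)
    have [measurable]: "(\<lambda>g. g i) \<in> borel_measurable (gauss J)" by (rule gauss_component[OF i])
    have [measurable]: "e \<in> borel_measurable (gauss J)" unfolding e_def by measurable
    define H where "H g = F (?sh g)" for g
    have [measurable]: "H \<in> borel_measurable (gauss J)"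
      unfolding H_def by (rule measurable_compose[OF sh]) measurable
    have "(\<lambda>j. if j \<in> insert i K then g j + s j else g j) = ?sh (g(i := g i + s i))" for g
      using insert by (auto simp: fun_eq_iff)
    then have "(\<integral>\<^sup>+g. F (\<lambda>j. if j \<in> insert i K then g j + s j else g j) \<partial>gauss J) =
        (\<integral>\<^sup>+g. H (g(i := g i + s i)) \<partial>gauss J)" by (simp add: H_def)
    also have "\<dots> = (\<integral>\<^sup>+g. \<integral>\<^sup>+z. H ((g(i := z))(i := (g(i := z)) i + s i)) \<partial>std_gaussian \<partial>gauss J)"
      by (rule nn_integral_PiM_resample[OF assms(1) i prob_space_std_gaussian]) measurable
    also have "\<dots> = (\<integral>\<^sup>+g. \<integral>\<^sup>+z. H (g(i := z)) * e (g(i := z)) \<partial>std_gaussian \<partial>gauss J)"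
    proof (rule nn_integral_cong)
      fix g assume g[measurable]: "g \<in> space (gauss J)"
      have "(\<lambda>z. g(i := z)) \<in> borel \<rightarrow>\<^sub>M gauss J"
        by (rule measurable_gauss_upd[OF i]) (use g in auto)
      then have "(\<lambda>z. H (g(i := z))) \<in> borel_measurable borel" by measurable
      from std_gaussian_shift[OF this, of "s i"]
      show "(\<integral>\<^sup>+z. H ((g(i := z))(i := (g(i := z)) i + s i)) \<partial>std_gaussian) =
        (\<integral>\<^sup>+z. H (g(i := z)) * e (g(i := z)) \<partial>std_gaussian)"
        by (simp only: fun_upd_same fun_upd_upd e_def)
    qed
    also have "\<dots> = (\<integral>\<^sup>+g. H g * e g \<partial>gauss J)"
      by (rule nn_integral_PiM_resample[where f="\<lambda>g. H g * e g", OF assms(1) i prob_space_std_gaussian, symmetric])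
        measurable
    also have "\<dots> = (\<integral>\<^sup>+g. (\<lambda>g. F g * e g) (?sh g) \<partial>gauss J)"
      using insert by (simp add: H_def e_def)
    also have "\<dots> = (\<integral>\<^sup>+g. F g * e g * ennreal (exp (\<Sum>j\<in>K. s j * g j - (s j)\<^sup>2 / 2)) \<partial>gauss J)"
      by (rule insert.IH[where F="\<lambda>g. F g * e g"]) (use insert in auto)
    also have "\<dots> = (\<integral>\<^sup>+g. F g * ennreal (exp (\<Sum>j\<in>insert i K. s j * g j - (s j)\<^sup>2 / 2)) \<partial>gauss J)"
      using insert by (simp add: e_def mult.assoc exp_add flip: ennreal_mult')
    finally show ?case .
  qed auto
qed

section \<open>Resampling a Gaussian vector along a unit direction\<close>

definition translate :: "'a set \<Rightarrow> ('a \<Rightarrow> real) \<Rightarrow> real \<Rightarrow> ('a \<Rightarrow> real) \<Rightarrow> 'a \<Rightarrow> real" where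
  "translate J u s g = (\<lambda>j. if j \<in> J then g j + s * u j else g j)"

lemma measurable_translate[measurable]:
  assumes [measurable]: "h \<in> borel_measurable N" and g: "g \<in> N \<rightarrow>\<^sub>M gauss J"
  shows "(\<lambda>x. translate J u (h x) (g x)) \<in> N \<rightarrow>\<^sub>M gauss J"
  unfolding translate_def by (rule measurable_gauss_shift[OF _ order_refl g]) measurable

text \<open>The left-hand side is computed by substituting \<open>z = s + \<Sum>j\<in>J. u j * g j\<close>, after which the shift of
  \<open>g\<close> by \<open>s *\<^sub>R u\<close> is the Cameron--Martin formula and the remaining integral over \<open>s\<close> is \<open>1\<close>.\<close>
lemma gauss_resample_direction:
  assumes J: "finite J" and [measurable]: "F \<in> borel_measurable (gauss J)" and u: "(\<Sum>j\<in>J. (u j)\<^sup>2) = 1"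
  shows "(\<integral>\<^sup>+g. \<integral>\<^sup>+z. F (translate J u (z - (\<Sum>j\<in>J. u j * g j)) g) \<partial>std_gaussian \<partial>gauss J)
    = (\<integral>\<^sup>+g. F g \<partial>gauss J)"
proof -
  define d where "d g = (\<Sum>j\<in>J. u j * g j)" for g :: "'a \<Rightarrow> real"
  define sh where "sh = translate J u"
  have [measurable]: "d \<in> borel_measurable (gauss J)" unfolding d_def by measurable
  note [measurable] = measurable_translate[where J=J and u=u, folded sh_def]
  have d_sh: "d (sh s g) = d g + s" for s g
    using u unfolding d_def sh_def translate_def
    by (simp add: distrib_left sum.distrib power2_eq_square mult.left_commute flip: sum_distrib_left)
  have sgd: "sigma_finite_measure (gauss J)"
    by (intro prob_space_imp_sigma_finite prob_space_PiM prob_space_std_gaussian)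
  interpret G: sigma_finite_measure "gauss J" by fact
  interpret P: pair_sigma_finite lborel "gauss J"
    unfolding pair_sigma_finite_def using sgd sigma_finite_lborel by auto
  have "(\<integral>\<^sup>+g. \<integral>\<^sup>+z. F (sh (z - d g) g) \<partial>std_gaussian \<partial>gauss J) =
    (\<integral>\<^sup>+g. \<integral>\<^sup>+s. ennreal (std_normal_density (d g + s)) * F (sh s g) \<partial>lborel \<partial>gauss J)"
  proof (rule nn_integral_cong)
    fix g assume [measurable]: "g \<in> space (gauss J)"
    have "(\<integral>\<^sup>+z. F (sh (z - d g) g) \<partial>std_gaussian) =
      (\<integral>\<^sup>+z. ennreal (std_normal_density z) * F (sh (z - d g) g) \<partial>lborel)"
      by (rule nn_integral_std_gaussian) measurable
    also have "\<dots> = (\<integral>\<^sup>+s. ennreal (std_normal_density (d g + s)) * F (sh s g) \<partial>lborel)"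
      by (subst nn_integral_real_affine[where c=1 and t="d g"]) auto
    finally show "(\<integral>\<^sup>+z. F (sh (z - d g) g) \<partial>std_gaussian) = \<dots>" .
  qed
  also have "\<dots> = (\<integral>\<^sup>+s. \<integral>\<^sup>+g. ennreal (std_normal_density (d g + s)) * F (sh s g) \<partial>gauss J \<partial>lborel)"
    by (rule P.Fubini') measurable
  also have "\<dots> = (\<integral>\<^sup>+s. \<integral>\<^sup>+g. ennreal (std_normal_density (s - d g)) * F g \<partial>gauss J \<partial>lborel)"
  proof (rule nn_integral_cong)
    fix s :: real
    have "(\<integral>\<^sup>+g. ennreal (std_normal_density (d g + s)) * F (sh s g) \<partial>gauss J) =
        (\<integral>\<^sup>+g. (\<lambda>g. ennreal (std_normal_density (d g)) * F g) (\<lambda>j. if j \<in> J then g j + s * u j else g j) \<partial>gauss J)"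
      using d_sh[of s] by (simp add: add.commute sh_def translate_def)
    also have "\<dots> = (\<integral>\<^sup>+g. ennreal (std_normal_density (d g)) * F g *
         ennreal (exp (\<Sum>j\<in>J. s * u j * g j - (s * u j)\<^sup>2 / 2)) \<partial>gauss J)"
      by (rule gauss_shift[OF J order_refl]) measurable
    also have "\<dots> = (\<integral>\<^sup>+g. ennreal (std_normal_density (s - d g)) * F g \<partial>gauss J)"
    proof (rule nn_integral_cong)
      fix g
      have "(\<Sum>j\<in>J. s * u j * g j - (s * u j)\<^sup>2 / 2) = s * d g - s\<^sup>2 / 2"
        using u unfolding d_def
        by (simp add: sum_subtractf mult.assoc power_mult_distrib flip: sum_distrib_left sum_divide_distrib)
      moreover have "std_normal_density (d g) * exp (s * d g - s\<^sup>2 / 2) = std_normal_density (s - d g)"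
        by (simp add: std_normal_density_def flip: exp_add) (simp add: field_simps power2_eq_square)
      ultimately show "ennreal (std_normal_density (d g)) * F g * ennreal (exp (\<Sum>j\<in>J. s * u j * g j - (s * u j)\<^sup>2 / 2))
         = ennreal (std_normal_density (s - d g)) * F g"
        by (metis (no_types, lifting) ennreal_mult' exp_ge_zero mult.assoc mult.commute)
    qed
    finally show "(\<integral>\<^sup>+g. ennreal (std_normal_density (d g + s)) * F (sh s g) \<partial>gauss J) = \<dots>" .
  qed
  also have "\<dots> = (\<integral>\<^sup>+g. \<integral>\<^sup>+s. ennreal (std_normal_density (s - d g)) * F g \<partial>lborel \<partial>gauss J)"
    by (rule P.Fubini'[symmetric]) measurable
  also have "\<dots> = (\<integral>\<^sup>+g. F g \<partial>gauss J)"
  proof (rule nn_integral_cong)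
    fix g
    have "(\<integral>\<^sup>+s. ennreal (std_normal_density (s - d g)) * F g \<partial>lborel) =
      (\<integral>\<^sup>+s. ennreal (std_normal_density (s - d g)) \<partial>lborel) * F g"
      by (rule nn_integral_multc) measurable
    also have "(\<integral>\<^sup>+s. ennreal (std_normal_density (s - d g)) \<partial>lborel) = (\<integral>\<^sup>+s. ennreal (std_normal_density s) \<partial>lborel)"
      by (subst nn_integral_real_affine[where c=1 and t="d g"]) auto
    also have "\<dots> = 1"
      using nn_integral_std_gaussian[of "\<lambda>_. 1"] prob_space.emeasure_space_1[OF prob_space_std_gaussian] by simp
    finally show "(\<integral>\<^sup>+s. ennreal (std_normal_density (s - d g)) * F g \<partial>lborel) = F g" by simp
  qed
  finally show ?thesis unfolding sh_def d_def .
qed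

section \<open>Projections of a Gaussian vector\<close>

definition gram :: "'a set \<Rightarrow> ('b \<Rightarrow> 'a \<Rightarrow> real) \<Rightarrow> 'b \<Rightarrow> 'b \<Rightarrow> real" where
  "gram J v p q = (\<Sum>j\<in>J. v p j * v q j)"

lemma gram_commute: "gram J v p q = gram J v q p"
  by (simp add: gram_def mult.commute)

definition project :: "'a set \<Rightarrow> 'b set \<Rightarrow> ('b \<Rightarrow> 'a \<Rightarrow> real) \<Rightarrow> ('a \<Rightarrow> real) \<Rightarrow> 'b \<Rightarrow> real" where
  "project J B v g = (\<lambda>p\<in>B. \<Sum>j\<in>J. v p j * g j)"

lemma measurable_project:
  "project J B v \<in> gauss J \<rightarrow>\<^sub>M gauss B"
  unfolding project_def
  by (rule measurable_gaussI) (auto intro!: borel_measurable_sum borel_measurable_times gauss_component)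

text \<open>The double sum is at most \<epsilon> times the squared l1 norm of \<open>u\<close>, and
  Cauchy--Schwarz passes to the l2 norm at the price of \<open>card S\<close>. This crude operator
  norm bound suffices because at most 1 / (2 \<epsilon>) points are ever queried.\<close>

lemma abs_bilinear_form_le:
  fixes u :: "'a \<Rightarrow> real"
  assumes S: "finite S" and E: "\<And>p q. p \<in> S \<Longrightarrow> q \<in> S \<Longrightarrow> \<bar>E p q\<bar> \<le> \<epsilon>" and \<epsilon>: "0 \<le> \<epsilon>"
  shows "\<bar>\<Sum>p\<in>S. u p * (\<Sum>q\<in>S. E p q * u q)\<bar> \<le> real (card S) * \<epsilon> * (\<Sum>p\<in>S. (u p)\<^sup>2)"
proof -
  have "\<bar>\<Sum>p\<in>S. u p * (\<Sum>q\<in>S. E p q * u q)\<bar> \<le> (\<Sum>p\<in>S. \<bar>u p * (\<Sum>q\<in>S. E p q * u q)\<bar>)" by (rule sum_abs)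
  also have "\<dots> \<le> (\<Sum>p\<in>S. \<bar>u p\<bar> * (\<epsilon> * (\<Sum>q\<in>S. \<bar>u q\<bar>)))"
  proof (rule sum_mono)
    fix p assume p: "p \<in> S"
    have "\<bar>\<Sum>q\<in>S. E p q * u q\<bar> \<le> (\<Sum>q\<in>S. \<bar>E p q * u q\<bar>)" by (rule sum_abs)
    also have "\<dots> \<le> (\<Sum>q\<in>S. \<epsilon> * \<bar>u q\<bar>)"
      using E[OF p] by (intro sum_mono) (simp add: abs_mult mult_right_mono)
    finally show "\<bar>u p * (\<Sum>q\<in>S. E p q * u q)\<bar> \<le> \<bar>u p\<bar> * (\<epsilon> * (\<Sum>q\<in>S. \<bar>u q\<bar>))"
      by (simp only: abs_mult sum_distrib_left[symmetric]) (rule mult_left_mono, auto)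
  qed
  also have "\<dots> = \<epsilon> * (\<Sum>p\<in>S. \<bar>u p\<bar>)\<^sup>2"
  proof -
    have "(\<Sum>p\<in>S. \<bar>u p\<bar> * (\<epsilon> * s)) = \<epsilon> * ((\<Sum>p\<in>S. \<bar>u p\<bar>) * s)" for s
      by (simp add: sum_distrib_right sum_distrib_left mult.left_commute)
    then show ?thesis by (simp only: power2_eq_square)
  qed
  also have "(\<Sum>p\<in>S. \<bar>u p\<bar>)\<^sup>2 \<le> real (card S) * (\<Sum>p\<in>S. (u p)\<^sup>2)"
    using sum_squared_le_sum_of_squares[of "\<lambda>p. \<bar>u p\<bar>" S] by (simp add: mult.commute)
  finally show ?thesis using \<epsilon> by (simp add: mult_left_mono mult.left_commute mult.assoc)
qed

text \<open>With \<open>(I + E) c = a\<close> this is \<open>a \<bullet> (I - (I + E)\<^sup>-\<^sup>1) a \<ge> a \<bullet> E a - 2 \<parallel>E a\<parallel>\<^sup>2\<close>.\<close>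
lemma quadratic_form_inverse_ge:
  fixes a c :: "'a \<Rightarrow> real"
  assumes S: "finite S" and E: "\<And>p q. p \<in> S \<Longrightarrow> q \<in> S \<Longrightarrow> \<bar>E p q\<bar> \<le> \<epsilon>" and \<epsilon>: "0 \<le> \<epsilon>" "real (card S) * \<epsilon> \<le> 1 / 2"
    and sym: "\<And>p q. E p q = E q p"
    and c: "\<And>p. p \<in> S \<Longrightarrow> c p + (\<Sum>q\<in>S. E p q * c q) = a p"
  shows "(\<Sum>p\<in>S. a p * (\<Sum>q\<in>S. E p q * a q)) - 2 * (\<Sum>p\<in>S. (\<Sum>q\<in>S. E p q * a q)\<^sup>2) \<le> (\<Sum>p\<in>S. a p * (a p - c p))"
proof -
  \<comment> \<open>In vector notation \<open>u = E c = a - c\<close> and \<open>y = E a\<close>,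
    hence \<open>y = u + E u\<close>; the right-hand side of the claim is
    \<open>a \<bullet> u = a \<bullet> y - u \<bullet> y\<close>, so only
    \<open>u \<bullet> y\<close> has to be bounded from above.\<close>
  define u where "u p = (\<Sum>q\<in>S. E p q * c q)" for p
  define y where "y p = (\<Sum>q\<in>S. E p q * a q)" for p
  have swap: "(\<Sum>p\<in>S. f p * (\<Sum>q\<in>S. E p q * g q)) = (\<Sum>p\<in>S. (\<Sum>q\<in>S. E p q * f q) * g p)" for f g
    unfolding sum_distrib_left sum_distrib_right
    by (subst sum.swap) (simp add: sym mult.left_commute mult.commute mult.assoc)
  have y: "y p = u p + (\<Sum>q\<in>S. E p q * u q)" for p
  proof -
    have "y p = (\<Sum>q\<in>S. E p q * (c q + u q))" unfolding y_def using c by (intro sum.cong) (auto simp: u_def)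
    then show ?thesis by (simp add: distrib_left sum.distrib u_def)
  qed
  have Q: "\<bar>\<Sum>p\<in>S. u p * (\<Sum>q\<in>S. E p q * u q)\<bar> \<le> (\<Sum>p\<in>S. (u p)\<^sup>2) / 2"
  proof -
    have "\<bar>\<Sum>p\<in>S. u p * (\<Sum>q\<in>S. E p q * u q)\<bar> \<le> real (card S) * \<epsilon> * (\<Sum>p\<in>S. (u p)\<^sup>2)"
      by (rule abs_bilinear_form_le[OF S E \<epsilon>(1)])
    also have "\<dots> \<le> (1 / 2) * (\<Sum>p\<in>S. (u p)\<^sup>2)"
      by (intro mult_right_mono \<epsilon>(2) sum_nonneg) auto
    finally show ?thesis by simp
  qed
  have uy: "(\<Sum>p\<in>S. u p * y p) = (\<Sum>p\<in>S. (u p)\<^sup>2) + (\<Sum>p\<in>S. u p * (\<Sum>q\<in>S. E p q * u q))"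
    by (simp add: y distrib_left sum.distrib power2_eq_square)
  \<comment> \<open>By \<open>Q\<close> and \<open>uy\<close>, \<open>u \<bullet> y\<close> is at
    least half the squared norm of \<open>u\<close>. Young's inequality with weight 1 / 4 on
    \<open>u\<close> is therefore absorbed by half of \<open>u \<bullet> y\<close>, which produces
    the factor 2.\<close>
  have "(\<Sum>p\<in>S. u p * y p) \<le> (\<Sum>p\<in>S. (y p)\<^sup>2 + (u p)\<^sup>2 / 4)"
  proof (rule sum_mono)
    fix p have "0 \<le> (y p - u p / 2)\<^sup>2" by simp
    then show "u p * y p \<le> (y p)\<^sup>2 + (u p)\<^sup>2 / 4" by (simp add: power2_eq_square field_simps)
  qed
  then have "(\<Sum>p\<in>S. u p * y p) \<le> (\<Sum>p\<in>S. (y p)\<^sup>2) + (\<Sum>p\<in>S. (u p)\<^sup>2) / 4"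
    by (simp add: sum.distrib sum_divide_distrib)
  then have main: "(\<Sum>p\<in>S. u p * y p) \<le> 2 * (\<Sum>p\<in>S. (y p)\<^sup>2)"
    using Q uy by linarith
  have "(\<Sum>p\<in>S. a p * (a p - c p)) = (\<Sum>p\<in>S. a p * u p)"
  proof (intro sum.cong refl)
    fix p assume "p \<in> S"
    from c[OF this] have "a p - c p = u p" by (simp add: u_def)
    then show "a p * (a p - c p) = a p * u p" by simp
  qed
  also have "\<dots> = (\<Sum>p\<in>S. a p * y p) - (\<Sum>p\<in>S. a p * (\<Sum>q\<in>S. E p q * u q))"
    by (simp add: y distrib_left sum.distrib)
  also have "(\<Sum>p\<in>S. a p * (\<Sum>q\<in>S. E p q * u q)) = (\<Sum>p\<in>S. u p * y p)"
    by (subst swap) (simp add: y_def mult.commute)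
  finally show ?thesis using main by (simp add: y_def)
qed

text \<open>The hypothesis on \<open>m\<close> is the system of normal equations for regressing
  \<open>v w\<close> on the vectors of \<open>S\<close>, so the residual is orthogonal to all of
  them and has squared norm 1 - t, where t is the squared norm of the projection. Near orthogonality
  keeps t below 1, so the residual can be normalised to the unit vector \<open>u\<close>; \<sigma>
  is its length.\<close>

lemma gram_schmidt_step:
  fixes v :: "'b \<Rightarrow> 'a \<Rightarrow> real"
  assumes S: "finite S" "w \<notin> S" and unit: "\<And>p. p \<in> insert w S \<Longrightarrow> gram J v p p = 1"
    and orth: "\<And>p q. p \<in> insert w S \<Longrightarrow> q \<in> insert w S \<Longrightarrow> p \<noteq> q \<Longrightarrow> \<bar>gram J v p q\<bar> \<le> \<epsilon>"
    and \<epsilon>: "0 \<le> \<epsilon>" "real (card (insert w S)) * \<epsilon> \<le> 1 / 2"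
    and m: "\<And>p. p \<in> S \<Longrightarrow> (\<Sum>q\<in>S. gram J v p q * m q) = gram J v p w"
  obtains \<sigma> u where "0 < \<sigma>" "\<sigma> \<le> 1" "\<sigma>\<^sup>2 = 1 - (\<Sum>p\<in>S. m p * gram J v p w)"
    "(\<Sum>j\<in>J. (u j)\<^sup>2) = 1" "\<And>p. p \<in> S \<Longrightarrow> (\<Sum>j\<in>J. v p j * u j) = 0" "(\<Sum>j\<in>J. v w j * u j) = \<sigma>"
    "\<And>g. (\<Sum>j\<in>J. v w j * g j) = (\<Sum>p\<in>S. m p * (\<Sum>j\<in>J. v p j * g j)) + \<sigma> * (\<Sum>j\<in>J. u j * g j)"
proof -
  let ?G = "gram J v"
  define r where "r j = v w j - (\<Sum>q\<in>S. m q * v q j)" for j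
  define t where "t = (\<Sum>p\<in>S. m p * ?G p w)"
  have lin: "(\<Sum>j\<in>J. x j * r j) = (\<Sum>j\<in>J. x j * v w j) - (\<Sum>q\<in>S. m q * (\<Sum>j\<in>J. x j * v q j))" for x
    unfolding r_def
    by (simp add: right_diff_distrib sum_subtractf sum_distrib_left mult.left_commute) (rule sum.swap)
  have r0: "(\<Sum>j\<in>J. v p j * r j) = 0" if "p \<in> S" for p
    using m[OF that] unfolding lin by (simp add: gram_def mult.commute)
  have rw: "(\<Sum>j\<in>J. v w j * r j) = 1 - t"
    using unit[of w] unfolding lin t_def by (simp add: gram_def mult.commute)
  have rr: "(\<Sum>j\<in>J. r j * r j) = 1 - t"
    unfolding lin using rw r0 by (simp add: mult.commute)
  have card: "real (card S) * \<epsilon> \<le> 1 / 2" "\<epsilon> \<le> 1 / 2"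
    using \<epsilon> S by (auto simp: distrib_right) (smt (verit, ccfv_SIG) mult_nonneg_nonneg of_nat_0_le_iff)+
  \<comment> \<open>Isolating the diagonal term of each normal equation bounds the l1 norm
    \<open>s\<close> of \<open>m\<close> by \<open>card S * \<epsilon> * (1 + s)\<close>, hence by 1
    / 2 + s / 2. This gives s at most 1, and then t at most \<epsilon>.\<close>
  define s where "s = (\<Sum>p\<in>S. \<bar>m p\<bar>)"
  have mp: "\<bar>m p\<bar> \<le> \<epsilon> + \<epsilon> * s" if p: "p \<in> S" for p
  proof -
    have "?G p w = m p + (\<Sum>q\<in>S - {p}. ?G p q * m q)"
      using m[OF p] unit[of p] p S by (simp add: sum.remove[of S p])
    moreover have "\<bar>\<Sum>q\<in>S - {p}. ?G p q * m q\<bar> \<le> (\<Sum>q\<in>S - {p}. \<epsilon> * \<bar>m q\<bar>)"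
      by (rule order_trans[OF sum_abs sum_mono]) (use orth p in \<open>auto simp: abs_mult intro!: mult_right_mono\<close>)
    moreover have "(\<Sum>q\<in>S - {p}. \<epsilon> * \<bar>m q\<bar>) \<le> \<epsilon> * s"
      unfolding s_def sum_distrib_left using S \<epsilon> by (intro sum_mono2) auto
    moreover have "\<bar>?G p w\<bar> \<le> \<epsilon>" using p S by (intro orth) auto
    ultimately show ?thesis by linarith
  qed
  have "s \<le> (\<Sum>p\<in>S. \<epsilon> + \<epsilon> * s)" unfolding s_def[of] by (rule sum_mono) (use mp s_def in auto)
  then have "s \<le> real (card S) * \<epsilon> + real (card S) * \<epsilon> * s" by (simp add: distrib_left mult.assoc)
  moreover have "0 \<le> s" unfolding s_def by (rule sum_nonneg) simp
  moreover have "real (card S) * \<epsilon> * s \<le> 1 / 2 * s" using card \<open>0 \<le> s\<close> by (intro mult_right_mono)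
  ultimately have s1: "s \<le> 1" using card by linarith
  have "t \<le> (\<Sum>p\<in>S. \<bar>m p\<bar> * \<epsilon>)"
    unfolding t_def
  proof (rule sum_mono)
    fix p assume p: "p \<in> S"
    have "m p * ?G p w \<le> \<bar>m p\<bar> * \<bar>?G p w\<bar>" by (metis abs_ge_self abs_mult)
    also have "\<dots> \<le> \<bar>m p\<bar> * \<epsilon>" using p S by (intro mult_left_mono orth) auto
    finally show "m p * ?G p w \<le> \<bar>m p\<bar> * \<epsilon>" .
  qed
  also have "\<dots> = s * \<epsilon>" by (simp add: s_def sum_distrib_right)
  also have "\<dots> \<le> 1 * \<epsilon>" using s1 \<epsilon> by (intro mult_right_mono)
  finally have t1: "t < 1" using card by linarith
  have t0: "0 \<le> t"
  proof -
    define x where "x j = (\<Sum>q\<in>S. m q * v q j)" for j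
    have xr: "(\<Sum>j\<in>J. x j * r j) = 0"
      unfolding x_def sum_distrib_right by (subst sum.swap) (simp add: mult.assoc r0 flip: sum_distrib_left)
    have "t = (\<Sum>j\<in>J. x j * v w j)"
      unfolding x_def t_def gram_def sum_distrib_left sum_distrib_right
      by (subst sum.swap) (simp add: mult.assoc)
    also have "\<dots> = (\<Sum>j\<in>J. x j * x j + x j * r j)"
      by (intro sum.cong) (auto simp: r_def x_def algebra_simps)
    also have "\<dots> = (\<Sum>j\<in>J. x j * x j)" using xr by (simp add: sum.distrib)
    finally show ?thesis by (simp add: sum_nonneg)
  qed
  define \<sigma> where "\<sigma> = sqrt (1 - t)"
  have \<sigma>: "0 < \<sigma>" "\<sigma> \<le> 1" "\<sigma>\<^sup>2 = 1 - t" "\<sigma> * \<sigma> = 1 - t" using t0 t1 by (auto simp: \<sigma>_def)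
  define u where "u j = r j / \<sigma>" for j
  have xu: "(\<Sum>j\<in>J. x j * u j) = (\<Sum>j\<in>J. x j * r j) / \<sigma>" for x by (simp add: u_def sum_divide_distrib)
  show thesis
  proof (rule that[of \<sigma> u])
    show "0 < \<sigma>" "\<sigma> \<le> 1" "\<sigma>\<^sup>2 = 1 - (\<Sum>p\<in>S. m p * ?G p w)" using \<sigma> by (auto simp: t_def)
    have "(\<Sum>j\<in>J. (u j)\<^sup>2) = (\<Sum>j\<in>J. r j * r j) / \<sigma>\<^sup>2"
      by (simp add: u_def power_divide sum_divide_distrib power2_eq_square)
    then show "(\<Sum>j\<in>J. (u j)\<^sup>2) = 1" using rr \<sigma> t1 by simp
    show "(\<Sum>j\<in>J. v p j * u j) = 0" if "p \<in> S" for p using r0[OF that] by (simp add: xu)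
    show "(\<Sum>j\<in>J. v w j * u j) = \<sigma>" unfolding xu rw \<sigma>(4)[symmetric] using \<sigma>(1) by simp
    show "(\<Sum>j\<in>J. v w j * g j) = (\<Sum>p\<in>S. m p * (\<Sum>j\<in>J. v p j * g j)) + \<sigma> * (\<Sum>j\<in>J. u j * g j)" for g
    proof -
      have "\<sigma> * (\<Sum>j\<in>J. u j * g j) = (\<Sum>j\<in>J. g j * r j)"
        using \<sigma> xu[of g] by (simp add: mult.commute)
      then show ?thesis unfolding lin by (simp add: mult.commute)
    qed
  qed
qed


text \<open>Induction on \<open>S\<close> along Gram--Schmidt: given the coordinates in \<open>S\<close>, the new coordinate \<open>w\<close> is
  \<open>m \<bullet> b + \<sigma> z\<close> with \<open>z\<close> a fresh standard Gaussian. Here \<open>c b\<close> is the inverse Gram matrix applied to \<open>b\<close>, and the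
  factor \<open>det (gram J v) powr (- 1 / 2) \<ge> 1\<close> of the density is dropped.\<close>
lemma gauss_project_density:
  fixes v :: "'b \<Rightarrow> 'a \<Rightarrow> real"
  assumes J: "finite J" and B: "finite B" and S: "S \<subseteq> B" and unit: "\<And>p. p \<in> S \<Longrightarrow> gram J v p p = 1"
    and orth: "\<And>p q. p \<in> S \<Longrightarrow> q \<in> S \<Longrightarrow> p \<noteq> q \<Longrightarrow> \<bar>gram J v p q\<bar> \<le> \<epsilon>"
    and \<epsilon>: "0 \<le> \<epsilon>" "real (card S) * \<epsilon> \<le> 1 / 2"
  shows "\<exists>c. (\<forall>p\<in>S. (\<lambda>b. c b p) \<in> borel_measurable (gauss B)) \<and>
    (\<forall>b. \<forall>p\<in>S. (\<Sum>q\<in>S. gram J v p q * c b q) = b p) \<and>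
    (\<forall>b b'. (\<forall>p\<in>S. b p = b' p) \<longrightarrow> (\<forall>p\<in>S. c b p = c b' p)) \<and>
    (\<forall>F\<in>borel_measurable (gauss B).
      (\<forall>b\<in>space (gauss B). \<forall>b'\<in>space (gauss B). (\<forall>p\<in>S. b p = b' p) \<longrightarrow> F b = F b') \<longrightarrow>
      (\<integral>\<^sup>+b. F b * ennreal (exp ((\<Sum>p\<in>S. b p * (b p - c b p)) / 2)) \<partial>gauss B) \<le>
      (\<integral>\<^sup>+g. F (project J B v g) \<partial>gauss J))"
proof -
  have "finite S" using S B finite_subset by blast
  then show ?thesis using S unit orth \<epsilon>
  proof (induction S)
    case empty
    have "(\<integral>\<^sup>+b. F b \<partial>gauss B) \<le> (\<integral>\<^sup>+g. F (project J B v g) \<partial>gauss J)"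
      if F: "F \<in> borel_measurable (gauss B)"
        "\<forall>b\<in>space (gauss B). \<forall>b'\<in>space (gauss B). F b = F b'" for F :: "('b \<Rightarrow> real) \<Rightarrow> ennreal"
    proof -
      interpret GB: prob_space "gauss B" by (intro prob_space_PiM prob_space_std_gaussian)
      interpret GJ: prob_space "gauss J" by (intro prob_space_PiM prob_space_std_gaussian)
      obtain b0 where b0: "b0 \<in> space (gauss B)" using GB.not_empty unfolding ex_in_conv[symmetric] by (elim exE)
      have "(\<integral>\<^sup>+b. F b \<partial>gauss B) = (\<integral>\<^sup>+b. F b0 \<partial>gauss B)"
        using F b0 by (intro nn_integral_cong) blast
      also have "\<dots> = (\<integral>\<^sup>+g. F b0 \<partial>gauss J)" by (simp add: GB.emeasure_space_1 GJ.emeasure_space_1)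
      also have "\<dots> = (\<integral>\<^sup>+g. F (project J B v g) \<partial>gauss J)"
        using F b0 measurable_space[OF measurable_project[of J B v]] by (intro nn_integral_cong) blast
      finally show ?thesis by simp
    qed
    note base = this
    show ?case
    proof (intro exI[of _ "\<lambda>_ _. 0"] conjI ballI impI)
      fix F :: "('b \<Rightarrow> real) \<Rightarrow> ennreal" assume "F \<in> borel_measurable (gauss B)"
        and "\<forall>b\<in>space (gauss B). \<forall>b'\<in>space (gauss B). (\<forall>p\<in>{}. b p = b' p) \<longrightarrow> F b = F b'"
      then have "(\<integral>\<^sup>+b. F b \<partial>gauss B) \<le> (\<integral>\<^sup>+g. F (project J B v g) \<partial>gauss J)"
        by (intro base) blast+
      then show "(\<integral>\<^sup>+b. F b * ennreal (exp ((\<Sum>p\<in>{}. b p * (b p - 0)) / 2)) \<partial>gauss B) \<le> (\<integral>\<^sup>+g. F (project J B v g) \<partial>gauss J)"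
        by simp
    qed simp_all
  next
    case (insert w S)
    let ?G = "gram J v"
    have card: "real (card S) * \<epsilon> \<le> 1 / 2"
      using insert.hyps insert.prems(5) insert.prems(4) by (simp add: distrib_right)
    obtain c where C: "(\<forall>p\<in>S. (\<lambda>b. c b p) \<in> borel_measurable (gauss B)) \<and>
      (\<forall>b. \<forall>p\<in>S. (\<Sum>q\<in>S. ?G p q * c b q) = b p) \<and>
      (\<forall>b b'. (\<forall>p\<in>S. b p = b' p) \<longrightarrow> (\<forall>p\<in>S. c b p = c b' p)) \<and>
      (\<forall>F\<in>borel_measurable (gauss B).
        (\<forall>b\<in>space (gauss B). \<forall>b'\<in>space (gauss B). (\<forall>p\<in>S. b p = b' p) \<longrightarrow> F b = F b') \<longrightarrow>
        (\<integral>\<^sup>+b. F b * ennreal (exp ((\<Sum>p\<in>S. b p * (b p - c b p)) / 2)) \<partial>gauss B) \<le>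
        (\<integral>\<^sup>+g. F (project J B v g) \<partial>gauss J))"
    proof (rule exE[OF insert.IH])
      show "S \<subseteq> B" using insert.prems by auto
      show "gram J v p p = 1" if "p \<in> S" for p using insert.prems that by blast
      show "\<bar>gram J v p q\<bar> \<le> \<epsilon>" if "p \<in> S" "q \<in> S" "p \<noteq> q" for p q using insert.prems that by blast
    qed (use insert.prems card in blast)+
    from C have c_meas: "\<And>p. p \<in> S \<Longrightarrow> (\<lambda>b. c b p) \<in> borel_measurable (gauss B)"
      by blast
    from C have c_inv: "\<And>b p. p \<in> S \<Longrightarrow> (\<Sum>q\<in>S. ?G p q * c b q) = b p"
      by blast
    from C have c_dep: "\<And>b b' p. (\<And>p. p \<in> S \<Longrightarrow> b p = b' p) \<Longrightarrow> p \<in> S \<Longrightarrow> c b p = c b' p"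
      by blast
    from C have IH: "\<And>F. F \<in> borel_measurable (gauss B) \<Longrightarrow>
        (\<And>b b'. b \<in> space (gauss B) \<Longrightarrow> b' \<in> space (gauss B) \<Longrightarrow> (\<And>p. p \<in> S \<Longrightarrow> b p = b' p) \<Longrightarrow> F b = F b') \<Longrightarrow>
        (\<integral>\<^sup>+b. F b * ennreal (exp ((\<Sum>p\<in>S. b p * (b p - c b p)) / 2)) \<partial>gauss B) \<le>
        (\<integral>\<^sup>+g. F (project J B v g) \<partial>gauss J)"
      by blast
    have wB: "w \<in> B" and SB: "S \<subseteq> B" using insert.prems by auto
    \<comment> \<open>The induction carries \<open>c\<close> as a solver for arbitrary right-hand
      sides so that it can be applied here to the column of \<open>w\<close>; this yields the
      regression coefficients without any matrix inverse.\<close>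
    define m where "m = c (\<lambda>p. ?G p w)"
    have m: "(\<Sum>q\<in>S. ?G p q * m q) = ?G p w" if "p \<in> S" for p
      using c_inv[OF that] by (simp add: m_def)
    obtain \<sigma> u where \<sigma>: "0 < \<sigma>" "\<sigma> \<le> 1" "\<sigma>\<^sup>2 = 1 - (\<Sum>p\<in>S. m p * ?G p w)"
      and u1: "(\<Sum>j\<in>J. (u j)\<^sup>2) = 1" and u0: "\<And>p. p \<in> S \<Longrightarrow> (\<Sum>j\<in>J. v p j * u j) = 0"
      and uw: "(\<Sum>j\<in>J. v w j * u j) = \<sigma>"
      and w_eq: "\<And>g. (\<Sum>j\<in>J. v w j * g j) = (\<Sum>p\<in>S. m p * (\<Sum>j\<in>J. v p j * g j)) + \<sigma> * (\<Sum>j\<in>J. u j * g j)"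
      by (rule gram_schmidt_step[OF insert.hyps insert.prems(2) insert.prems(3) insert.prems(4,5) m]) auto
    \<comment> \<open>Given the coordinates in \<open>S\<close>, the coordinate \<open>w\<close> has
      conditional mean \<open>mu b\<close> and conditional variance \<open>\<sigma>\<^sup>2\<close>.
      The solver \<open>c'\<close> for the enlarged system is block elimination, with Schur
      complement \<open>\<sigma>\<^sup>2\<close>.\<close>
    define mu where "mu b = (\<Sum>p\<in>S. m p * b p)" for b :: "'b \<Rightarrow> real"
    define cw where "cw b = (b w - mu b) / \<sigma>\<^sup>2" for b :: "'b \<Rightarrow> real"
    define c' where "c' b = (\<lambda>p. if p = w then cw b else c b p - m p * cw b)" for b :: "'b \<Rightarrow> real"
    have comp: "(\<lambda>b. b p) \<in> borel_measurable (gauss B)" if "p \<in> insert w S" for p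
      using that wB SB by (intro gauss_component) auto
    have mu_meas: "mu \<in> borel_measurable (gauss B)"
      unfolding mu_def using comp by (auto intro!: borel_measurable_sum borel_measurable_times)
    have cw_meas: "cw \<in> borel_measurable (gauss B)"
      unfolding cw_def using comp mu_meas by (auto intro!: borel_measurable_divide borel_measurable_diff)
    have c'_meas: "(\<lambda>b. c' b p) \<in> borel_measurable (gauss B)" if "p \<in> insert w S" for p
      using that cw_meas c_meas unfolding c'_def
      by (cases "p = w") (auto intro!: borel_measurable_diff borel_measurable_times)
    have mc: "(\<Sum>q\<in>S. ?G w q * c b q) = mu b" for b
    proof -
      have "(\<Sum>q\<in>S. ?G w q * c b q) = (\<Sum>q\<in>S. (\<Sum>p\<in>S. ?G q p * m p) * c b q)"
        using m by (intro sum.cong) (auto simp: gram_commute)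
      also have "\<dots> = (\<Sum>p\<in>S. m p * (\<Sum>q\<in>S. ?G p q * c b q))"
        unfolding sum_distrib_left sum_distrib_right
        by (subst sum.swap) (simp add: gram_commute mult.left_commute mult.commute)
      also have "\<dots> = mu b" unfolding mu_def using c_inv by (intro sum.cong) auto
      finally show ?thesis .
    qed
    have c'_S: "(\<Sum>q\<in>S. ?G p q * c' b q) = (\<Sum>q\<in>S. ?G p q * c b q) - (\<Sum>q\<in>S. ?G p q * m q) * cw b" for p b
    proof -
      have "(\<Sum>q\<in>S. ?G p q * c' b q) = (\<Sum>q\<in>S. ?G p q * c b q - ?G p q * m q * cw b)"
        using insert.hyps by (intro sum.cong) (auto simp: c'_def algebra_simps)
      then show ?thesis by (simp add: sum_subtractf sum_distrib_right)
    qed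
    have c'_inv: "(\<Sum>q\<in>insert w S. ?G p q * c' b q) = b p" if "p \<in> insert w S" for p b
    proof (cases "p = w")
      case True
      have "(\<Sum>q\<in>insert w S. ?G p q * c' b q) = cw b + (\<Sum>q\<in>S. ?G w q * c' b q)"
        using insert.hyps insert.prems(2)[of w] True by (simp add: c'_def)
      also have "\<dots> = cw b * \<sigma>\<^sup>2 + mu b"
        unfolding c'_S mc \<sigma>(3) by (simp add: algebra_simps gram_commute[of J v w])
      also have "\<dots> = b w" using \<sigma>(1) by (simp add: cw_def)
      finally show ?thesis using True by simp
    next
      case False
      then have "p \<in> S" using that by simp
      then show ?thesis
        using insert.hyps c_inv m by (simp add: c'_S) (simp add: c'_def)
    qed
    have c'_dep: "c' b p = c' b' p" if "\<And>p. p \<in> insert w S \<Longrightarrow> b p = b' p" "p \<in> insert w S" for b b' p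
    proof -
      have "mu b = mu b'" unfolding mu_def using that by simp
      then have "cw b = cw b'" using that(1)[of w] by (simp add: cw_def)
      moreover have "p \<in> S \<Longrightarrow> c b p = c b' p" by (rule c_dep) (use that in auto)
      ultimately show ?thesis using that(2) by (auto simp: c'_def)
    qed
    define Q where "Q b = (\<Sum>p\<in>S. b p * (b p - c b p))" for b
    define Q' where "Q' b = (\<Sum>p\<in>insert w S. b p * (b p - c' b p))" for b
    have Q_meas: "Q \<in> borel_measurable (gauss B)"
      unfolding Q_def using comp c_meas by (auto intro!: borel_measurable_sum borel_measurable_times borel_measurable_diff)
    have Q'_meas: "Q' \<in> borel_measurable (gauss B)"
      unfolding Q'_def using comp c'_meas by (intro borel_measurable_sum borel_measurable_times borel_measurable_diff) auto
    \<comment> \<open>The quadratic form grows by twice the exponent in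
      \<open>std_gaussian_affine\<close> for mean \<open>mu b\<close> and scale \<sigma>, which is
      why one integration over the coordinate \<open>w\<close> reduces the claim to
      \<open>S\<close>.\<close>
    have Q': "Q' b = Q b + ((b w)\<^sup>2 - ((b w - mu b) / \<sigma>)\<^sup>2)" for b
    proof -
      have "(\<Sum>p\<in>S. b p * (b p - c' b p)) = (\<Sum>p\<in>S. b p * (b p - c b p) + m p * b p * cw b)"
        using insert.hyps by (intro sum.cong) (auto simp: c'_def algebra_simps)
      also have "\<dots> = Q b + mu b * cw b" by (simp add: sum.distrib Q_def mu_def sum_distrib_right)
      finally have "Q' b = b w * (b w - cw b) + Q b + mu b * cw b"
        using insert.hyps by (simp add: Q'_def) (simp add: c'_def)
      moreover have "((b w - mu b) / \<sigma>)\<^sup>2 = (b w - mu b) * cw b" by (simp add: cw_def power2_eq_square)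
      ultimately show ?thesis by (simp add: power2_eq_square algebra_simps)
    qed
    have upd_S: "mu (b(w := z)) = mu b" "Q (b(w := z)) = Q b" for b z
    proof -
      have "c (b(w := z)) p = c b p" if "p \<in> S" for p by (rule c_dep) (use insert.hyps that in auto)
      then show "mu (b(w := z)) = mu b" "Q (b(w := z)) = Q b"
        unfolding mu_def Q_def using insert.hyps by (auto intro!: sum.cong)
    qed
    have main: "(\<integral>\<^sup>+b. F b * ennreal (exp (Q' b / 2)) \<partial>gauss B) \<le> (\<integral>\<^sup>+g. F (project J B v g) \<partial>gauss J)"
      if F: "F \<in> borel_measurable (gauss B)"
        and F_dep: "\<And>b b'. b \<in> space (gauss B) \<Longrightarrow> b' \<in> space (gauss B) \<Longrightarrow> (\<And>p. p \<in> insert w S \<Longrightarrow> b p = b' p) \<Longrightarrow> F b = F b'"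
      for F :: "('b \<Rightarrow> real) \<Rightarrow> ennreal"
    proof -
      \<comment> \<open>Integrating out \<open>w\<close> against its conditional law leaves a
        function of the coordinates in \<open>S\<close> alone, as the induction hypothesis
        demands.\<close>
      define \<Psi> where "\<Psi> b = (\<integral>\<^sup>+z. F (b(w := mu b + \<sigma> * z)) \<partial>std_gaussian)" for b
      have pair: "(\<lambda>x. F ((fst x)(w := h x))) \<in> borel_measurable (gauss B \<Otimes>\<^sub>M std_gaussian)"
        if "h \<in> borel_measurable (gauss B \<Otimes>\<^sub>M std_gaussian)" for h
        by (rule measurable_compose[OF measurable_gauss_upd[OF wB that measurable_fst] F])
      have h: "(\<lambda>x. mu (fst x) + \<sigma> * snd x) \<in> borel_measurable (gauss B \<Otimes>\<^sub>M std_gaussian)"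
        using mu_meas by measurable
      interpret ps: sigma_finite_measure std_gaussian by (rule prob_space_imp_sigma_finite[OF prob_space_std_gaussian])
      have \<Psi>_meas: "\<Psi> \<in> borel_measurable (gauss B)"
        unfolding \<Psi>_def using pair[OF h] by (intro ps.borel_measurable_nn_integral) (simp add: case_prod_beta')
      have upd_space: "b(w := z) \<in> space (gauss B)" if "b \<in> space (gauss B)" for b z
        using that wB by (auto simp: space_PiM PiE_def extensional_def)
      have fib: "(\<lambda>z. F (b(w := z))) \<in> borel_measurable borel" if "b \<in> space (gauss B)" for b
        by (rule measurable_compose[OF measurable_gauss_upd[OF wB] F]) (use that in auto)
      have "(\<integral>\<^sup>+b. F b * ennreal (exp (Q' b / 2)) \<partial>gauss B) =
          (\<integral>\<^sup>+b. \<integral>\<^sup>+z. F (b(w := z)) * ennreal (exp (Q' (b(w := z)) / 2)) \<partial>std_gaussian \<partial>gauss B)"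
      proof (rule nn_integral_PiM_resample[where f="\<lambda>b. F b * ennreal (exp (Q' b / 2))", OF B wB prob_space_std_gaussian])
        note [measurable] = F Q'_meas
        show "(\<lambda>b. F b * ennreal (exp (Q' b / 2))) \<in> borel_measurable (gauss B)" by measurable
      qed
      also have "\<dots> \<le> (\<integral>\<^sup>+b. \<Psi> b * ennreal (exp (Q b / 2)) \<partial>gauss B)"
      proof (rule nn_integral_mono)
        fix b assume b: "b \<in> space (gauss B)"
        note [measurable] = fib[OF b]
        have "(\<integral>\<^sup>+z. F (b(w := z)) * ennreal (exp (Q' (b(w := z)) / 2)) \<partial>std_gaussian) \<le>
          (\<integral>\<^sup>+z. F (b(w := z)) * ennreal (exp ((z\<^sup>2 - ((z - mu b) / \<sigma>)\<^sup>2) / 2) / \<sigma>) * ennreal (exp (Q b / 2)) \<partial>std_gaussian)"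
        proof (rule nn_integral_mono)
          fix z :: real
          let ?x = "exp ((z\<^sup>2 - ((z - mu b) / \<sigma>)\<^sup>2) / 2)"
          have "exp (Q' (b(w := z)) / 2) = ?x * exp (Q b / 2)"
            unfolding Q' upd_S by (simp add: add_divide_distrib diff_divide_distrib flip: exp_add)
          \<comment> \<open>Since \<sigma> is at most 1, the normalising factor 1 / \<sigma> may be
            inserted at the cost of an inequality; over the whole induction these factors make up
            the determinant term.\<close>
          also have "\<dots> \<le> ?x / \<sigma> * exp (Q b / 2)"
            using \<sigma> by (intro mult_right_mono) (auto simp: field_simps)
          finally have "ennreal (exp (Q' (b(w := z)) / 2)) \<le> ennreal (?x / \<sigma>) * ennreal (exp (Q b / 2))"
            using \<sigma> by (simp add: ennreal_leI flip: ennreal_mult')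
          then show "F (b(w := z)) * ennreal (exp (Q' (b(w := z)) / 2)) \<le> F (b(w := z)) * ennreal (?x / \<sigma>) * ennreal (exp (Q b / 2))"
            unfolding mult.assoc by (intro mult_left_mono) auto
        qed
        also have "\<dots> = (\<integral>\<^sup>+z. F (b(w := z)) * ennreal (exp ((z\<^sup>2 - ((z - mu b) / \<sigma>)\<^sup>2) / 2) / \<sigma>) \<partial>std_gaussian) * ennreal (exp (Q b / 2))"
          by (rule nn_integral_multc) measurable
        also have "\<dots> = \<Psi> b * ennreal (exp (Q b / 2))"
          unfolding \<Psi>_def using std_gaussian_affine[OF fib[OF b] \<sigma>(1), of "mu b"] by simp
        finally show "(\<integral>\<^sup>+z. F (b(w := z)) * ennreal (exp (Q' (b(w := z)) / 2)) \<partial>std_gaussian) \<le> \<Psi> b * ennreal (exp (Q b / 2))" .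
      qed
      also have "\<dots> \<le> (\<integral>\<^sup>+g. \<Psi> (project J B v g) \<partial>gauss J)"
        unfolding Q_def
      proof (rule IH[OF \<Psi>_meas])
        fix b b' assume b: "b \<in> space (gauss B)" "b' \<in> space (gauss B)" "\<And>p. p \<in> S \<Longrightarrow> b p = b' p"
        have "mu b = mu b'" unfolding mu_def using b(3) by simp
        then show "\<Psi> b = \<Psi> b'"
          unfolding \<Psi>_def using b by (intro nn_integral_cong F_dep upd_space) auto
      qed
      \<comment> \<open>Replacing the component of \<open>g\<close> along \<open>u\<close> by
        \<open>z\<close> leaves the values at \<open>S\<close> unchanged, because those directions
        are orthogonal to \<open>u\<close>, and turns the value at \<open>w\<close> into
        \<open>mu + \<sigma> * z\<close>. Coordinates outside \<open>insert w S\<close> may differ,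
        so \<open>F_dep\<close> is essential here.\<close>
      also have "\<dots> = (\<integral>\<^sup>+g. \<integral>\<^sup>+z. F (project J B v (translate J u (z - (\<Sum>j\<in>J. u j * g j)) g)) \<partial>std_gaussian \<partial>gauss J)"
        unfolding \<Psi>_def
      proof (intro nn_integral_cong F_dep upd_space)
        fix g z assume g: "g \<in> space (gauss J)"
        show "project J B v g \<in> space (gauss B)" by (rule measurable_space[OF measurable_project g])
        have "translate J u s g \<in> space (gauss J)" for s
          using g by (auto simp: space_PiM PiE_def extensional_def translate_def)
        then show "project J B v (translate J u (z - (\<Sum>j\<in>J. u j * g j)) g) \<in> space (gauss B)"
          by (rule measurable_space[OF measurable_project])
        fix p assume p: "p \<in> insert w S"
        have tr: "project J B v (translate J u s g) p = project J B v g p + s * (\<Sum>j\<in>J. v p j * u j)" for s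
          using p wB SB by (auto simp: project_def translate_def distrib_left sum.distrib sum_distrib_left mult.left_commute)
        show "((project J B v g)(w := mu (project J B v g) + \<sigma> * z)) p =
            project J B v (translate J u (z - (\<Sum>j\<in>J. u j * g j)) g) p"
        proof (cases "p = w")
          case True
          have "mu (project J B v g) = (\<Sum>p\<in>S. m p * (\<Sum>j\<in>J. v p j * g j))"
            unfolding mu_def using SB by (intro sum.cong) (auto simp: project_def)
          moreover have "project J B v g w = (\<Sum>j\<in>J. v w j * g j)" using wB by (simp add: project_def)
          ultimately show ?thesis unfolding tr using True uw w_eq[of g] by (simp add: algebra_simps)
        next
          case False
          then show ?thesis unfolding tr using p u0 by simp
        qed
      qed
      also have "\<dots> = (\<integral>\<^sup>+g. F (project J B v g) \<partial>gauss J)"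
        by (rule gauss_resample_direction[where F="\<lambda>g. F (project J B v g)", OF J _ u1])
          (rule measurable_compose[OF measurable_project F])
      finally show ?thesis .
    qed
    show ?case
    proof (intro exI[of _ c'] conjI ballI allI impI)
      fix F :: "('b \<Rightarrow> real) \<Rightarrow> ennreal" assume "F \<in> borel_measurable (gauss B)"
        and "\<forall>b\<in>space (gauss B). \<forall>b'\<in>space (gauss B). (\<forall>p\<in>insert w S. b p = b' p) \<longrightarrow> F b = F b'"
      then show "(\<integral>\<^sup>+b. F b * ennreal (exp ((\<Sum>p\<in>insert w S. b p * (b p - c' b p)) / 2)) \<partial>gauss B)
          \<le> (\<integral>\<^sup>+g. F (project J B v g) \<partial>gauss J)"
        using main[of F] unfolding Q'_def by blast
    qed (use c'_meas c'_inv c'_dep in blast)+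
  qed
qed

text \<open>The inverse Gram matrix is replaced by an expression in its entries, since only sums
  over pairs of queried points can be followed one query at a time under the uniform law.\<close>

corollary gauss_project_density_ge:
  fixes v :: "'b \<Rightarrow> 'a \<Rightarrow> real" and F :: "('b \<Rightarrow> real) \<Rightarrow> ennreal"
  assumes J: "finite J" and B: "finite B" and S: "S \<subseteq> B" and unit: "\<And>p. p \<in> S \<Longrightarrow> gram J v p p = 1"
    and orth: "\<And>p q. p \<in> S \<Longrightarrow> q \<in> S \<Longrightarrow> p \<noteq> q \<Longrightarrow> \<bar>gram J v p q\<bar> \<le> \<epsilon>"
    and \<epsilon>: "0 \<le> \<epsilon>" "real (card S) * \<epsilon> \<le> 1 / 2"
    and F: "F \<in> borel_measurable (gauss B)"
      "\<And>b b'. b \<in> space (gauss B) \<Longrightarrow> b' \<in> space (gauss B) \<Longrightarrow> (\<And>p. p \<in> S \<Longrightarrow> b p = b' p) \<Longrightarrow> F b = F b'"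
    and E: "\<And>p q. E p q = (if p = q then 0 else gram J v p q)"
  shows "(\<integral>\<^sup>+b. F b * ennreal (exp ((\<Sum>p\<in>S. b p * (\<Sum>q\<in>S. E p q * b q)) / 2 - (\<Sum>p\<in>S. (\<Sum>q\<in>S. E p q * b q)\<^sup>2))) \<partial>gauss B)
    \<le> (\<integral>\<^sup>+g. F (project J B v g) \<partial>gauss J)"
proof -
  obtain c where c_inv: "\<And>b p. p \<in> S \<Longrightarrow> (\<Sum>q\<in>S. gram J v p q * c b q) = b p"
    and le: "(\<integral>\<^sup>+b. F b * ennreal (exp ((\<Sum>p\<in>S. b p * (b p - c b p)) / 2)) \<partial>gauss B) \<le>
      (\<integral>\<^sup>+g. F (project J B v g) \<partial>gauss J)"
    using gauss_project_density[OF J B S unit orth \<epsilon>] F by blast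
  have fin: "finite S" using S B finite_subset by blast
  show ?thesis
  proof (rule order_trans[OF nn_integral_mono le])
    fix b :: "'b \<Rightarrow> real"
    have "(\<Sum>p\<in>S. b p * (\<Sum>q\<in>S. E p q * b q)) - 2 * (\<Sum>p\<in>S. (\<Sum>q\<in>S. E p q * b q)\<^sup>2) \<le> (\<Sum>p\<in>S. b p * (b p - c b p))"
    proof (rule quadratic_form_inverse_ge[OF fin _ \<epsilon>])
      show "\<bar>E p q\<bar> \<le> \<epsilon>" if "p \<in> S" "q \<in> S" for p q using orth that \<epsilon> by (simp add: E)
      show "E p q = E q p" for p q by (simp add: E gram_commute)
      show "c b p + (\<Sum>q\<in>S. E p q * c b q) = b p" if p: "p \<in> S" for p
      proof -
        have "(\<Sum>q\<in>S. E p q * c b q) = (\<Sum>q\<in>S - {p}. E p q * c b q)"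
          unfolding sum.remove[OF fin p] by (simp add: E)
        also have "\<dots> = (\<Sum>q\<in>S - {p}. gram J v p q * c b q)"
          by (rule sum.cong[OF refl]) (auto simp: E)
        finally have "(\<Sum>q\<in>S. E p q * c b q) = \<dots>" .
        moreover have "(\<Sum>q\<in>S. gram J v p q * c b q) = c b p + (\<Sum>q\<in>S - {p}. gram J v p q * c b q)"
          unfolding sum.remove[OF fin p] using unit[OF p] by simp
        ultimately show ?thesis using c_inv[OF p, of b] by simp
      qed
    qed
    then have "(\<Sum>p\<in>S. b p * (\<Sum>q\<in>S. E p q * b q)) / 2 - (\<Sum>p\<in>S. (\<Sum>q\<in>S. E p q * b q)\<^sup>2)
        \<le> (\<Sum>p\<in>S. b p * (b p - c b p)) / 2" by linarith
    then show "F b * ennreal (exp ((\<Sum>p\<in>S. b p * (\<Sum>q\<in>S. E p q * b q)) / 2 - (\<Sum>p\<in>S. (\<Sum>q\<in>S. E p q * b q)\<^sup>2)))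
        \<le> F b * ennreal (exp ((\<Sum>p\<in>S. b p * (b p - c b p)) / 2))"
      by (rule mult_left_mono[OF ennreal_leI[OF iffD2[OF exp_le_cancel_iff]] zero_le])
  qed
qed

section \<open>Adaptive queries to independent coordinates\<close>

text \<open>The seed is frozen, so \<open>nq\<close> is a deterministic strategy. Coordinates may
  follow different laws, so that the same tail bounds serve the sign levels and the Gaussian
  levels.\<close>

locale adaptive =
  fixes I :: "'i set" and M :: "'i \<Rightarrow> real measure" and nq :: "nat \<Rightarrow> (nat \<Rightarrow> real) \<Rightarrow> 'i" and T :: nat
  assumes finite_I: "finite I"
    and prob_M: "\<And>p. prob_space (M p)"
    and sets_M: "\<And>p. sets (M p) = sets borel"
    and nq_measurable: "\<And>t. t < T \<Longrightarrow> nq t \<in> Pi\<^sub>M {..<t} (\<lambda>_. borel) \<rightarrow>\<^sub>M count_space I"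
begin

abbreviation law :: "('i \<Rightarrow> real) measure" where
  "law \<equiv> Pi\<^sub>M I M"

primrec run :: "('i \<Rightarrow> real) \<Rightarrow> nat \<Rightarrow> nat \<Rightarrow> real" where
  "run f 0 = (\<lambda>_. undefined)"
| "run f (Suc t) = (run f t)(t := f (nq t (run f t)))"

definition query :: "('i \<Rightarrow> real) \<Rightarrow> nat \<Rightarrow> 'i" where
  "query f t = nq t (run f t)"

definition visited :: "('i \<Rightarrow> real) \<Rightarrow> nat \<Rightarrow> 'i \<Rightarrow> bool" where
  "visited f t p \<longleftrightarrow> (\<exists>s<t. query f s = p)"

definition fresh :: "('i \<Rightarrow> real) \<Rightarrow> nat \<Rightarrow> 'i \<Rightarrow> bool" where
  "fresh f t p \<longleftrightarrow> query f t = p \<and> \<not> visited f t p"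

lemma visited_0[simp]: "\<not> visited f 0 p"
  by (simp add: visited_def)

lemma visited_Suc: "visited f (Suc t) p \<longleftrightarrow> visited f t p \<or> fresh f t p"
  by (auto simp: visited_def fresh_def less_Suc_eq)

lemma visited_mono: "visited f s p \<Longrightarrow> s \<le> t \<Longrightarrow> visited f t p"
  unfolding visited_def using order_less_le_trans by blast

lemma fresh_unique: "fresh f t p \<Longrightarrow> fresh f t q \<Longrightarrow> p = q"
  by (auto simp: fresh_def)

lemma sum_fresh:
  fixes h :: "'i \<Rightarrow> 'b :: comm_monoid_add"
  assumes "finite B" "p \<in> B" "fresh f t p"
  shows "(\<Sum>q\<in>B. if fresh f t q then h q else 0) = h p"
proof -
  have "fresh f t q \<longleftrightarrow> q = p" for q using assms(3) fresh_unique by blast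
  then show ?thesis using assms by simp
qed

text \<open>A run reads its input only at visited points. This later makes the event that exactly
  the points of \<open>W\<close> are visited a function of the coordinates in
  \<open>W\<close>.\<close>

lemma run_cong:
  assumes "\<And>p. visited f t p \<Longrightarrow> f p = f' p" "s \<le> t"
  shows "run f' s = run f s"
  using assms(2)
proof (induction s)
  case (Suc s)
  have "visited f t (nq s (run f s))"
    unfolding visited_def query_def using Suc.prems by (intro exI[of _ s]) simp
  then show ?case using Suc assms(1) by simp
qed simp

lemma
  assumes "\<And>p. visited f t p \<Longrightarrow> f p = f' p" "s \<le> t"
  shows query_cong: "query f' s = query f s" and visited_cong: "visited f' s p = visited f s p"
    and fresh_cong: "fresh f' s p = fresh f s p"
proof -
  have *: "query f' s = query f s" if "s \<le> t" for s
    using run_cong[OF assms(1) that] by (simp add: query_def)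
  then have **: "visited f' s p = visited f s p"
    using assms(2) by (auto simp: visited_def)
  show "query f' s = query f s" "visited f' s p = visited f s p" "fresh f' s p = fresh f s p"
    using *[OF assms(2)] ** by (auto simp: fresh_def)
qed

text \<open>The case \<open>s = t\<close> is included: query number \<open>t\<close> is chosen from
  the answers to earlier queries only, so altering a point unvisited before time \<open>t\<close>
  changes neither that choice nor its freshness, even if it is the very point being queried.\<close>

lemma
  assumes "\<not> visited f t p" "s \<le> t"
  shows visited_upd: "visited (f(p := z)) s q = visited f s q"
    and fresh_upd: "fresh (f(p := z)) s q = fresh f s q"
proof -
  have agree: "f q = (f(p := z)) q" if "visited f t q" for q using assms(1) that by auto
  show "visited (f(p := z)) s q = visited f s q" by (rule visited_cong[OF agree assms(2)])
  show "fresh (f(p := z)) s q = fresh f s q" by (rule fresh_cong[OF agree assms(2)])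
qed

lemma component_law: "p \<in> I \<Longrightarrow> (\<lambda>f. f p) \<in> borel_measurable law"
  using measurable_component_singleton[of p I M] measurable_cong_sets[OF refl sets_M] by blast

lemma measurable_query_run:
  "t \<le> T \<Longrightarrow> (\<lambda>f. run f t) \<in> law \<rightarrow>\<^sub>M Pi\<^sub>M {..<t} (\<lambda>_. borel)"
proof (induction t)
  case 0
  then show ?case by (intro measurable_PiM_single') (auto simp: PiE_def)
next
  case (Suc t)
  have q: "(\<lambda>f. nq t (run f t)) \<in> law \<rightarrow>\<^sub>M count_space I"
    using Suc by (intro measurable_compose[OF _ nq_measurable]) auto
  have "(\<lambda>f. f (nq t (run f t))) \<in> borel_measurable law"
    by (rule measurable_compose_countable'[where f="\<lambda>p f. f p", OF component_law q])
      (auto intro: countable_finite finite_I)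
  then show ?case unfolding run.simps
    using Suc by (intro measurable_fun_upd[where J="{..<t}"]) auto
qed

lemma measurable_query: "t < T \<Longrightarrow> (\<lambda>f. query f t) \<in> law \<rightarrow>\<^sub>M count_space I"
  unfolding query_def by (intro measurable_compose[OF measurable_query_run nq_measurable]) auto

lemma query_in: "t < T \<Longrightarrow> f \<in> space law \<Longrightarrow> query f t \<in> I"
  using measurable_space[OF measurable_query] by auto

lemma pred_query:
  assumes "t < T" "p \<in> I" shows "Measurable.pred law (\<lambda>f. query f t = p)"
proof -
  have "{f \<in> space law. query f t = p} = (\<lambda>f. query f t) -` {p} \<inter> space law" by auto
  also have "\<dots> \<in> sets law" using assms by (intro measurable_sets[OF measurable_query]) auto
  finally show ?thesis by (simp add: pred_def)
qed

lemma pred_visited: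
  assumes "t \<le> T" "p \<in> I" shows "Measurable.pred law (\<lambda>f. visited f t p)"
proof -
  have "{f \<in> space law. visited f t p} = (\<Union>s\<in>{..<t}. {f \<in> space law. query f s = p})"
    by (auto simp: visited_def)
  also have "\<dots> \<in> sets law"
    using pred_query[OF _ assms(2)] assms(1) by (intro sets.finite_UN) (auto simp: pred_def)
  finally show ?thesis by (simp add: pred_def)
qed

lemma pred_fresh: "t < T \<Longrightarrow> p \<in> I \<Longrightarrow> Measurable.pred law (\<lambda>f. fresh f t p)"
  unfolding fresh_def using pred_query pred_visited by (intro pred_intros_logic) auto

text \<open>A discrete stochastic integral along the run: a point contributes at its first query and
  repeated queries contribute nothing. Summing over all points with an indicator, instead of
  evaluating at \<open>query f s\<close>, makes every term refer to a fixed coordinate, which can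
  then be resampled.\<close>

definition qsum :: "'i set \<Rightarrow> (nat \<Rightarrow> 'i \<Rightarrow> ('i \<Rightarrow> real) \<Rightarrow> real) \<Rightarrow> ('i \<Rightarrow> real) \<Rightarrow> nat \<Rightarrow> real" where
  "qsum B c f t = (\<Sum>s<t. \<Sum>p\<in>B. if fresh f s p then c s p f else 0)"

lemma qsum_0[simp]: "qsum B c f 0 = 0"
  by (simp add: qsum_def)

lemma qsum_Suc_fresh:
  "finite B \<Longrightarrow> p \<in> B \<Longrightarrow> fresh f t p \<Longrightarrow> qsum B c f (Suc t) = qsum B c f t + c t p f"
  using sum_fresh[of B p f t "\<lambda>p. c t p f"] by (simp add: qsum_def)

lemma qsum_Suc_not_fresh:
  "\<not> (\<exists>p\<in>B. fresh f t p) \<Longrightarrow> qsum B c f (Suc t) = qsum B c f t"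
  by (simp add: qsum_def sum.neutral)

lemma measurable_qsum:
  assumes "t \<le> T" "B \<subseteq> I" "\<And>s p. s < t \<Longrightarrow> p \<in> B \<Longrightarrow> c s p \<in> borel_measurable law"
  shows "(\<lambda>f. qsum B c f t) \<in> borel_measurable law"
  unfolding qsum_def
proof (intro borel_measurable_sum)
  fix s p assume s: "s \<in> {..<t}" and p: "p \<in> B"
  have [measurable]: "c s p \<in> borel_measurable law" using assms(3) s p by auto
  have [measurable]: "Measurable.pred law (\<lambda>f. fresh f s p)" using s p assms by (intro pred_fresh) auto
  show "(\<lambda>f. if fresh f s p then c s p f else 0) \<in> borel_measurable law" using s p by measurable
qed

lemma qsum_le:
  assumes "finite B" "\<And>s p. s < t \<Longrightarrow> p \<in> B \<Longrightarrow> fresh f s p \<Longrightarrow> c s p f \<le> x" "0 \<le> x"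
  shows "qsum B c f t \<le> real t * x"
proof -
  have "(\<Sum>p\<in>B. if fresh f s p then c s p f else 0) \<le> x" if s: "s < t" for s
  proof (cases "\<exists>p\<in>B. fresh f s p")
    case True
    then obtain p where p: "p \<in> B" "fresh f s p" by blast
    show ?thesis using assms(2)[OF s p] sum_fresh[OF assms(1) p, of "\<lambda>p. c s p f"] by simp
  next
    case False
    then show ?thesis using assms by (simp add: sum.neutral)
  qed
  then have "qsum B c f t \<le> (\<Sum>s<t. x)" unfolding qsum_def by (intro sum_mono) auto
  then show ?thesis by simp
qed

text \<open>Every visited point is fresh at exactly one time, so for coefficients that ignore time
  the order of the queries disappears.\<close>

lemma qsum_visited:
  "qsum B (\<lambda>_. c) f t = (\<Sum>p\<in>B. if visited f t p then c p f else 0)"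
proof (induction t)
  case (Suc t)
  have "qsum B (\<lambda>_. c) f (Suc t) = (\<Sum>p\<in>B. (if visited f t p then c p f else 0) + (if fresh f t p then c p f else 0))"
    using Suc by (simp add: qsum_def sum.distrib)
  also have "\<dots> = (\<Sum>p\<in>B. if visited f (Suc t) p then c p f else 0)"
    by (intro sum.cong) (auto simp: visited_Suc fresh_def)
  finally show ?case .
qed (simp add: qsum_def)

text \<open>Predictability without a filtration: resampling the point first read at time
  \<open>s\<close> does not change the coefficients in force up to time \<open>s\<close>. The value
  \<open>r = s\<close> matters, since a coefficient has to be independent of the fresh answer that
  it multiplies. Only coefficients at fresh points are constrained, because \<open>qsum\<close> sees
  no others.\<close>

definition predictable :: "'i set \<Rightarrow> (nat \<Rightarrow> 'i \<Rightarrow> ('i \<Rightarrow> real) \<Rightarrow> real) \<Rightarrow> bool" where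
  "predictable B c \<longleftrightarrow> (\<forall>s<T. \<forall>p\<in>B. \<forall>f z r q. fresh f s p \<longrightarrow> r \<le> s \<longrightarrow> q \<in> B \<longrightarrow> fresh f r q \<longrightarrow>
    c r q (f(p := z)) = c r q f)"

lemma qsum_upd:
  assumes c: "predictable B c" and s: "s < T" "p \<in> B" "fresh f s p"
  shows "qsum B (\<lambda>t q f. h (c t q f)) (f(p := z)) s = qsum B (\<lambda>t q f. h (c t q f)) f s"
    and "qsum B (\<lambda>t q f. c t q f * f q) (f(p := z)) s = qsum B (\<lambda>t q f. c t q f * f q) f s"
proof -
  have nv: "\<not> visited f s p" using s by (simp add: fresh_def)
  have fr: "fresh (f(p := z)) r q = fresh f r q" if "r < s" for r q
    using fresh_upd[OF nv] that by simp
  have ce: "c r q (f(p := z)) = c r q f" if "r < s" "q \<in> B" "fresh f r q" for r q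
    using c that s unfolding predictable_def by (metis less_imp_le)
  have ne: "q \<noteq> p" if "r < s" "fresh f r q" for r q
    using nv that by (auto simp: fresh_def visited_def)
  show "qsum B (\<lambda>t q f. h (c t q f)) (f(p := z)) s = qsum B (\<lambda>t q f. h (c t q f)) f s"
    unfolding qsum_def using fr ce by (intro sum.cong) auto
  show "qsum B (\<lambda>t q f. c t q f * f q) (f(p := z)) s = qsum B (\<lambda>t q f. c t q f * f q) f s"
    unfolding qsum_def
  proof (intro sum.cong refl)
    fix r q assume "r \<in> {..<s}" "q \<in> B"
    then show "(if fresh (f(p := z)) r q then c r q (f(p := z)) * (f(p := z)) q else 0) =
      (if fresh f r q then c r q f * f q else 0)"
      using fr[of r q] ce[of r q] ne[of r q] by auto
  qed
qed

text \<open>A fresh coordinate is independent of the past, so resampling it shows that each query multiplies the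
  exponential by a factor of conditional mean at most \<open>1\<close>.\<close>
lemma nn_integral_exp_qsum_le:
  assumes B: "B \<subseteq> I"
    and sub: "\<And>p m. p \<in> B \<Longrightarrow> (\<integral>\<^sup>+z. ennreal (exp (m * z - m\<^sup>2 / 2)) \<partial>M p) \<le> 1"
    and c_meas: "\<And>s p. s < T \<Longrightarrow> p \<in> B \<Longrightarrow> c s p \<in> borel_measurable law"
    and c: "predictable B c" and t: "t \<le> T"
  shows "(\<integral>\<^sup>+f. ennreal (exp (qsum B (\<lambda>s p f. c s p f * f p) f t - qsum B (\<lambda>s p f. (c s p f)\<^sup>2) f t / 2)) \<partial>law) \<le> 1"
  using t
proof (induction t)
  case 0
  interpret prob_space law by (intro prob_space_PiM prob_M)
  show ?case by (simp add: qsum_def emeasure_space_1)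
next
  case (Suc t)
  have tT: "t < T" using Suc by simp
  have finB: "finite B" using B finite_I finite_subset by blast
  define Z where "Z f = exp (qsum B (\<lambda>s p f. c s p f * f p) f t - qsum B (\<lambda>s p f. (c s p f)\<^sup>2) f t / 2)" for f
  have comp: "(\<lambda>f. f p) \<in> borel_measurable law" if "p \<in> B" for p using that B by (intro component_law) auto
  have Z_meas: "Z \<in> borel_measurable law"
  proof -
    have [measurable]: "(\<lambda>f. qsum B (\<lambda>s p f. c s p f * f p) f t) \<in> borel_measurable law"
      "(\<lambda>f. qsum B (\<lambda>s p f. (c s p f)\<^sup>2) f t) \<in> borel_measurable law"
      using Suc.prems B c_meas comp by (auto intro!: measurable_qsum borel_measurable_times borel_measurable_power)
    show ?thesis unfolding Z_def by measurable
  qed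
  \<comment> \<open>The new factor is split by the point of \<open>B\<close> that is fresh, since a
    coordinate can be resampled only for a fixed \<open>p\<close>. The summand \<open>N\<close>
    covers a repeated query or one outside \<open>B\<close>, where the exponential stays as it
    was.\<close>
  define D where "D p f = (if fresh f t p then ennreal (Z f * exp (c t p f * f p - (c t p f)\<^sup>2 / 2)) else 0)" for p f
  define N where "N f = (if \<exists>p\<in>B. fresh f t p then 0 else ennreal (Z f))" for f
  have fr_meas: "Measurable.pred law (\<lambda>f. fresh f t p)" if "p \<in> B" for p
    using tT that B by (intro pred_fresh) auto
  have D_meas: "D p \<in> borel_measurable law" if p: "p \<in> B" for p
  proof -
    note [measurable] = Z_meas comp[OF p] c_meas[OF tT p] fr_meas[OF p]
    show ?thesis unfolding D_def by measurable
  qed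
  have N_meas: "N \<in> borel_measurable law"
  proof -
    note [measurable] = Z_meas
    have "{f \<in> space law. \<exists>p\<in>B. fresh f t p} = (\<Union>p\<in>B. {f \<in> space law. fresh f t p})" by auto
    also have "\<dots> \<in> sets law" using fr_meas finB by (intro sets.finite_UN) (auto simp: pred_def)
    finally have [measurable]: "Measurable.pred law (\<lambda>f. \<exists>p\<in>B. fresh f t p)" by (simp add: pred_def)
    show ?thesis unfolding N_def by measurable
  qed
  have D_sum: "(\<Sum>p\<in>B. D p f) = D p f" if p: "p \<in> B" "fresh f t p" for p f
    using sum_fresh[OF finB p] p(2) unfolding D_def by simp
  have split: "ennreal (exp (qsum B (\<lambda>s p f. c s p f * f p) f (Suc t) - qsum B (\<lambda>s p f. (c s p f)\<^sup>2) f (Suc t) / 2))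
      = (\<Sum>p\<in>B. D p f) + N f" for f
  proof (cases "\<exists>p\<in>B. fresh f t p")
    case True
    then obtain p where p: "p \<in> B" "fresh f t p" by blast
    have "exp (qsum B (\<lambda>s p f. c s p f * f p) f (Suc t) - qsum B (\<lambda>s p f. (c s p f)\<^sup>2) f (Suc t) / 2) =
        Z f * exp (c t p f * f p - (c t p f)\<^sup>2 / 2)"
      unfolding qsum_Suc_fresh[OF finB p] Z_def by (simp add: add_divide_distrib flip: exp_add)
    then show ?thesis
      unfolding D_sum[OF p] using p by (auto simp: N_def D_def)
  next
    case False
    then show ?thesis unfolding qsum_Suc_not_fresh[OF False] by (auto simp: N_def D_def Z_def sum.neutral)
  qed
  have D_le: "(\<integral>\<^sup>+f. D p f \<partial>law) \<le> (\<integral>\<^sup>+f. (if fresh f t p then ennreal (Z f) else 0) \<partial>law)" if p: "p \<in> B" for p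
  proof -
    have pI: "p \<in> I" using p B by auto
    have "(\<integral>\<^sup>+f. D p f \<partial>law) = (\<integral>\<^sup>+f. \<integral>\<^sup>+z. D p (f(p := z)) \<partial>M p \<partial>law)"
      by (rule nn_integral_PiM_resample[OF finite_I pI prob_M D_meas[OF p]])
    also have "\<dots> \<le> (\<integral>\<^sup>+f. (if fresh f t p then ennreal (Z f) else 0) \<partial>law)"
    proof (rule nn_integral_mono)
      fix f
      show "(\<integral>\<^sup>+z. D p (f(p := z)) \<partial>M p) \<le> (if fresh f t p then ennreal (Z f) else 0)"
      proof (cases "fresh f t p")
        case True
        then have nv: "\<not> visited f t p" by (simp add: fresh_def)
        have "D p (f(p := z)) = ennreal (Z f) * ennreal (exp (c t p f * z - (c t p f)\<^sup>2 / 2))" for z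
        proof -
          have "c t p (f(p := z)) = c t p f" using c True tT p unfolding predictable_def by blast
          moreover have "Z (f(p := z)) = Z f" unfolding Z_def using qsum_upd[OF c tT p True] by simp
          moreover have "fresh (f(p := z)) t p" using fresh_upd[OF nv] True by simp
          ultimately show ?thesis by (simp add: D_def ennreal_mult' Z_def)
        qed
        then have "(\<integral>\<^sup>+z. D p (f(p := z)) \<partial>M p) = (\<integral>\<^sup>+z. ennreal (Z f) * ennreal (exp (c t p f * z - (c t p f)\<^sup>2 / 2)) \<partial>M p)"
          by simp
        also have "\<dots> = ennreal (Z f) * (\<integral>\<^sup>+z. ennreal (exp (c t p f * z - (c t p f)\<^sup>2 / 2)) \<partial>M p)"
          by (rule nn_integral_cmult) (simp add: measurable_cong_sets[OF sets_M refl])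
        also have "\<dots> \<le> ennreal (Z f) * 1" by (intro mult_left_mono sub p) simp
        finally show ?thesis using True by simp
      next
        case False
        \<comment> \<open>Resampling cannot make \<open>p\<close> fresh: if it were fresh after the
          change, restoring the value \<open>f p\<close> would preserve freshness.\<close>
        have "D p (f(p := z)) = 0" for z
        proof (cases "fresh (f(p := z)) t p")
          case True
          then have "\<not> visited (f(p := z)) t p" by (simp add: fresh_def)
          from fresh_upd[OF this order_refl, of "f p" p] True False show ?thesis by simp
        qed (simp add: D_def)
        then show ?thesis by simp
      qed
    qed
    finally show ?thesis .
  qed
  have "(\<integral>\<^sup>+f. (\<Sum>p\<in>B. D p f) + N f \<partial>law) = (\<Sum>p\<in>B. \<integral>\<^sup>+f. D p f \<partial>law) + (\<integral>\<^sup>+f. N f \<partial>law)"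
    using D_meas N_meas by (simp add: nn_integral_add nn_integral_sum)
  also have "\<dots> \<le> (\<Sum>p\<in>B. \<integral>\<^sup>+f. (if fresh f t p then ennreal (Z f) else 0) \<partial>law) + (\<integral>\<^sup>+f. N f \<partial>law)"
    by (intro add_right_mono sum_mono D_le)
  also have "\<dots> = (\<integral>\<^sup>+f. (\<Sum>p\<in>B. if fresh f t p then ennreal (Z f) else 0) + N f \<partial>law)"
  proof -
    have "(\<lambda>f. if fresh f t p then ennreal (Z f) else 0) \<in> borel_measurable law" if p: "p \<in> B" for p
    proof -
      note [measurable] = Z_meas fr_meas[OF p]
      show ?thesis by measurable
    qed
    then show ?thesis using N_meas by (simp add: nn_integral_add nn_integral_sum)
  qed
  also have "\<dots> = (\<integral>\<^sup>+f. ennreal (Z f) \<partial>law)"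
  proof (rule nn_integral_cong)
    fix f
    show "(\<Sum>p\<in>B. if fresh f t p then ennreal (Z f) else 0) + N f = ennreal (Z f)"
    proof (cases "\<exists>p\<in>B. fresh f t p")
      case True
      then obtain p where p: "p \<in> B" "fresh f t p" by blast
      show ?thesis using sum_fresh[OF finB p] True by (simp add: N_def)
    next
      case False
      then show ?thesis by (simp add: N_def sum.neutral)
    qed
  qed
  also have "\<dots> \<le> 1" using Suc by (simp add: Z_def)
  finally show ?case unfolding split .
qed

text \<open>A Freedman-type bound. The quadratic variation is random, hence it is bounded inside the
  event. Markov's inequality is applied to the exponential supermartingale with coefficients scaled
  by \<open>l = a / v\<close>, the value that maximises
  \<open>l * a - l\<^sup>2 * v / 2\<close>.\<close>

lemma qsum_tail_aux:
  assumes B: "B \<subseteq> I"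
    and sub: "\<And>p m. p \<in> B \<Longrightarrow> (\<integral>\<^sup>+z. ennreal (exp (m * z - m\<^sup>2 / 2)) \<partial>M p) \<le> 1"
    and c_meas: "\<And>s p. s < T \<Longrightarrow> p \<in> B \<Longrightarrow> c s p \<in> borel_measurable law"
    and c: "predictable B c" and t: "t \<le> T" and v: "0 < v" "0 \<le> a"
  shows "measure law {f \<in> space law. a \<le> qsum B (\<lambda>s p f. c s p f * f p) f t \<and> qsum B (\<lambda>s p f. (c s p f)\<^sup>2) f t \<le> v}
    \<le> exp (- a\<^sup>2 / (2 * v))"
proof -
  interpret prob_space law by (intro prob_space_PiM prob_M)
  define l where "l = a / v"
  let ?S = "\<lambda>f. qsum B (\<lambda>s p f. c s p f * f p) f t" and ?V = "\<lambda>f. qsum B (\<lambda>s p f. (c s p f)\<^sup>2) f t"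
  let ?E = "{f \<in> space law. a \<le> ?S f \<and> ?V f \<le> v}"
  have comp: "(\<lambda>f. f p) \<in> borel_measurable law" if "p \<in> B" for p using that B by (intro component_law) auto
  have [measurable]: "?S \<in> borel_measurable law" "?V \<in> borel_measurable law"
    using t B c_meas comp by (auto intro!: measurable_qsum borel_measurable_times borel_measurable_power)
  have l_meas: "(\<lambda>f. l * c s p f) \<in> borel_measurable law" if "s < T" "p \<in> B" for s p
    using c_meas[OF that] by simp
  have l_pred: "predictable B (\<lambda>s p f. l * c s p f)" using c unfolding predictable_def by fastforce
  have q1: "qsum B (\<lambda>s p f. l * c s p f * f p) f t = l * ?S f" for f
    by (simp add: qsum_def sum_distrib_left mult.assoc if_distrib cong: if_cong)
  have q2: "qsum B (\<lambda>s p f. (l * c s p f)\<^sup>2) f t = l\<^sup>2 * ?V f" for f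
    by (simp add: qsum_def sum_distrib_left power_mult_distrib if_distrib cong: if_cong)
  have le1: "(\<integral>\<^sup>+f. ennreal (exp (l * ?S f - l\<^sup>2 * ?V f / 2)) \<partial>law) \<le> 1"
    using nn_integral_exp_qsum_le[OF B sub l_meas l_pred t] unfolding q1 q2 by simp
  have "emeasure law ?E = (\<integral>\<^sup>+f. indicator ?E f \<partial>law)" by simp
  also have "\<dots> \<le> (\<integral>\<^sup>+f. ennreal (exp (- a\<^sup>2 / (2 * v))) * ennreal (exp (l * ?S f - l\<^sup>2 * ?V f / 2)) \<partial>law)"
  proof (rule nn_integral_mono)
    fix f
    show "indicator ?E f \<le> ennreal (exp (- a\<^sup>2 / (2 * v))) * ennreal (exp (l * ?S f - l\<^sup>2 * ?V f / 2))"
    proof (cases "f \<in> ?E")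
      case True
      have "0 \<le> l" using v by (simp add: l_def)
      then have "l * a \<le> l * ?S f" "l\<^sup>2 * ?V f \<le> l\<^sup>2 * v"
        using True by (auto intro!: mult_left_mono)
      moreover have "l * a = a\<^sup>2 / v" "l\<^sup>2 * v = a\<^sup>2 / v" using v by (auto simp: l_def power2_eq_square field_simps)
      moreover have "a\<^sup>2 / (2 * v) = a\<^sup>2 / v / 2" by simp
      ultimately have "0 \<le> - a\<^sup>2 / (2 * v) + (l * ?S f - l\<^sup>2 * ?V f / 2)" by linarith
      then have "1 \<le> exp (- a\<^sup>2 / (2 * v)) * exp (l * ?S f - l\<^sup>2 * ?V f / 2)"
        by (simp flip: exp_add)
      then show ?thesis using True
        by (simp add: indicator_def flip: ennreal_mult')
    qed auto
  qed
  also have "\<dots> = ennreal (exp (- a\<^sup>2 / (2 * v))) * (\<integral>\<^sup>+f. ennreal (exp (l * ?S f - l\<^sup>2 * ?V f / 2)) \<partial>law)"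
    by (rule nn_integral_cmult) measurable
  also have "\<dots> \<le> ennreal (exp (- a\<^sup>2 / (2 * v))) * 1" using le1 by (intro mult_left_mono) auto
  finally show ?thesis by (simp add: emeasure_eq_measure)
qed

lemma qsum_tail:
  assumes B: "B \<subseteq> I"
    and sub: "\<And>p m. p \<in> B \<Longrightarrow> (\<integral>\<^sup>+z. ennreal (exp (m * z - m\<^sup>2 / 2)) \<partial>M p) \<le> 1"
    and c_meas: "\<And>s p. s < T \<Longrightarrow> p \<in> B \<Longrightarrow> c s p \<in> borel_measurable law"
    and c: "predictable B c" and t: "t \<le> T" and v: "0 < v" "0 \<le> a"
  shows "measure law {f \<in> space law. a \<le> \<bar>qsum B (\<lambda>s p f. c s p f * f p) f t\<bar> \<and> qsum B (\<lambda>s p f. (c s p f)\<^sup>2) f t \<le> v}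
    \<le> 2 * exp (- a\<^sup>2 / (2 * v))"
proof -
  interpret prob_space law by (intro prob_space_PiM prob_M)
  let ?S = "\<lambda>f. qsum B (\<lambda>s p f. c s p f * f p) f t" and ?V = "\<lambda>f. qsum B (\<lambda>s p f. (c s p f)\<^sup>2) f t"
  have comp: "(\<lambda>f. f p) \<in> borel_measurable law" if "p \<in> B" for p using that B by (intro component_law) auto
  have [measurable]: "?S \<in> borel_measurable law" "?V \<in> borel_measurable law"
    using t B c_meas comp by (auto intro!: measurable_qsum borel_measurable_times borel_measurable_power)
  have 1: "measure law {f \<in> space law. a \<le> ?S f \<and> ?V f \<le> v} \<le> exp (- a\<^sup>2 / (2 * v))"
    by (rule qsum_tail_aux[OF B sub c_meas c t v])
  have n_meas: "(\<lambda>f. - c s p f) \<in> borel_measurable law" if "s < T" "p \<in> B" for s p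
    using c_meas[OF that] by simp
  have n_pred: "predictable B (\<lambda>s p f. - c s p f)" using c unfolding predictable_def by fastforce
  have q1: "qsum B (\<lambda>s p f. - c s p f * f p) f t = - ?S f" for f
    by (simp add: qsum_def if_distrib flip: sum_negf cong: if_cong)
  have 2: "measure law {f \<in> space law. a \<le> - ?S f \<and> ?V f \<le> v} \<le> exp (- a\<^sup>2 / (2 * v))"
    using qsum_tail_aux[OF B sub n_meas n_pred t v] unfolding q1 power2_minus by simp
  have "{f \<in> space law. a \<le> \<bar>?S f\<bar> \<and> ?V f \<le> v} =
      {f \<in> space law. a \<le> ?S f \<and> ?V f \<le> v} \<union> {f \<in> space law. a \<le> - ?S f \<and> ?V f \<le> v}"
    by (auto simp: abs_real_def split: if_splits)
  then have "measure law {f \<in> space law. a \<le> \<bar>?S f\<bar> \<and> ?V f \<le> v} \<le>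
      measure law {f \<in> space law. a \<le> ?S f \<and> ?V f \<le> v} + measure law {f \<in> space law. a \<le> - ?S f \<and> ?V f \<le> v}"
    by (simp add: measure_Un_le)
  then show ?thesis using 1 2 by linarith
qed

end

text \<open>A non-adaptive algorithm that queries the points of \<open>B\<close> one after the other.\<close>
lemma slice_tail:
  fixes M :: "'i \<Rightarrow> real measure"
  assumes I: "finite I" and prob: "\<And>p. prob_space (M p)" and sets: "\<And>p. sets (M p) = sets borel"
    and B: "B \<subseteq> I" and sub: "\<And>p m. p \<in> B \<Longrightarrow> (\<integral>\<^sup>+z. ennreal (exp (m * z - m\<^sup>2 / 2)) \<partial>M p) \<le> 1"
    and c_meas: "\<And>p. p \<in> B \<Longrightarrow> c p \<in> borel_measurable (Pi\<^sub>M I M)"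
    and c_upd: "\<And>p q f z. p \<in> B \<Longrightarrow> q \<in> B \<Longrightarrow> c p (f(q := z)) = c p f"
    and v: "0 < v" "0 \<le> a"
  shows "measure (Pi\<^sub>M I M) {f \<in> space (Pi\<^sub>M I M). a \<le> \<bar>\<Sum>p\<in>B. c p f * f p\<bar> \<and> (\<Sum>p\<in>B. (c p f)\<^sup>2) \<le> v}
    \<le> 2 * exp (- a\<^sup>2 / (2 * v))"
proof -
  have finB: "finite B" using B I finite_subset by blast
  obtain e where e: "bij_betw e {0..<card B} B" using ex_bij_betw_nat_finite[OF finB] by blast
  have nq: "(\<lambda>_. e t) \<in> Pi\<^sub>M {..<t} (\<lambda>_. borel :: real measure) \<rightarrow>\<^sub>M count_space I" if "t < card B" for t
    using bij_betwE[OF e] B that by (intro measurable_const) auto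
  interpret adaptive I M "\<lambda>t _. e t" "card B"
    by (rule adaptive.intro[OF I prob sets nq])
  have vis: "visited f (card B) p" if "p \<in> B" for f p
  proof -
    have "p \<in> e ` {0..<card B}" using e that by (simp add: bij_betw_def)
    then obtain s where "s < card B" "e s = p" by auto
    then show ?thesis unfolding visited_def query_def by blast
  qed
  have q: "qsum B (\<lambda>_ p f. h p f) f (card B) = (\<Sum>p\<in>B. h p f)" for h :: "'i \<Rightarrow> ('i \<Rightarrow> real) \<Rightarrow> real" and f
    unfolding qsum_visited using vis by (intro sum.cong) auto
  have pred: "predictable B (\<lambda>_. c)" using c_upd unfolding predictable_def by blast
  show ?thesis
    using qsum_tail[OF B sub _ pred order_refl v] c_meas unfolding q by blast
qed

section \<open>The quadratic exponent as a martingale along the run\<close>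

locale correlated = adaptive +
  fixes B :: "'a set" and e :: "('a \<Rightarrow> real) \<Rightarrow> 'a \<Rightarrow> 'a \<Rightarrow> real"
  assumes B_subset: "B \<subseteq> I"
    and subgaussian: "\<And>p m. p \<in> B \<Longrightarrow> (\<integral>\<^sup>+z. ennreal (exp (m * z - m\<^sup>2 / 2)) \<partial>M p) \<le> 1"
    and e_measurable: "\<And>p q. p \<in> B \<Longrightarrow> q \<in> B \<Longrightarrow> (\<lambda>f. e f p q) \<in> borel_measurable law"
    and e_upd: "\<And>f p q r z. r \<in> B \<Longrightarrow> e (f(r := z)) p q = e f p q"
    and e_commute: "\<And>f p q. e f p q = e f q p"
    and e_diagonal: "\<And>f p. e f p p = 0"
begin

lemma finite_B: "finite B"
  using B_subset finite_I finite_subset by blast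

definition pull :: "('a \<Rightarrow> real) \<Rightarrow> nat \<Rightarrow> 'a \<Rightarrow> real" where
  "pull f t p = (\<Sum>q\<in>B. if visited f t q then e f p q * f q else 0)"

text \<open>Half of the quadratic form of \<open>e\<close> on the visited values, written so that a
  fresh answer is multiplied by its \<open>pull\<close> from strictly earlier answers;
  \<open>sum_visited_pull\<close> identifies the two.\<close>

definition energy :: "('a \<Rightarrow> real) \<Rightarrow> nat \<Rightarrow> real" where
  "energy f t = qsum B (\<lambda>s p f. pull f s p * f p) f t"

lemma pull_qsum: "pull f t p = qsum B (\<lambda>_ q f. e f p q * f q) f t"
  unfolding pull_def qsum_visited ..

lemma comp_B: "p \<in> B \<Longrightarrow> (\<lambda>f. f p) \<in> borel_measurable law"
  using B_subset by (intro component_law) auto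

lemma measurable_pull: "t \<le> T \<Longrightarrow> p \<in> B \<Longrightarrow> (\<lambda>f. pull f t p) \<in> borel_measurable law"
  unfolding pull_qsum using B_subset by (intro measurable_qsum borel_measurable_times e_measurable comp_B) auto

lemma measurable_energy: "t \<le> T \<Longrightarrow> (\<lambda>f. energy f t) \<in> borel_measurable law"
  unfolding energy_def using B_subset by (intro measurable_qsum borel_measurable_times measurable_pull comp_B) auto

text \<open>A fresh point adds a row and a column to the quadratic form. By symmetry both contribute
  its value times its pull, and the zero diagonal means that there is no square of the new
  value.\<close>

lemma sum_visited_pull:
  "(\<Sum>p\<in>B. if visited f t p then f p * pull f t p else 0) = 2 * energy f t"
proof (induction t)
  case 0
  then show ?case by (simp add: energy_def)
next
  case (Suc t)
  show ?case
  proof (cases "\<exists>p\<in>B. fresh f t p")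
    case True
    then obtain p0 where p0: "p0 \<in> B" "fresh f t p0" by blast
    have nv: "\<not> visited f t p0" using p0 by (simp add: fresh_def)
    have vis: "visited f (Suc t) p \<longleftrightarrow> visited f t p \<or> p = p0" for p
      unfolding visited_Suc using p0 fresh_unique by blast
    have pull: "pull f (Suc t) p = pull f t p + e f p p0 * f p0" for p
      unfolding pull_qsum by (rule qsum_Suc_fresh[OF finite_B p0])
    have "(\<Sum>p\<in>B. if visited f (Suc t) p then f p * pull f (Suc t) p else 0) =
      (\<Sum>p\<in>B. (if visited f t p then f p * pull f t p else 0) +
        f p0 * (if visited f t p then e f p0 p * f p else 0) + (if p = p0 then f p0 * pull f t p0 else 0))"
    proof (rule sum.cong[OF refl])
      fix p assume "p \<in> B"
      show "(if visited f (Suc t) p then f p * pull f (Suc t) p else 0) =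
        (if visited f t p then f p * pull f t p else 0) +
        f p0 * (if visited f t p then e f p0 p * f p else 0) + (if p = p0 then f p0 * pull f t p0 else 0)"
      proof (cases "p = p0")
        case True
        then show ?thesis using nv vis[of p] pull[of p] e_diagonal[of f p0] by simp
      next
        case False
        then show ?thesis using vis[of p] pull[of p] e_commute[of f p p0] by (simp add: algebra_simps)
      qed
    qed
    also have "\<dots> = 2 * energy f t + f p0 * pull f t p0 + f p0 * pull f t p0"
      using Suc p0 finite_B by (simp add: sum.distrib pull_def flip: sum_distrib_left)
    also have "\<dots> = 2 * energy f (Suc t)"
      using qsum_Suc_fresh[OF finite_B p0, of "\<lambda>s p f. pull f s p * f p"] by (simp add: energy_def)
    finally show ?thesis .
  next
    case False
    have vis: "visited f (Suc t) p \<longleftrightarrow> visited f t p" if "p \<in> B" for p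
      using False that by (auto simp: visited_Suc)
    have pull: "pull f (Suc t) p = pull f t p" for p
      unfolding pull_qsum by (rule qsum_Suc_not_fresh[OF False])
    have "energy f (Suc t) = energy f t"
      unfolding energy_def by (rule qsum_Suc_not_fresh[OF False])
    then show ?thesis using Suc vis by (simp add: pull cong: if_cong)
  qed
qed

text \<open>For a fixed \<open>p\<close> the coefficients \<open>e f p q\<close> are untouched by
  resampling inside \<open>B\<close>, so the pull is itself a stochastic integral. At most
  \<open>T\<close> fresh points with coefficients at most \<epsilon> bound its quadratic
  variation.\<close>

lemma pull_tail:
  assumes p: "p \<in> B" and t: "t \<le> T" and v: "0 < v" "real T * \<epsilon>\<^sup>2 \<le> v" "0 \<le> a"
  shows "measure law {f \<in> space law. a \<le> \<bar>pull f t p\<bar> \<and> (\<forall>p\<in>B. \<forall>q\<in>B. \<bar>e f p q\<bar> \<le> \<epsilon>)} \<le> 2 * exp (- a\<^sup>2 / (2 * v))"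
proof -
  interpret prob_space law by (intro prob_space_PiM prob_M)
  have pred: "predictable B (\<lambda>_ q f. e f p q)"
    unfolding predictable_def using e_upd by blast
  have em: "(\<lambda>f. e f p q) \<in> borel_measurable law" if "q \<in> B" for q using e_measurable[OF p that] .
  let ?A = "{f \<in> space law. a \<le> \<bar>qsum B (\<lambda>_ q f. e f p q * f q) f t\<bar> \<and> qsum B (\<lambda>_ q f. (e f p q)\<^sup>2) f t \<le> v}"
  have "{f \<in> space law. a \<le> \<bar>pull f t p\<bar> \<and> (\<forall>p\<in>B. \<forall>q\<in>B. \<bar>e f p q\<bar> \<le> \<epsilon>)} \<subseteq> ?A"
  proof safe
    fix f assume a: "a \<le> \<bar>pull f t p\<bar>" and e: "\<forall>p\<in>B. \<forall>q\<in>B. \<bar>e f p q\<bar> \<le> \<epsilon>"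
    show "a \<le> \<bar>qsum B (\<lambda>_ q f. e f p q * f q) f t\<bar>" using a by (simp add: pull_qsum)
    have "(e f p q)\<^sup>2 \<le> \<epsilon>\<^sup>2" if "q \<in> B" for q
      using e p that by (metis abs_ge_zero power2_abs power_mono)
    then have "qsum B (\<lambda>_ q f. (e f p q)\<^sup>2) f t \<le> real t * \<epsilon>\<^sup>2"
      using finite_B by (intro qsum_le) auto
    also have "\<dots> \<le> real T * \<epsilon>\<^sup>2" using t by (intro mult_right_mono) auto
    finally show "qsum B (\<lambda>_ q f. (e f p q)\<^sup>2) f t \<le> v" using v by linarith
  qed
  moreover have "?A \<in> sets law"
  proof -
    have [measurable]: "(\<lambda>f. qsum B (\<lambda>_ q f. e f p q * f q) f t) \<in> borel_measurable law"
      "(\<lambda>f. qsum B (\<lambda>_ q f. (e f p q)\<^sup>2) f t) \<in> borel_measurable law"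
      using t B_subset em comp_B by (auto intro!: measurable_qsum borel_measurable_times borel_measurable_power)
    show ?thesis by measurable
  qed
  ultimately have "measure law {f \<in> space law. a \<le> \<bar>pull f t p\<bar> \<and> (\<forall>p\<in>B. \<forall>q\<in>B. \<bar>e f p q\<bar> \<le> \<epsilon>)} \<le> measure law ?A"
    by (rule finite_measure_mono)
  also have "\<dots> \<le> 2 * exp (- a\<^sup>2 / (2 * v))"
    by (rule qsum_tail[OF B_subset subgaussian em pred t v(1) v(3)])
  finally show ?thesis .
qed

text \<open>The pull at time \<open>r\<close> involves only points visited strictly before
  \<open>r\<close>, and a point fresh at a time \<open>s\<close> not before \<open>r\<close> is none
  of these.\<close>

lemma pull_predictable: "predictable B (\<lambda>s p f. pull f s p)"
  unfolding predictable_def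
proof (intro allI impI ballI)
  fix s p f z r q
  assume s: "s < T" "p \<in> B" "fresh f s p" "r \<le> s" "q \<in> B"
  have nv: "\<not> visited f s p" using s by (simp add: fresh_def)
  show "pull (f(p := z)) r q = pull f r q"
    unfolding pull_def
  proof (rule sum.cong[OF refl])
    fix q' assume "q' \<in> B"
    have "visited f r q' \<Longrightarrow> q' \<noteq> p" using nv visited_mono[OF _ s(4)] by blast
    then show "(if visited (f(p := z)) r q' then e (f(p := z)) q q' * (f(p := z)) q' else 0) =
      (if visited f r q' then e f q q' * f q' else 0)"
      using visited_upd[OF nv s(4)] e_upd[OF s(2)] by auto
  qed
qed

lemma energy_tail:
  assumes v: "0 < v" "real T * a\<^sup>2 \<le> v" "0 \<le> \<tau>"
  shows "measure law {f \<in> space law. \<tau> \<le> \<bar>energy f T\<bar> \<and> (\<forall>t\<le>T. \<forall>p\<in>B. \<bar>pull f t p\<bar> \<le> a)} \<le> 2 * exp (- \<tau>\<^sup>2 / (2 * v))"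
proof -
  interpret prob_space law by (intro prob_space_PiM prob_M)
  have pm: "(\<lambda>f. pull f s p) \<in> borel_measurable law" if "s < T" "p \<in> B" for s p
    using that by (intro measurable_pull) auto
  let ?A = "{f \<in> space law. \<tau> \<le> \<bar>qsum B (\<lambda>s p f. pull f s p * f p) f T\<bar> \<and> qsum B (\<lambda>s p f. (pull f s p)\<^sup>2) f T \<le> v}"
  have "{f \<in> space law. \<tau> \<le> \<bar>energy f T\<bar> \<and> (\<forall>t\<le>T. \<forall>p\<in>B. \<bar>pull f t p\<bar> \<le> a)} \<subseteq> ?A"
  proof safe
    fix f assume \<tau>: "\<tau> \<le> \<bar>energy f T\<bar>" and a: "\<forall>t\<le>T. \<forall>p\<in>B. \<bar>pull f t p\<bar> \<le> a"
    show "\<tau> \<le> \<bar>qsum B (\<lambda>s p f. pull f s p * f p) f T\<bar>" using \<tau> by (simp add: energy_def)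
    have "(pull f s p)\<^sup>2 \<le> a\<^sup>2" if "s < T" "p \<in> B" for s p
      using a that by (metis abs_ge_zero power2_abs power_mono less_imp_le)
    then have "qsum B (\<lambda>s p f. (pull f s p)\<^sup>2) f T \<le> real T * a\<^sup>2"
      using finite_B by (intro qsum_le) auto
    then show "qsum B (\<lambda>s p f. (pull f s p)\<^sup>2) f T \<le> v" using v by linarith
  qed
  moreover have "?A \<in> sets law"
  proof -
    have [measurable]: "(\<lambda>f. qsum B (\<lambda>s p f. pull f s p * f p) f T) \<in> borel_measurable law"
      "(\<lambda>f. qsum B (\<lambda>s p f. (pull f s p)\<^sup>2) f T) \<in> borel_measurable law"
      using B_subset pm comp_B by (auto intro!: measurable_qsum borel_measurable_times borel_measurable_power)
    show ?thesis by measurable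
  qed
  ultimately have "measure law {f \<in> space law. \<tau> \<le> \<bar>energy f T\<bar> \<and> (\<forall>t\<le>T. \<forall>p\<in>B. \<bar>pull f t p\<bar> \<le> a)} \<le> measure law ?A"
    by (rule finite_measure_mono)
  also have "\<dots> \<le> 2 * exp (- \<tau>\<^sup>2 / (2 * v))"
    by (rule qsum_tail[OF B_subset subgaussian pm pull_predictable order_refl v(1) v(3)])
  finally show ?thesis .
qed

definition small_correlations :: "real \<Rightarrow> ('a \<Rightarrow> real) \<Rightarrow> bool" where
  "small_correlations \<epsilon> f \<longleftrightarrow> (\<forall>p\<in>B. \<forall>q\<in>B. \<bar>e f p q\<bar> \<le> \<epsilon>)"

definition tame :: "real \<Rightarrow> real \<Rightarrow> ('a \<Rightarrow> real) \<Rightarrow> bool" where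
  "tame a \<tau> f \<longleftrightarrow> (\<forall>t\<le>T. \<forall>p\<in>B. \<bar>pull f t p\<bar> \<le> a) \<and> \<bar>energy f T\<bar> \<le> \<tau>"

lemma sets_small_correlations: "{f \<in> space law. small_correlations \<epsilon> f} \<in> sets law"
proof -
  have "{f \<in> space law. \<bar>e f p q\<bar> \<le> \<epsilon>} \<in> sets law" if "p \<in> B" "q \<in> B" for p q
  proof -
    note [measurable] = e_measurable[OF that]
    show ?thesis by measurable
  qed
  then show ?thesis unfolding small_correlations_def
    by (intro sets.sets_Collect_finite_All finite_B)
qed

lemma sets_pull_le: "{f \<in> space law. \<forall>t\<le>T. \<forall>p\<in>B. \<bar>pull f t p\<bar> \<le> a} \<in> sets law"
proof -
  have "{f \<in> space law. \<bar>pull f t p\<bar> \<le> a} \<in> sets law" if "t \<in> {..T}" "p \<in> B" for t p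
  proof -
    have [measurable]: "(\<lambda>f. pull f t p) \<in> borel_measurable law" using that by (intro measurable_pull) auto
    show ?thesis by measurable
  qed
  then have "{f \<in> space law. \<forall>p\<in>B. \<bar>pull f t p\<bar> \<le> a} \<in> sets law" if "t \<in> {..T}" for t
    using that by (intro sets.sets_Collect_finite_All finite_B)
  then have "{f \<in> space law. \<forall>t\<in>{..T}. \<forall>p\<in>B. \<bar>pull f t p\<bar> \<le> a} \<in> sets law"
    by (rule sets.sets_Collect_finite_All) auto
  then show ?thesis by (simp only: Ball_def atMost_iff)
qed

lemma sets_tame: "{f \<in> space law. tame a \<tau> f} \<in> sets law"
proof -
  note [measurable] = measurable_energy[OF order_refl]
  have "{f \<in> space law. \<bar>energy f T\<bar> \<le> \<tau>} \<in> sets law" by measurable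
  from sets.sets_Collect_conj[OF this sets_pull_le] show ?thesis unfolding tame_def .
qed

text \<open>The next query may be any point, so the pulls are controlled by a union bound over all
  \<open>(T + 1) * card B\<close> pairs of a time and a point. Only where all pulls are at most
  \<open>a\<close> is the quadratic variation of the energy bounded, so its tail is taken on that
  event.\<close>

lemma not_tame_le:
  assumes v: "0 < v" "real T * \<epsilon>\<^sup>2 \<le> v" and w: "0 < w" "real T * a\<^sup>2 \<le> w" and nonneg: "0 \<le> a" "0 \<le> \<tau>"
  shows "measure law {f \<in> space law. small_correlations \<epsilon> f \<and> \<not> tame a \<tau> f} \<le>
    2 * (real T + 1) * real (card B) * exp (- a\<^sup>2 / (2 * v)) + 2 * exp (- \<tau>\<^sup>2 / (2 * w))"
proof -
  interpret prob_space law by (intro prob_space_PiM prob_M)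
  let ?P = "\<lambda>x. {f \<in> space law. a \<le> \<bar>pull f (fst x) (snd x)\<bar> \<and> small_correlations \<epsilon> f}"
  let ?E = "{f \<in> space law. \<tau> \<le> \<bar>energy f T\<bar> \<and> (\<forall>t\<le>T. \<forall>p\<in>B. \<bar>pull f t p\<bar> \<le> a)}"
  let ?X = "{..T} \<times> B"
  have P_sets: "?P x \<in> sets law" if "x \<in> ?X" for x
  proof -
    have [measurable]: "(\<lambda>f. pull f (fst x) (snd x)) \<in> borel_measurable law" using that by (intro measurable_pull) auto
    have "{f \<in> space law. a \<le> \<bar>pull f (fst x) (snd x)\<bar>} \<in> sets law" by measurable
    from sets.sets_Collect_conj[OF sets_small_correlations this] show ?thesis .
  qed
  have E_sets: "?E \<in> sets law"
  proof -
    note [measurable] = measurable_energy[OF order_refl]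
    have "{f \<in> space law. \<tau> \<le> \<bar>energy f T\<bar>} \<in> sets law" by measurable
    from sets.sets_Collect_conj[OF sets_pull_le this] show ?thesis .
  qed
  have "{f \<in> space law. small_correlations \<epsilon> f \<and> \<not> tame a \<tau> f} \<subseteq> (\<Union>x\<in>?X. ?P x) \<union> ?E"
  proof
    fix f assume f: "f \<in> {f \<in> space law. small_correlations \<epsilon> f \<and> \<not> tame a \<tau> f}"
    show "f \<in> (\<Union>x\<in>?X. ?P x) \<union> ?E"
    proof (cases "\<forall>t\<le>T. \<forall>p\<in>B. \<bar>pull f t p\<bar> \<le> a")
      case True
      then show ?thesis using f by (auto simp: tame_def)
    next
      case False
      then obtain t p where tp: "t \<le> T" "p \<in> B" "a \<le> \<bar>pull f t p\<bar>" by force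
      then have "f \<in> ?P (t, p)" using f by simp
      then show ?thesis using tp by blast
    qed
  qed
  then have "measure law {f \<in> space law. small_correlations \<epsilon> f \<and> \<not> tame a \<tau> f} \<le> measure law ((\<Union>x\<in>?X. ?P x) \<union> ?E)"
    using P_sets E_sets finite_B by (intro finite_measure_mono sets.Un sets.finite_UN) auto
  also have "\<dots> \<le> measure law (\<Union>x\<in>?X. ?P x) + measure law ?E"
    using P_sets E_sets finite_B by (intro measure_Un_le sets.finite_UN) auto
  also have "measure law (\<Union>x\<in>?X. ?P x) \<le> (\<Sum>x\<in>?X. measure law (?P x))"
    using P_sets finite_B by (intro measure_UNION_le) auto
  also have "\<dots> \<le> (\<Sum>x\<in>?X. 2 * exp (- a\<^sup>2 / (2 * v)))"
  proof (rule sum_mono)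
    fix x assume "x \<in> ?X"
    then show "measure law (?P x) \<le> 2 * exp (- a\<^sup>2 / (2 * v))"
      using pull_tail[OF _ _ v nonneg(1), of "snd x" "fst x"] unfolding small_correlations_def by auto
  qed
  also have "\<dots> = 2 * (real T + 1) * real (card B) * exp (- a\<^sup>2 / (2 * v))"
    by (simp add: card_cartesian_product algebra_simps)
  also have "measure law ?E \<le> 2 * exp (- \<tau>\<^sup>2 / (2 * w))"
    by (rule energy_tail[OF w nonneg(2)])
  finally show ?thesis by simp
qed

end

section \<open>Walsh--Hadamard layers\<close>

definition chi :: "nat \<Rightarrow> (nat \<Rightarrow> nat) \<Rightarrow> (nat \<Rightarrow> nat) \<Rightarrow> real" where
  "chi n x y = (- 1) ^ dotp n x y"

lemma chi_prod: "chi n x y = (\<Prod>j<n. (- 1) ^ (x j * y j))"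
  by (simp add: chi_def dotp_def power_sum)

lemma chi_commute: "chi n x y = chi n y x"
  by (simp add: chi_prod mult.commute)

lemma chi_square[simp]: "chi n x y * chi n x y = 1" "(chi n x y)\<^sup>2 = 1"
  by (simp_all add: chi_def flip: power_add power_mult)

lemma abs_chi[simp]: "\<bar>chi n x y\<bar> = 1"
  by (simp add: chi_def power_abs)

lemma finite_cube[simp]: "finite (cube n)"
  by (auto simp: cube_def intro!: finite_PiE)

lemma card_cube: "card (cube n) = 2 ^ n"
  by (simp add: cube_def card_PiE numeral_2_eq_2)

lemma finite_points[simp]: "finite (points m n)"
  by (simp add: points_def)

lemma cube_cases: "x \<in> cube n \<Longrightarrow> i < n \<Longrightarrow> x i = 0 \<or> x i = 1"
  by (auto simp: cube_def PiE_def Pi_def)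

lemma cube_neq:
  assumes "y \<in> cube n" "y' \<in> cube n" "y \<noteq> y'"
  obtains j where "j < n" "y j \<noteq> y' j"
proof -
  have "\<exists>j<n. y j \<noteq> y' j"
  proof (rule ccontr)
    assume "\<not> ?thesis"
    then have "y = y'" using assms(1,2) unfolding cube_def by (intro PiE_ext) auto
    then show False using assms(3) by simp
  qed
  then show thesis using that by blast
qed

lemma sum_cube_prod:
  fixes g :: "nat \<Rightarrow> nat \<Rightarrow> real"
  shows "(\<Sum>x\<in>cube n. \<Prod>j<n. g j (x j)) = (\<Prod>j<n. g j 0 + g j 1)"
  unfolding cube_def by (subst prod_sum_PiE[symmetric]) auto

lemma sum_chi_chi:
  assumes y: "y \<in> cube n" "y' \<in> cube n"
  shows "(\<Sum>x\<in>cube n. chi n x y * chi n x y') = (if y = y' then 2 ^ n else 0)"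
proof -
  have "(\<Sum>x\<in>cube n. chi n x y * chi n x y') = (\<Prod>j<n. 1 + (- 1) ^ (y j + y' j))"
    using sum_cube_prod[of "\<lambda>j b. (- 1) ^ (b * y j) * (- 1) ^ (b * y' j)" n]
    by (simp add: chi_prod prod.distrib power_add)
  also have "\<dots> = (if y = y' then 2 ^ n else 0)"
  proof (cases "y = y'")
    case True
    then show ?thesis by (simp flip: mult_2)
  next
    case False
    then obtain j where j: "j < n" "y j \<noteq> y' j" using cube_neq[OF y] by blast
    have "y j + y' j = 1" using cube_cases[OF y(1) j(1)] cube_cases[OF y(2) j(1)] j(2) by auto
    then have "1 + (- 1 :: real) ^ (y j + y' j) = 0" by simp
    then have "(\<Prod>j<n. 1 + (- 1 :: real) ^ (y j + y' j)) = 0" using j by (intro prod_zero) auto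
    then show ?thesis using False by simp
  qed
  finally show ?thesis .
qed

text \<open>Addition of \<open>y + y'\<close> over GF(2), with bits stored as naturals: an
  involution of the cube through which a product of characters collapses into one.\<close>

definition shift3 :: "nat \<Rightarrow> (nat \<Rightarrow> nat) \<Rightarrow> (nat \<Rightarrow> nat) \<Rightarrow> (nat \<Rightarrow> nat) \<Rightarrow> nat \<Rightarrow> nat" where
  "shift3 n y y' a = (\<lambda>i\<in>{..<n}. (a i + y i + y' i) mod 2)"

lemma shift3_in_cube[simp]: "shift3 n y y' a \<in> cube n"
  by (auto simp: shift3_def cube_def)

lemma shift3_shift3: 
  assumes "a \<in> cube n" shows "shift3 n y y' (shift3 n y y' a) = a"
proof -
  have "(((a i + y i + y' i) mod 2) + y i + y' i) mod 2 = a i" if "i < n" for i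
    using cube_cases[OF assms that] by presburger
  then show ?thesis
    using assms shift3_in_cube[of n y y' "shift3 n y y' a"] unfolding cube_def
    by (intro PiE_ext) (auto simp: shift3_def)
qed

lemma chi_shift3: "chi n x (shift3 n y y' a) = chi n x a * chi n x y * chi n x y'"
proof -
  have "(- 1 :: real) ^ (x j * ((a j + y j + y' j) mod 2)) = (- 1) ^ (x j * a j) * (- 1) ^ (x j * y j) * (- 1) ^ (x j * y' j)" for j
  proof -
    have "even (x j * ((a j + y j + y' j) mod 2)) = even (x j * (a j + y j + y' j))" by simp
    also have "x j * (a j + y j + y' j) = x j * a j + x j * y j + x j * y' j" by (simp add: distrib_left)
    finally have "even (x j * ((a j + y j + y' j) mod 2)) = even (x j * a j + x j * y j + x j * y' j)" .
    then have "(- 1 :: real) ^ (x j * ((a j + y j + y' j) mod 2)) = (- 1) ^ (x j * a j + x j * y j + x j * y' j)"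
      by (simp only: minus_one_power_iff)
    then show ?thesis by (simp only: power_add)
  qed
  then show ?thesis by (simp add: chi_prod shift3_def flip: prod.distrib)
qed

definition hadamard :: "nat \<Rightarrow> ((nat \<Rightarrow> nat) \<Rightarrow> real) \<Rightarrow> (nat \<Rightarrow> nat) \<Rightarrow> real" where
  "hadamard n h x = (\<Sum>a\<in>cube n. chi n a x * h a) / sqrt (2 ^ n)"

lemma hadamard_square:
  "(hadamard n h x)\<^sup>2 = (\<Sum>a\<in>cube n. \<Sum>a'\<in>cube n. chi n x a * chi n x a' * (h a * h a')) / 2 ^ n"
  by (simp add: hadamard_def power_divide power2_eq_square[of "sum _ _"] sum_product chi_commute[of n _ x] mult.assoc mult.left_commute)

text \<open>The square expands into pairs of characters; two of the characters merge with a third by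
  \<open>chi_shift3\<close>, and orthogonality selects one partner for each \<open>a\<close>. The
  result is an autocorrelation of \<open>h\<close>, in which independent signs can be
  isolated.\<close>

lemma hadamard_correlation:
  assumes y: "y \<in> cube n" "y' \<in> cube n"
  shows "(\<Sum>x\<in>cube n. chi n x y * chi n x y' * (hadamard n h x)\<^sup>2) = (\<Sum>a\<in>cube n. h a * h (shift3 n y y' a))"
proof -
  have "(\<Sum>x\<in>cube n. chi n x y * chi n x y' * (hadamard n h x)\<^sup>2) =
    (\<Sum>x\<in>cube n. \<Sum>a\<in>cube n. \<Sum>a'\<in>cube n. chi n x (shift3 n y y' a) * chi n x a' * (h a * h a') / 2 ^ n)"
    unfolding hadamard_square chi_shift3
    by (simp add: sum_distrib_left sum_divide_distrib ac_simps)
  also have "\<dots> = (\<Sum>a\<in>cube n. \<Sum>x\<in>cube n. \<Sum>a'\<in>cube n. chi n x (shift3 n y y' a) * chi n x a' * (h a * h a') / 2 ^ n)"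
    by (rule sum.swap)
  also have "\<dots> = (\<Sum>a\<in>cube n. \<Sum>a'\<in>cube n. \<Sum>x\<in>cube n. chi n x (shift3 n y y' a) * chi n x a' * (h a * h a') / 2 ^ n)"
    by (rule sum.cong[OF refl]) (rule sum.swap)
  also have "\<dots> = (\<Sum>a\<in>cube n. \<Sum>a'\<in>cube n. (\<Sum>x\<in>cube n. chi n x (shift3 n y y' a) * chi n x a') * (h a * h a') / 2 ^ n)"
    by (simp add: sum_distrib_right sum_divide_distrib)
  also have "\<dots> = (\<Sum>a\<in>cube n. \<Sum>a'\<in>cube n. if shift3 n y y' a = a' then h a * h a' else 0)"
    by (intro sum.cong refl) (simp add: sum_chi_chi)
  also have "\<dots> = (\<Sum>a\<in>cube n. h a * h (shift3 n y y' a))"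
    by (intro sum.cong refl) simp
  finally show ?thesis .
qed

lemma shift3_same: "a \<in> cube n \<Longrightarrow> shift3 n y y a = a"
proof -
  assume a: "a \<in> cube n"
  have "(a i + y i + y i) mod 2 = a i" if "i < n" for i
    using cube_cases[OF a that] by presburger
  then show ?thesis
    using a shift3_in_cube[of n y y a] unfolding cube_def by (intro PiE_ext) (auto simp: shift3_def)
qed

lemma hadamard_parseval:
  "(\<Sum>x\<in>cube n. (hadamard n h x)\<^sup>2) = (\<Sum>a\<in>cube n. (h a)\<^sup>2)"
proof -
  have z: "(\<lambda>i\<in>{..<n}. 0) \<in> cube n" by (auto simp: cube_def)
  show ?thesis
    using hadamard_correlation[OF z z, of h] by (simp add: shift3_same power2_eq_square)
qed

text \<open>Each pair of \<open>a\<close> and its shift is counted twice. Since the shift flips bit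
  \<open>j\<close>, the points with \<open>a j = 0\<close> represent all pairs, and the sum becomes
  linear in the values of \<open>h\<close> there, with coefficients taken from the other half of the
  cube.\<close>

lemma sum_shift3_half:
  assumes y: "y \<in> cube n" "y' \<in> cube n" and j: "j < n" "y j \<noteq> y' j"
  shows "(\<Sum>a\<in>cube n. h a * h (shift3 n y y' a)) = 2 * (\<Sum>a\<in>{a \<in> cube n. a j = 0}. h a * h (shift3 n y y' a) :: real)"
proof -
  let ?s = "shift3 n y y'" and ?H = "\<lambda>b. {a \<in> cube n. a j = b}"
  have flip: "?s a j = 1 - a j" if "a \<in> cube n" for a
    using cube_cases[OF that j(1)] cube_cases[OF y(1) j(1)] cube_cases[OF y(2) j(1)] j by (auto simp: shift3_def)
  have "(\<Sum>a\<in>?H 1. h a * h (?s a)) = (\<Sum>a\<in>?H 0. h (?s a) * h (?s (?s a)))"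
  proof (rule sum.reindex_bij_witness[of _ ?s ?s])
  qed (auto simp: shift3_shift3 flip)
  also have "\<dots> = (\<Sum>a\<in>?H 0. h a * h (?s a))"
    by (intro sum.cong refl) (auto simp: shift3_shift3)
  finally have half: "(\<Sum>a\<in>?H 1. h a * h (?s a)) = (\<Sum>a\<in>?H 0. h a * h (?s a))" .
  have "cube n = ?H 0 \<union> ?H 1" using cube_cases[OF _ j(1)] by auto
  then have "(\<Sum>a\<in>cube n. h a * h (?s a)) = (\<Sum>a\<in>?H 0 \<union> ?H 1. h a * h (?s a))" by simp
  also have "\<dots> = (\<Sum>a\<in>?H 0. h a * h (?s a)) + (\<Sum>a\<in>?H 1. h a * h (?s a))"
    by (rule sum.union_disjoint) auto
  finally show ?thesis using half by simp
qed

text \<open>The forrelation sum cut off after \<open>m\<close> functions, with its last character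
  left free. It alternates pointwise multiplication with an orthogonal transform, so for signs every
  layer keeps the squared norm \<open>2 ^ n\<close> of the constant layer 0.\<close>

primrec layer :: "nat \<Rightarrow> (point \<Rightarrow> real) \<Rightarrow> nat \<Rightarrow> (nat \<Rightarrow> nat) \<Rightarrow> real" where
  "layer n f 0 = (\<lambda>_. 1)"
| "layer n f (Suc i) = hadamard n (\<lambda>a. f (Suc i, a) * layer n f i a)"

lemma layer_cong:
  "(\<And>i a. 1 \<le> i \<Longrightarrow> i \<le> m \<Longrightarrow> a \<in> cube n \<Longrightarrow> f (i, a) = f' (i, a)) \<Longrightarrow> layer n f m x = layer n f' m x"
proof (induction m arbitrary: x)
  case (Suc m)
  then show ?case by (simp add: hadamard_def)
qed simp

lemma sum_PiE_Suc:
  fixes g :: "(nat \<Rightarrow> 'a) \<Rightarrow> real"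
  shows "(\<Sum>x\<in>{1..Suc m} \<rightarrow>\<^sub>E C. g x) = (\<Sum>a\<in>C. \<Sum>x\<in>{1..m} \<rightarrow>\<^sub>E C. g (x(Suc m := a)))"
proof -
  have "{1..Suc m} \<rightarrow>\<^sub>E C = (\<lambda>(a, x). x(Suc m := a)) ` (C \<times> ({1..m} \<rightarrow>\<^sub>E C))"
    by (simp add: atLeastAtMostSuc_conv PiE_insert_eq)
  then have "(\<Sum>x\<in>{1..Suc m} \<rightarrow>\<^sub>E C. g x) = (\<Sum>(a, x)\<in>C \<times> ({1..m} \<rightarrow>\<^sub>E C). g (x(Suc m := a)))"
    using inj_combinator[of "Suc m" "{1..m}" "\<lambda>_. C"]
    by (simp add: sum.reindex case_prod_beta' comp_def)
  then show ?thesis by (simp add: sum.cartesian_product)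
qed

text \<open>Fixing the last point of a path leaves a shorter path sum that ends in this point, which
  is the recursion of \<open>layer\<close>. The conditional treats the empty path, which has no end
  point to attach a character to.\<close>

lemma sum_paths_layer:
  "(\<Sum>x \<in> {1..m} \<rightarrow>\<^sub>E cube n. (\<Prod>i\<in>{1..m}. f (i, x i)) * (\<Prod>i\<in>{1..<m}. chi n (x i) (x (i + 1))) *
      (if m = 0 then 1 else chi n (x m) y)) = sqrt (2 ^ n) ^ m * layer n f m y"
proof (induction m arbitrary: y)
  case (Suc m)
  have split: "(\<Prod>i\<in>{1..Suc m}. f (i, (x(Suc m := a)) i)) * (\<Prod>i\<in>{1..<Suc m}. chi n ((x(Suc m := a)) i) ((x(Suc m := a)) (i + 1))) =
     f (Suc m, a) * ((\<Prod>i\<in>{1..m}. f (i, x i)) * (\<Prod>i\<in>{1..<m}. chi n (x i) (x (i + 1))) *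
      (if m = 0 then 1 else chi n (x m) a))" for x a
  proof -
    have 1: "(\<Prod>i\<in>{1..Suc m}. f (i, (x(Suc m := a)) i)) = (\<Prod>i\<in>{1..m}. f (i, x i)) * f (Suc m, a)"
      by (simp add: prod.nat_ivl_Suc')
    have 2: "(\<Prod>i\<in>{1..<Suc m}. chi n ((x(Suc m := a)) i) ((x(Suc m := a)) (i + 1))) =
      (\<Prod>i\<in>{1..<m}. chi n (x i) (x (i + 1))) * (if m = 0 then 1 else chi n (x m) a)"
    proof (cases "m = 0")
      case False
      then have "(\<Prod>i\<in>{1..<Suc m}. chi n ((x(Suc m := a)) i) ((x(Suc m := a)) (i + 1))) =
        (\<Prod>i\<in>{1..<m}. chi n ((x(Suc m := a)) i) ((x(Suc m := a)) (i + 1))) * chi n (x m) a"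
        by (simp add: prod.atLeastLessThan_Suc)
      then show ?thesis using False by simp
    qed simp
    show ?thesis unfolding 1 2 by (simp only: ac_simps)
  qed
  have "(\<Sum>x \<in> {1..Suc m} \<rightarrow>\<^sub>E cube n. (\<Prod>i\<in>{1..Suc m}. f (i, x i)) * (\<Prod>i\<in>{1..<Suc m}. chi n (x i) (x (i + 1))) *
      (if Suc m = 0 then 1 else chi n (x (Suc m)) y)) =
    (\<Sum>a\<in>cube n. \<Sum>x\<in>{1..m} \<rightarrow>\<^sub>E cube n. f (Suc m, a) * ((\<Prod>i\<in>{1..m}. f (i, x i)) * (\<Prod>i\<in>{1..<m}. chi n (x i) (x (i + 1))) *
      (if m = 0 then 1 else chi n (x m) a)) * chi n a y)"
    unfolding sum_PiE_Suc split by simp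
  also have "\<dots> = (\<Sum>a\<in>cube n. f (Suc m, a) * (sqrt (2 ^ n) ^ m * layer n f m a) * chi n a y)"
    by (simp only: sum_distrib_left[symmetric] sum_distrib_right[symmetric] Suc.IH)
  also have "\<dots> = sqrt (2 ^ n) ^ m * (\<Sum>a\<in>cube n. chi n a y * (f (Suc m, a) * layer n f m a))"
    by (simp add: sum_distrib_left ac_simps)
  also have "\<dots> = sqrt (2 ^ n) ^ Suc m * layer n f (Suc m) y"
    by (simp add: hadamard_def)
  finally show ?case .
qed simp

lemma forrelation_layer:
  assumes "2 \<le> k"
  shows "forrelation k n f y = layer n f (k - 1) y"
proof -
  have k: "k - 1 \<noteq> 0" using assms by simp
  have "2 powr (real ((k - 1) * n) / 2) = sqrt (2 powr real ((k - 1) * n))"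
    by (simp add: powr_half_sqrt[symmetric] powr_powr)
  also have "\<dots> = sqrt (2 ^ n) ^ (k - 1)"
    unfolding powr_realpow[OF zero_less_numeral] by (simp only: real_sqrt_power[symmetric] power_mult[symmetric] mult.commute)
  finally have p: "2 powr (real ((k - 1) * n) / 2) = sqrt (2 ^ n) ^ (k - 1)" .
  show ?thesis
    using sum_paths_layer[where m="k - 1" and n=n and f=f and y=y] k
    unfolding forrelation_def p chi_def by simp
qed

definition signs :: "nat \<Rightarrow> nat \<Rightarrow> (point \<Rightarrow> real) \<Rightarrow> bool" where
  "signs m n f \<longleftrightarrow> (\<forall>p\<in>points m n. f p = - 1 \<or> f p = 1)"

lemma layer_parseval:
  "signs m n f \<Longrightarrow> (\<Sum>x\<in>cube n. (layer n f m x)\<^sup>2) = 2 ^ n"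
proof (induction m)
  case 0
  then show ?case by (simp add: card_cube)
next
  case (Suc m)
  have "signs m n f" using Suc.prems by (auto simp: signs_def points_def)
  have "(f (Suc m, a) * layer n f m a)\<^sup>2 = (layer n f m a)\<^sup>2" if "a \<in> cube n" for a
    using Suc.prems that by (force simp: signs_def points_def power_mult_distrib)
  then show ?case using Suc.IH[OF \<open>signs m n f\<close>] by (simp add: hadamard_parseval)
qed

section \<open>The random layers are flat\<close>

lemma sets_rademacher[measurable_cong, simp]: "sets rademacher = sets borel"
  by (simp add: rademacher_def)

lemma prob_space_rademacher: "prob_space rademacher"
  unfolding rademacher_def by (rule measure_pmf.prob_space_distr) simp

lemma nn_integral_rademacher:
  assumes [measurable]: "F \<in> borel_measurable borel"
  shows "(\<integral>\<^sup>+z. F z \<partial>rademacher) = (F (- 1) + F 1) / 2"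
  unfolding rademacher_def by (simp add: nn_integral_distr nn_integral_pmf_of_set)

lemma AE_rademacher: "AE z in rademacher. z = - 1 \<or> z = 1"
  unfolding rademacher_def by (simp add: AE_distr_iff AE_measure_pmf_iff)

text \<open>Hoeffding's lemma for a fair two-point variable: with probability 1 / 2 and interval
  length \<open>2 * \<bar>m\<bar>\<close> the logarithm of its moment generating function is that of
  \<open>cosh\<close>. As \<open>cosh\<close> is even, nonnegative arguments suffice.\<close>

lemma cosh_le_exp_square: "cosh m \<le> exp (m\<^sup>2 / 2)" for m :: real
proof -
  have "cosh \<bar>m\<bar> \<le> exp (\<bar>m\<bar>\<^sup>2 / 2)"
  proof -
    let ?x = "\<bar>m\<bar>"
    have "- (2 * ?x) * (1 / 2) + ln (1 + 1 / 2 * (exp (2 * ?x) - 1)) \<le> (2 * ?x)\<^sup>2 / 8"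
      by (rule Hoeffdings_lemma_aux) auto
    moreover have pos: "1 + 1 / 2 * (exp (2 * ?x) - 1) > 0"
      using exp_gt_zero[of "2 * ?x"] by (simp add: field_simps add_pos_pos)
    ultimately have le: "exp (- ?x + ln (1 + 1 / 2 * (exp (2 * ?x) - 1))) \<le> exp (?x\<^sup>2 / 2)"
      by (simp add: power_mult_distrib)
    have "exp (- ?x) * exp (2 * ?x) = exp ?x" by (simp flip: exp_add)
    then have "cosh ?x = exp (- ?x) * (1 + 1 / 2 * (exp (2 * ?x) - 1))" by (simp add: cosh_def algebra_simps)
    also have "\<dots> = exp (- ?x + ln (1 + 1 / 2 * (exp (2 * ?x) - 1)))"
      using pos by (simp only: exp_add exp_ln)
    finally show ?thesis using le by simp
  qed
  then show ?thesis by (simp add: cosh_real_abs)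
qed

lemma rademacher_subgaussian:
  "(\<integral>\<^sup>+z. ennreal (exp (m * z - m\<^sup>2 / 2)) \<partial>rademacher) \<le> 1"
proof -
  have "(\<integral>\<^sup>+z. ennreal (exp (m * z - m\<^sup>2 / 2)) \<partial>rademacher) =
    (ennreal (exp (m * - 1 - m\<^sup>2 / 2)) + ennreal (exp (m * 1 - m\<^sup>2 / 2))) / 2"
    by (rule nn_integral_rademacher) measurable
  also have "\<dots> = ennreal (cosh m * exp (- (m\<^sup>2 / 2)))"
  proof -
    have "exp (m * - 1 - m\<^sup>2 / 2) = exp (- m) * exp (- (m\<^sup>2 / 2))" "exp (m * 1 - m\<^sup>2 / 2) = exp m * exp (- (m\<^sup>2 / 2))"
      by (simp_all flip: exp_add)
    then have "exp (m * - 1 - m\<^sup>2 / 2) + exp (m * 1 - m\<^sup>2 / 2) = 2 * (cosh m * exp (- (m\<^sup>2 / 2)))"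
      by (simp only: cosh_def) (simp add: algebra_simps)
    then have "ennreal (exp (m * - 1 - m\<^sup>2 / 2)) + ennreal (exp (m * 1 - m\<^sup>2 / 2)) = 2 * ennreal (cosh m * exp (- (m\<^sup>2 / 2)))"
      by (simp add: ennreal_mult' flip: ennreal_plus)
    then show ?thesis
      by (simp add: ennreal_divide_eq_top_iff mult.commute[of 2] ennreal_mult_divide_eq del: ennreal_plus)
  qed
  also have "\<dots> \<le> ennreal (exp (m\<^sup>2 / 2) * exp (- (m\<^sup>2 / 2)))"
    by (intro ennreal_leI mult_right_mono cosh_le_exp_square) simp
  also have "\<dots> = 1" by (simp flip: exp_add)
  finally show ?thesis .
qed

lemma prob_space_coord_law: "prob_space (coord_law k p)"
  by (simp add: coord_law_def prob_space_rademacher prob_space_std_gaussian)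

lemma sets_coord_law: "sets (coord_law k p) = sets borel"
  by (simp add: coord_law_def)

lemma coord_law_subgaussian:
  "(\<integral>\<^sup>+z. ennreal (exp (m * z - m\<^sup>2 / 2)) \<partial>coord_law k p) \<le> 1"
  by (simp add: coord_law_def rademacher_subgaussian nn_integral_exp_std_gaussian)

lemma prob_space_uniform_law: "prob_space (uniform_law k n)"
  unfolding uniform_law_def by (intro prob_space_PiM prob_space_coord_law)

lemma uniform_law_component: "p \<in> points k n \<Longrightarrow> (\<lambda>f. f p) \<in> borel_measurable (uniform_law k n)"
  unfolding uniform_law_def
  using measurable_component_singleton[of p "points k n" "coord_law k"] measurable_cong_sets[OF refl sets_coord_law] by blast

lemma measurable_layer:
  assumes "\<And>i a. 1 \<le> i \<Longrightarrow> i \<le> m \<Longrightarrow> a \<in> cube n \<Longrightarrow> (\<lambda>w. F w (i, a)) \<in> borel_measurable N"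
  shows "(\<lambda>w. layer n (F w) m x) \<in> borel_measurable N"
  using assms
proof (induction m arbitrary: x)
  case (Suc m)
  then show ?case unfolding layer.simps hadamard_def
    by (intro borel_measurable_divide borel_measurable_sum borel_measurable_times borel_measurable_const) auto
qed simp

lemma measurable_layer_uniform:
  "m \<le> k \<Longrightarrow> (\<lambda>f. layer n f m x) \<in> borel_measurable (uniform_law k n)"
  by (intro measurable_layer uniform_law_component) (auto simp: points_def)

lemma sets_signs:
  "m \<le> k \<Longrightarrow> {f \<in> space (uniform_law k n). signs m n f} \<in> sets (uniform_law k n)"
  unfolding signs_def
proof (rule sets.sets_Collect_finite_All)
  fix p assume "m \<le> k" "p \<in> points m n"
  then have [measurable]: "(\<lambda>f. f p) \<in> borel_measurable (uniform_law k n)"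
    by (intro uniform_law_component) (auto simp: points_def)
  show "{f \<in> space (uniform_law k n). f p = - 1 \<or> f p = 1} \<in> sets (uniform_law k n)" by measurable
qed simp

lemma AE_signs: "AE f in uniform_law k n. signs (k - 2) n f"
  unfolding signs_def
proof (rule AE_finite_allI)
  fix p assume p: "p \<in> points (k - 2) n"
  have "AE z in coord_law k p. z = - 1 \<or> z = 1"
  proof -
    have eq: "coord_law k p = rademacher" using p by (auto simp: coord_law_def points_def)
    show ?thesis unfolding eq by (rule AE_rademacher)
  qed
  then show "AE f in uniform_law k n. f p = - 1 \<or> f p = 1"
    unfolding uniform_law_def using p by (intro AE_PiM_component prob_space_coord_law) (auto simp: points_def)
qed simp

text \<open>Tail of a linear form in the values on part \<open>A\<close> of one level, with
  coefficients free of those values. \<open>Q\<close> may be any set inside the tail event, so that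
  side conditions such as \<open>signs\<close> can be passed along.\<close>

lemma uniform_slice_tail:
  fixes c :: "(nat \<Rightarrow> nat) \<Rightarrow> (point \<Rightarrow> real) \<Rightarrow> real"
  assumes "1 \<le> m" "m \<le> k" "A \<subseteq> cube n"
    and "\<And>a. a \<in> A \<Longrightarrow> c a \<in> borel_measurable (uniform_law k n)"
    and "\<And>a b f z. a \<in> A \<Longrightarrow> b \<in> A \<Longrightarrow> c a (f((m, b) := z)) = c a f"
    and v: "0 < v" "0 \<le> t"
    and Q: "\<And>f. f \<in> Q \<Longrightarrow> f \<in> space (uniform_law k n) \<and> t \<le> \<bar>\<Sum>a\<in>A. c a f * f (m, a)\<bar> \<and> (\<Sum>a\<in>A. (c a f)\<^sup>2) \<le> v"
  shows "measure (uniform_law k n) Q \<le> 2 * exp (- t\<^sup>2 / (2 * v))"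
proof -
  interpret prob_space "uniform_law k n" by (rule prob_space_uniform_law)
  let ?B = "Pair m ` A"
  have sumB: "(\<Sum>p\<in>?B. h p) = (\<Sum>a\<in>A. h (m, a))" for h :: "point \<Rightarrow> real"
    by (subst sum.reindex) (auto simp: inj_on_def)
  let ?R = "{f \<in> space (uniform_law k n). t \<le> \<bar>\<Sum>a\<in>A. c a f * f (m, a)\<bar> \<and> (\<Sum>a\<in>A. (c a f)\<^sup>2) \<le> v}"
  have "measure (uniform_law k n) ?R \<le> 2 * exp (- t\<^sup>2 / (2 * v))"
  proof -
    have B: "?B \<subseteq> points k n" using assms by (auto simp: points_def)
    have meas: "c (snd p) \<in> borel_measurable (Pi\<^sub>M (points k n) (coord_law k))" if "p \<in> ?B" for p
      using that assms(4) unfolding uniform_law_def by auto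
    have upd: "c (snd p) (f(q := z)) = c (snd p) f" if "p \<in> ?B" "q \<in> ?B" for p q f z
      using that assms(5) by auto
    show ?thesis
      using slice_tail[of "points k n" "coord_law k" ?B "\<lambda>p. c (snd p)", OF finite_points prob_space_coord_law
          sets_coord_law B coord_law_subgaussian meas upd v]
      unfolding sumB uniform_law_def by simp
  qed
  moreover have "?R \<in> sets (uniform_law k n)"
  proof -
    have [measurable]: "(\<lambda>f. \<Sum>a\<in>A. c a f * f (m, a)) \<in> borel_measurable (uniform_law k n)"
      "(\<lambda>f. \<Sum>a\<in>A. (c a f)\<^sup>2) \<in> borel_measurable (uniform_law k n)"
      using assms by (auto intro!: borel_measurable_sum borel_measurable_times borel_measurable_power uniform_law_component simp: points_def)
    show ?thesis by measurable
  qed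
  moreover have "Q \<subseteq> ?R" using Q by blast
  ultimately show ?thesis using finite_measure_mono by (meson order_trans)
qed

lemma signs_mono: "signs m n f \<Longrightarrow> i \<le> m \<Longrightarrow> signs i n f"
  by (auto simp: signs_def points_def)

lemma layer_upd:
  "i < m \<Longrightarrow> layer n (f((m, b) := z)) i x = layer n f i x"
  by (rule layer_cong) auto

text \<open>With the earlier levels fixed, the layer at \<open>x\<close> is linear in the signs of
  level \<open>m\<close>, and Parseval makes its squared coefficients sum to 1. The assumption that
  \<tau> exceeds 1 settles layer 0, which is constantly 1.\<close>

lemma layer_tail:
  assumes m: "m \<le> k" and \<tau>: "1 < \<tau>"
  shows "measure (uniform_law k n) {f \<in> space (uniform_law k n). signs m n f \<and> \<tau> \<le> \<bar>layer n f m x\<bar>} \<le> 2 * exp (- \<tau>\<^sup>2 / 2)"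
proof (cases m)
  case 0
  then have "{f \<in> space (uniform_law k n). signs m n f \<and> \<tau> \<le> \<bar>layer n f m x\<bar>} = {}" using \<tau> by auto
  then show ?thesis by (simp only: measure_empty) simp
next
  case (Suc i)
  let ?c = "\<lambda>a f. chi n a x * layer n f i a / sqrt (2 ^ n)"
  have "measure (uniform_law k n) {f \<in> space (uniform_law k n). signs m n f \<and> \<tau> \<le> \<bar>layer n f m x\<bar>} \<le> 2 * exp (- \<tau>\<^sup>2 / (2 * 1))"
  proof (rule uniform_slice_tail[where m=m and A="cube n" and c="?c"])
    show "?c a \<in> borel_measurable (uniform_law k n)" for a
      using measurable_layer_uniform[of i k n a] m Suc by simp
    show "?c a (f((m, b) := z)) = ?c a f" for a b f z
      using layer_upd[of i m] Suc by simp
    fix f assume f: "f \<in> {f \<in> space (uniform_law k n). signs m n f \<and> \<tau> \<le> \<bar>layer n f m x\<bar>}"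
    have "layer n f m x = (\<Sum>a\<in>cube n. ?c a f * f (m, a))"
      using Suc by (simp add: hadamard_def sum_divide_distrib ac_simps)
    moreover have "(\<Sum>a\<in>cube n. (?c a f)\<^sup>2) = (\<Sum>a\<in>cube n. (layer n f i a)\<^sup>2) / 2 ^ n"
      by (simp add: power_divide power_mult_distrib sum_divide_distrib)
    moreover have "(\<Sum>a\<in>cube n. (layer n f i a)\<^sup>2) = 2 ^ n"
      using f Suc by (intro layer_parseval) (auto intro: signs_mono)
    ultimately show "f \<in> space (uniform_law k n) \<and> \<tau> \<le> \<bar>\<Sum>a\<in>cube n. ?c a f * f (m, a)\<bar> \<and> (\<Sum>a\<in>cube n. (?c a f)\<^sup>2) \<le> 1"
      using f by simp
  qed (use Suc m \<tau> in auto)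
  then show ?thesis by simp
qed

text \<open>For \<open>m = k - 2\<close> this is the covariance, given the signs, of the forrelated
  values at two points of the last level.\<close>

definition correlation :: "nat \<Rightarrow> (point \<Rightarrow> real) \<Rightarrow> nat \<Rightarrow> (nat \<Rightarrow> nat) \<Rightarrow> (nat \<Rightarrow> nat) \<Rightarrow> real" where
  "correlation n f m y y' = (\<Sum>x\<in>cube n. chi n x y * chi n x y' * (layer n f m x)\<^sup>2) / 2 ^ n"

text \<open>The correlation is an autocorrelation of sign times preceding layer, divided by
  \<open>2 ^ n\<close>. Restricted to the half cube of \<open>sum_shift3_half\<close> it is linear
  in signs whose coefficients involve only the signs of the other half. In the sum of their squares
  one layer factor is bounded by \<tau> and the other is summed by Parseval.\<close>

lemma correlation_tail:
  assumes m: "m \<le> k" and \<tau>: "0 < \<tau>" and s: "0 < s" and y: "y \<in> cube n" "y' \<in> cube n" "y \<noteq> y'"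
  shows "measure (uniform_law k n) {f \<in> space (uniform_law k n). signs m n f \<and>
      (\<forall>a\<in>cube n. \<bar>layer n f (m - 1) a\<bar> \<le> \<tau>) \<and> s \<le> \<bar>correlation n f m y y'\<bar>} \<le> 2 * exp (- s\<^sup>2 / (2 * (4 * \<tau>\<^sup>2 / 2 ^ n)))"
    (is "measure _ ?Q \<le> _")
proof (cases m)
  \<comment> \<open>This case arises for \<open>k = 2\<close>: layer 0 is constant, so distinct
    characters are exactly orthogonal.\<close>
  case 0
  then have "?Q = {}" using s y by (auto simp: correlation_def sum_chi_chi)
  then show ?thesis by (simp only: measure_empty) simp
next
  case (Suc i)
  obtain j where j: "j < n" "y j \<noteq> y' j" using cube_neq[OF y] by blast
  let ?sh = "shift3 n y y'" and ?A = "{a \<in> cube n. a j = 0}"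
  let ?c = "\<lambda>a f. 2 / 2 ^ n * (layer n f i a * (f (m, ?sh a) * layer n f i (?sh a)))"
  have flip: "?sh a j = 1" if "a \<in> ?A" for a
    using that cube_cases[OF y(1) j(1)] cube_cases[OF y(2) j(1)] j by (auto simp: shift3_def)
  show ?thesis
  proof (rule uniform_slice_tail[where m=m and A="?A" and c="?c"])
    show "?c a \<in> borel_measurable (uniform_law k n)" for a
      using measurable_layer_uniform[of i k n] m Suc
      by (intro borel_measurable_times borel_measurable_const uniform_law_component) (auto simp: points_def)
    show "?c a (f((m, b) := z)) = ?c a f" if "a \<in> ?A" "b \<in> ?A" for a b f z
    proof -
      have "?sh a \<noteq> b" using flip[OF that(1)] that(2) by force
      then show ?thesis using layer_upd[of i m] Suc by simp
    qed
    fix f assume f: "f \<in> ?Q"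
    have sg: "signs i n f" using f Suc by (auto intro: signs_mono)
    have "correlation n f m y y' = (\<Sum>a\<in>?A. ?c a f * f (m, a))"
      using Suc y hadamard_correlation[OF y(1,2), of "\<lambda>a. f (m, a) * layer n f i a"]
        sum_shift3_half[OF y(1,2) j, of "\<lambda>a. f (m, a) * layer n f i a"]
      by (simp add: correlation_def sum_distrib_left sum_divide_distrib ac_simps)
    moreover have "(\<Sum>a\<in>?A. (?c a f)\<^sup>2) \<le> 4 * \<tau>\<^sup>2 / 2 ^ n"
    proof -
      have "(?c a f)\<^sup>2 \<le> 4 / (2 ^ n)\<^sup>2 * \<tau>\<^sup>2 * (layer n f i a)\<^sup>2" for a
      proof -
        have "(m, ?sh a) \<in> points m n" using Suc by (simp add: points_def)
        then have "f (m, ?sh a) = - 1 \<or> f (m, ?sh a) = 1" using f unfolding signs_def by blast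
        then have "(f (m, ?sh a))\<^sup>2 = 1" by auto
        then have "(?c a f)\<^sup>2 = 4 / (2 ^ n)\<^sup>2 * (layer n f i (?sh a))\<^sup>2 * (layer n f i a)\<^sup>2"
          by (simp add: power_mult_distrib power_divide)
        moreover have "(layer n f i (?sh a))\<^sup>2 \<le> \<tau>\<^sup>2"
          using f Suc shift3_in_cube[of n y y' a] by (intro abs_le_square_iff[THEN iffD1]) (use \<tau> in force)
        ultimately show ?thesis by (simp add: mult_left_mono mult_right_mono divide_right_mono)
      qed
      then have "(\<Sum>a\<in>?A. (?c a f)\<^sup>2) \<le> (\<Sum>a\<in>?A. 4 / (2 ^ n)\<^sup>2 * \<tau>\<^sup>2 * (layer n f i a)\<^sup>2)"
        by (intro sum_mono)
      also have "\<dots> \<le> (\<Sum>a\<in>cube n. 4 / (2 ^ n)\<^sup>2 * \<tau>\<^sup>2 * (layer n f i a)\<^sup>2)"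
        by (intro sum_mono2) auto
      also have "\<dots> = 4 / (2 ^ n)\<^sup>2 * \<tau>\<^sup>2 * 2 ^ n"
        using layer_parseval[OF sg] by (simp only: sum_distrib_left[symmetric])
      also have "\<dots> = 4 * \<tau>\<^sup>2 / 2 ^ n" by (simp add: power2_eq_square)
      finally show ?thesis .
    qed
    ultimately show "f \<in> space (uniform_law k n) \<and> s \<le> \<bar>\<Sum>a\<in>?A. ?c a f * f (m, a)\<bar> \<and> (\<Sum>a\<in>?A. (?c a f)\<^sup>2) \<le> 4 * \<tau>\<^sup>2 / 2 ^ n"
      using f by simp
  qed (use Suc m \<tau> s in auto)
qed


text \<open>With L = ln N, the threshold 2 sqrt L has Gaussian tail 2 / N^2, enough for a union over
  N points. Inserting it as \<tau> in \<open>correlation_tail\<close>, the level 10 L / sqrt N gives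
  the exponent 100 L / 32, at least 3 L, hence a tail of at most 2 / N^3 for each of at most N^2
  pairs.\<close>

definition typical :: "nat \<Rightarrow> nat \<Rightarrow> (point \<Rightarrow> real) \<Rightarrow> bool" where
  "typical m n f \<longleftrightarrow> signs m n f \<and> (\<forall>x\<in>cube n. \<bar>layer n f m x\<bar> \<le> 2 * sqrt (ln (2 ^ n))) \<and>
    (\<forall>y\<in>cube n. \<forall>y'\<in>cube n. y \<noteq> y' \<longrightarrow> \<bar>correlation n f m y y'\<bar> \<le> 10 * ln (2 ^ n) / sqrt (2 ^ n))"

lemma typical_cong:
  assumes "\<And>i a. 1 \<le> i \<Longrightarrow> i \<le> m \<Longrightarrow> a \<in> cube n \<Longrightarrow> f (i, a) = f' (i, a)"
  shows "typical m n f = typical m n f'"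
proof -
  have "signs m n f = signs m n f'" using assms by (auto simp: signs_def points_def)
  moreover have "layer n f m x = layer n f' m x" for x by (rule layer_cong) (rule assms)
  ultimately show ?thesis by (simp add: typical_def correlation_def)
qed

lemma half_less_ln_power:
  assumes "1 \<le> n" shows "1 / 2 < ln (2 ^ n :: real)"
proof -
  have "1 * ln 2 \<le> real n * ln (2 :: real)" using assms by (intro mult_right_mono) auto
  moreover have "ln (2 ^ n :: real) = real n * ln 2" by (simp add: ln_realpow)
  ultimately show ?thesis using ln2_ge_two_thirds by linarith
qed

text \<open>Three union bounds of 2 / N each: the last sign layer, the layer before it, and the
  correlations. Flatness of the layer before it is demanded only as input to
  \<open>correlation_tail\<close>.\<close>

lemma measure_not_typical:
  assumes n: "1 \<le> n"
  shows "measure (uniform_law k n) {f \<in> space (uniform_law k n). \<not> typical (k - 2) n f} \<le> 6 / 2 ^ n"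
proof -
  let ?U = "uniform_law k n" and ?m = "k - 2"
  interpret prob_space ?U by (rule prob_space_uniform_law)
  define L where "L = ln (2 ^ n :: real)"
  define \<tau> where "\<tau> = 2 * sqrt L"
  define s where "s = 10 * L / sqrt (2 ^ n)"
  have L: "1 / 2 < L" unfolding L_def by (rule half_less_ln_power[OF n])
  have "sqrt (1 / 4) < sqrt L" using L by (intro real_sqrt_less_mono) simp
  then have \<tau>: "1 < \<tau>" by (simp add: \<tau>_def real_sqrt_divide)
  have \<tau>2: "\<tau>\<^sup>2 = 4 * L" using L by (simp add: \<tau>_def power_mult_distrib)
  have s: "0 < s" using L by (simp add: s_def)
  have s2: "s\<^sup>2 = 100 * L\<^sup>2 / 2 ^ n" by (simp add: s_def power_mult_distrib power_divide)
  have expL: "exp (- L) = 1 / 2 ^ n" by (simp add: L_def exp_minus field_simps)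
  have e1: "exp (- \<tau>\<^sup>2 / 2) = (1 / 2 ^ n)\<^sup>2"
    unfolding \<tau>2 expL[symmetric] by (simp add: power2_eq_square flip: exp_add)
  have e2: "exp (- s\<^sup>2 / (2 * (4 * \<tau>\<^sup>2 / 2 ^ n))) \<le> (1 / 2 ^ n) ^ 3"
  proof -
    have "s\<^sup>2 / (2 * (4 * \<tau>\<^sup>2 / 2 ^ n)) = 100 / 32 * L"
      unfolding s2 \<tau>2 using L by (simp add: power2_eq_square field_simps)
    then have "- s\<^sup>2 / (2 * (4 * \<tau>\<^sup>2 / 2 ^ n)) \<le> - (3 * L)" using L by simp
    then have "exp (- s\<^sup>2 / (2 * (4 * \<tau>\<^sup>2 / 2 ^ n))) \<le> exp (- (3 * L))" by simp
    also have "exp (- (3 * L)) = (1 / 2 ^ n) ^ 3"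
      unfolding expL[symmetric] by (simp add: power3_eq_cube flip: exp_add)
    finally show ?thesis .
  qed
  note [measurable] = measurable_layer_uniform[of ?m k n] measurable_layer_uniform[of "?m - 1" k n]
  let ?S = "{f \<in> space ?U. \<not> signs ?m n f}"
  let ?A = "\<lambda>m x. {f \<in> space ?U. signs m n f \<and> \<tau> \<le> \<bar>layer n f m x\<bar>}"
  let ?C = "\<lambda>p. {f \<in> space ?U. signs ?m n f \<and> (\<forall>a\<in>cube n. \<bar>layer n f (?m - 1) a\<bar> \<le> \<tau>) \<and> s \<le> \<bar>correlation n f ?m (fst p) (snd p)\<bar>}"
  let ?P = "{p \<in> cube n \<times> cube n. fst p \<noteq> snd p}"
  have S_sets: "?S \<in> sets ?U" using sets_signs[of ?m k n] by (intro sets.sets_Collect_neg) auto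
  have A_sets: "?A m x \<in> sets ?U" if "m \<le> k" for m x
  proof -
    note [measurable] = measurable_layer_uniform[OF that]
    have "{f \<in> space ?U. \<tau> \<le> \<bar>layer n f m x\<bar>} \<in> sets ?U" by measurable
    from sets.sets_Collect_conj[OF this sets_signs[OF that]] show ?thesis .
  qed
  have C_sets: "?C p \<in> sets ?U" for p
  proof -
    have "{f \<in> space ?U. \<bar>layer n f (?m - 1) a\<bar> \<le> \<tau>} \<in> sets ?U" for a by measurable
    then have 1: "{f \<in> space ?U. \<forall>a\<in>cube n. \<bar>layer n f (?m - 1) a\<bar> \<le> \<tau>} \<in> sets ?U"
      by (intro sets.sets_Collect_finite_All) auto
    have 2: "{f \<in> space ?U. s \<le> \<bar>correlation n f ?m (fst p) (snd p)\<bar>} \<in> sets ?U"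
      unfolding correlation_def by measurable
    have "?m \<le> k" by simp
    from sets.sets_Collect_conj[OF sets.sets_Collect_conj[OF 2 1] sets_signs[OF this]] show ?thesis .
  qed
  have sub: "{f \<in> space ?U. \<not> typical ?m n f} \<subseteq> ?S \<union> (\<Union>x\<in>cube n. ?A ?m x) \<union> (\<Union>x\<in>cube n. ?A (?m - 1) x) \<union> (\<Union>p\<in>?P. ?C p)"
  proof
    fix f assume f: "f \<in> {f \<in> space ?U. \<not> typical ?m n f}"
    show "f \<in> ?S \<union> (\<Union>x\<in>cube n. ?A ?m x) \<union> (\<Union>x\<in>cube n. ?A (?m - 1) x) \<union> (\<Union>p\<in>?P. ?C p)"
    proof (rule ccontr)
      assume no: "\<not> ?thesis"
      have sp: "f \<in> space ?U" using f by simp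
      have sg: "signs ?m n f" using no sp by blast
      have sg': "signs (?m - 1) n f" by (rule signs_mono[OF sg]) simp
      have l: "\<bar>layer n f ?m x\<bar> \<le> \<tau>" if "x \<in> cube n" for x
      proof (rule ccontr)
        assume "\<not> ?thesis"
        then have "f \<in> ?A ?m x" using sp sg by simp
        then show False using no that by blast
      qed
      have l': "\<bar>layer n f (?m - 1) x\<bar> \<le> \<tau>" if "x \<in> cube n" for x
      proof (rule ccontr)
        assume "\<not> ?thesis"
        then have "f \<in> ?A (?m - 1) x" using sp sg' by simp
        then show False using no that by blast
      qed
      have c: "\<bar>correlation n f ?m y y'\<bar> \<le> s" if "y \<in> cube n" "y' \<in> cube n" "y \<noteq> y'" for y y'
      proof (rule ccontr)
        assume "\<not> ?thesis"
        then have "f \<in> ?C (y, y')" using sp sg l' by simp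
        moreover have "(y, y') \<in> ?P" using that by simp
        ultimately show False using no by blast
      qed
      have "typical ?m n f"
        unfolding typical_def using sg l c by (simp add: \<tau>_def s_def L_def)
      then show False using f by simp
    qed
  qed
  have b1: "measure ?U (\<Union>x\<in>cube n. ?A m x) \<le> 2 / 2 ^ n" if m: "m \<le> k" for m
  proof -
    have "measure ?U (\<Union>x\<in>cube n. ?A m x) \<le> (\<Sum>x\<in>cube n. measure ?U (?A m x))"
      using A_sets[OF m] by (intro measure_UNION_le) auto
    also have "\<dots> \<le> (\<Sum>x\<in>cube n. 2 * (1 / 2 ^ n)\<^sup>2)"
      by (rule sum_mono) (use layer_tail[OF m \<tau>, of n] in \<open>simp only: e1\<close>)
    also have "\<dots> = 2 / 2 ^ n" by (simp add: card_cube power2_eq_square)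
    finally show ?thesis .
  qed
  have b2: "measure ?U (\<Union>p\<in>?P. ?C p) \<le> 2 / 2 ^ n"
  proof -
    have fin: "finite ?P" by simp
    have "measure ?U (\<Union>p\<in>?P. ?C p) \<le> (\<Sum>p\<in>?P. measure ?U (?C p))"
      using C_sets by (intro measure_UNION_le fin) auto
    also have "\<dots> \<le> (\<Sum>p\<in>?P. 2 * (1 / 2 ^ n) ^ 3)"
    proof (rule sum_mono)
      fix p assume "p \<in> ?P"
      then have "measure ?U (?C p) \<le> 2 * exp (- s\<^sup>2 / (2 * (4 * \<tau>\<^sup>2 / 2 ^ n)))"
        using \<tau> s by (intro correlation_tail) auto
      then show "measure ?U (?C p) \<le> 2 * (1 / 2 ^ n) ^ 3" using e2 by linarith
    qed
    also have "\<dots> = real (card ?P) * (2 * (1 / 2 ^ n) ^ 3)" by simp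
    also have "\<dots> \<le> (2 ^ n)\<^sup>2 * (2 * (1 / 2 ^ n) ^ 3)"
    proof (rule mult_right_mono)
      have "card ?P \<le> card (cube n \<times> cube n)" by (intro card_mono) auto
      then have "real (card ?P) \<le> real (card (cube n \<times> cube n))" by (simp only: of_nat_le_iff)
      then show "real (card ?P) \<le> (2 ^ n)\<^sup>2" by (simp add: card_cartesian_product card_cube power2_eq_square)
    qed simp
    also have "\<dots> = 2 / 2 ^ n" by (simp add: power2_eq_square power3_eq_cube)
    finally show ?thesis .
  qed
  have b0: "measure ?U ?S = 0"
  proof -
    have "emeasure ?U ?S = 0"
      using AE_signs[of k n] S_sets by (intro AE_iff_measurable[THEN iffD1]) auto
    then show ?thesis by (simp add: measure_def)
  qed
  have sA: "(\<Union>x\<in>cube n. ?A m x) \<in> sets ?U" if "m \<le> k" for m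
    using A_sets[OF that] by (intro sets.finite_UN) auto
  have sC: "(\<Union>p\<in>?P. ?C p) \<in> sets ?U" using C_sets by (intro sets.finite_UN) auto
  have k: "?m \<le> k" "?m - 1 \<le> k" by auto
  have "measure ?U {f \<in> space ?U. \<not> typical ?m n f} \<le>
      measure ?U (?S \<union> (\<Union>x\<in>cube n. ?A ?m x) \<union> (\<Union>x\<in>cube n. ?A (?m - 1) x) \<union> (\<Union>p\<in>?P. ?C p))"
    by (rule finite_measure_mono[OF sub]) (intro sets.Un S_sets sA[OF k(1)] sA[OF k(2)] sC)
  also have "\<dots> \<le> measure ?U (?S \<union> (\<Union>x\<in>cube n. ?A ?m x) \<union> (\<Union>x\<in>cube n. ?A (?m - 1) x)) + measure ?U (\<Union>p\<in>?P. ?C p)"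
    by (intro measure_Un_le sets.Un S_sets sA[OF k(1)] sA[OF k(2)] sC)
  also have "measure ?U (?S \<union> (\<Union>x\<in>cube n. ?A ?m x) \<union> (\<Union>x\<in>cube n. ?A (?m - 1) x)) \<le>
      measure ?U (?S \<union> (\<Union>x\<in>cube n. ?A ?m x)) + measure ?U (\<Union>x\<in>cube n. ?A (?m - 1) x)"
    by (intro measure_Un_le sets.Un S_sets sA[OF k(1)] sA[OF k(2)])
  also have "measure ?U (?S \<union> (\<Union>x\<in>cube n. ?A ?m x)) \<le> measure ?U ?S + measure ?U (\<Union>x\<in>cube n. ?A ?m x)"
    by (intro measure_Un_le S_sets sA[OF k(1)])
  finally show ?thesis using b0 b1[OF k(1)] b1[OF k(2)] b2 by linarith
qed

section \<open>The Gaussian levels\<close>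

definition gauss_points :: "nat \<Rightarrow> nat \<Rightarrow> point set" where
  "gauss_points k n = {k - 1, k} \<times> cube n"

definition free_points :: "nat \<Rightarrow> nat \<Rightarrow> point set" where
  "free_points k n = {k - 1} \<times> cube n"

text \<open>Under the forrelated law the value at a point \<open>p\<close> of the last two levels is the inner product of \<open>direction k n f p\<close>
  with the values on level \<open>k - 1\<close>.\<close>
definition direction :: "nat \<Rightarrow> nat \<Rightarrow> (point \<Rightarrow> real) \<Rightarrow> point \<Rightarrow> point \<Rightarrow> real" where
  "direction k n f p j = (if fst p = k - 1 then (if j = p then 1 else 0)
     else chi n (snd j) (snd p) * layer n f (k - 2) (snd j) / sqrt (2 ^ n))"

definition covariance :: "nat \<Rightarrow> nat \<Rightarrow> (point \<Rightarrow> real) \<Rightarrow> point \<Rightarrow> point \<Rightarrow> real" where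
  "covariance k n f p q = (if p = q then 0 else gram (free_points k n) (direction k n f) p q)"

lemma finite_gauss_points[simp]: "finite (gauss_points k n)" and finite_free_points[simp]: "finite (free_points k n)"
  by (auto simp: gauss_points_def free_points_def)

lemma sum_free_points: "(\<Sum>j\<in>free_points k n. h j) = (\<Sum>x\<in>cube n. h (k - 1, x))"
proof -
  have "free_points k n = Pair (k - 1) ` cube n" by (auto simp: free_points_def)
  then show ?thesis by (simp add: sum.reindex inj_on_def)
qed

lemma points_split:
  assumes "2 \<le> k"
  shows "points k n = points (k - 2) n \<union> gauss_points k n" "points (k - 2) n \<inter> gauss_points k n = {}"
    "points (k - 1) n = points (k - 2) n \<union> free_points k n" "points (k - 2) n \<inter> free_points k n = {}"
  using assms by (auto simp: points_def gauss_points_def free_points_def)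

lemma gram_direction_unit:
  assumes "2 \<le> k" "signs (k - 2) n f" "p \<in> gauss_points k n"
  shows "gram (free_points k n) (direction k n f) p p = 1"
proof (cases "fst p = k - 1")
  case True
  then obtain x where x: "p = (k - 1, x)" "x \<in> cube n" using assms by (cases p) (auto simp: gauss_points_def)
  have "gram (free_points k n) (direction k n f) p p = (\<Sum>j\<in>cube n. if j = x then 1 else 0)"
    unfolding gram_def sum_free_points by (intro sum.cong refl) (auto simp: direction_def x)
  then show ?thesis using x by simp
next
  case False
  have "gram (free_points k n) (direction k n f) p p = (\<Sum>x\<in>cube n. (layer n f (k - 2) x)\<^sup>2 / 2 ^ n)"
    unfolding gram_def sum_free_points using False
    by (intro sum.cong refl) (simp add: direction_def power2_eq_square)
  then show ?thesis using layer_parseval[OF assms(2)] by (simp flip: sum_divide_distrib)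
qed

text \<open>Distinct points on level \<open>k - 1\<close> have orthogonal basis vectors as
  directions. A mixed pair picks out a single layer value divided by sqrt N, which flatness bounds;
  a pair on level \<open>k\<close> gives a \<open>correlation\<close>.\<close>

lemma abs_covariance_le:
  assumes k: "2 \<le> k" and n: "1 \<le> n" and ty: "typical (k - 2) n f"
    and pq: "p \<in> gauss_points k n" "q \<in> gauss_points k n"
  shows "\<bar>covariance k n f p q\<bar> \<le> 10 * ln (2 ^ n) / sqrt (2 ^ n)" (is "_ \<le> ?e")
proof -
  let ?L = "ln (2 ^ n :: real)"
  have L: "1 / 2 < ?L" by (rule half_less_ln_power[OF n])
  have e: "0 \<le> ?e" using L by simp
  have mixed: "\<bar>gram (free_points k n) (direction k n f) (k - 1, x) (k, y)\<bar> \<le> ?e" if "x \<in> cube n" for x y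
  proof -
    have "gram (free_points k n) (direction k n f) (k - 1, x) (k, y) =
      (\<Sum>j\<in>cube n. if j = x then chi n x y * layer n f (k - 2) x / sqrt (2 ^ n) else 0)"
      unfolding gram_def sum_free_points using k by (intro sum.cong refl) (auto simp: direction_def)
    then have "\<bar>gram (free_points k n) (direction k n f) (k - 1, x) (k, y)\<bar> = \<bar>layer n f (k - 2) x\<bar> / sqrt (2 ^ n)"
      using that by (simp add: abs_mult)
    also have "\<dots> \<le> 2 * sqrt ?L / sqrt (2 ^ n)"
      using ty that by (intro divide_right_mono) (auto simp: typical_def)
    also have "\<dots> \<le> ?e"
    proof (rule divide_right_mono)
      \<comment> \<open>Here L > 1 / 2 enters: it makes L at most 4 L^2, so the flatness bound fits
        under the larger correlation bound.\<close>
      have "sqrt ?L \<le> 2 * ?L"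
      proof (rule real_le_lsqrt)
        have "?L * 1 \<le> ?L * (4 * ?L)" using L by (intro mult_left_mono) auto
        then show "?L \<le> (2 * ?L)\<^sup>2" by (simp add: power2_eq_square)
      qed (use L in simp)
      then show "2 * sqrt ?L \<le> 10 * ?L" using L by linarith
    qed simp
    finally show ?thesis .
  qed
  show ?thesis
  proof (cases "p = q")
    case True
    then show ?thesis using e by (simp add: covariance_def)
  next
    case False
    obtain i x j y where p: "p = (i, x)" and q: "q = (j, y)" by (cases p, cases q)
    have ij: "i = k - 1 \<or> i = k" "j = k - 1 \<or> j = k" and xy: "x \<in> cube n" "y \<in> cube n"
      using pq by (auto simp: gauss_points_def p q)
    consider "i = k - 1" "j = k - 1" | "i = k - 1" "j = k" | "i = k" "j = k - 1" | "i = k" "j = k" using ij by blast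
    then have "\<bar>gram (free_points k n) (direction k n f) p q\<bar> \<le> ?e"
    proof cases
      case 1
      then have "gram (free_points k n) (direction k n f) p q = 0"
        unfolding gram_def sum_free_points using False by (intro sum.neutral) (auto simp: direction_def p q)
      then show ?thesis using e by simp
    next
      case 2
      then show ?thesis using mixed[OF xy(1), of y] by (simp add: p q)
    next
      case 3
      then show ?thesis using mixed[OF xy(2), of x] by (simp add: p q gram_commute[of _ _ "(k, x)"])
    next
      case 4
      have "gram (free_points k n) (direction k n f) p q = correlation n f (k - 2) x y"
        unfolding gram_def sum_free_points correlation_def sum_divide_distrib
        using 4 k by (intro sum.cong refl) (auto simp: direction_def p q power2_eq_square)
      then show ?thesis using ty xy 4 False by (auto simp: typical_def p q)
    qed
    then show ?thesis using False by (simp add: covariance_def)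
  qed
qed

lemma covariance_cong:
  assumes "\<And>p. p \<in> points (k - 2) n \<Longrightarrow> f p = f' p"
  shows "covariance k n f p q = covariance k n f' p q"
proof -
  have "layer n f (k - 2) x = layer n f' (k - 2) x" for x
    by (rule layer_cong) (use assms in \<open>auto simp: points_def\<close>)
  then have "layer n f (k - 2) = layer n f' (k - 2)" by (rule ext)
  then show ?thesis by (simp only: covariance_def gram_def direction_def)
qed

text \<open>For fixed signs \<sigma> the forrelated input is linear in the Gaussian level
  \<open>k - 1\<close>, which links \<open>forrelated_law\<close> to the Gaussian comparison. The
  layers depend on \<sigma> alone, so merging in \<open>g\<close> does not disturb the
  directions.\<close>

lemma extend_forrelated_project:
  assumes k: "2 \<le> k" and \<sigma>: "\<sigma> \<in> space (Pi\<^sub>M (points (k - 2) n) M)" and g: "g \<in> space (gauss (free_points k n))"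
  shows "extend_forrelated k n (merge (points (k - 2) n) (free_points k n) (\<sigma>, g)) =
    merge (points (k - 2) n) (gauss_points k n) (\<sigma>, project (free_points k n) (gauss_points k n) (direction k n \<sigma>) g)"
proof
  fix p :: point
  let ?S = "points (k - 2) n" and ?J = "free_points k n" and ?B = "gauss_points k n"
  let ?f = "merge ?S ?J (\<sigma>, g)"
  have lay: "layer n ?f (k - 2) x = layer n \<sigma> (k - 2) x" for x
    by (rule layer_cong) (auto simp: merge_def points_def)
  have fJ: "?f j = g j" if "j \<in> ?J" for j using that points_split(4)[OF k, of n] by (auto simp: merge_def)
  note split = points_split[OF k, of n]
  consider "p \<in> ?S" | "p \<in> ?J" | "p \<in> ?B" "p \<notin> ?J" | "p \<notin> ?S \<union> ?B" by blast
  then show "extend_forrelated k n ?f p = merge ?S ?B (\<sigma>, project ?J ?B (direction k n \<sigma>) g) p"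
  proof cases
    case 1
    then have "fst p \<noteq> k" using k by (auto simp: points_def)
    then show ?thesis using 1 split by (auto simp: extend_forrelated_def merge_def)
  next
    case 2
    then have p: "p \<in> ?B" "fst p = k - 1" "p \<notin> ?S" "fst p \<noteq> k" using k split by (auto simp: free_points_def gauss_points_def)
    have "(\<Sum>j\<in>?J. direction k n \<sigma> p j * g j) = (\<Sum>j\<in>?J. if j = p then g j else 0)"
      using p by (intro sum.cong) (auto simp: direction_def)
    also have "\<dots> = g p" using 2 by simp
    finally show ?thesis using p 2 split by (auto simp: extend_forrelated_def merge_def project_def)
  next
    case 3
    then obtain y where p: "p = (k, y)" "p \<notin> ?S" using k split by (cases p) (auto simp: free_points_def gauss_points_def)
    have Suc: "k - 1 = Suc (k - 2)" using k by simp
    have "forrelation k n ?f y = (\<Sum>x\<in>cube n. chi n x y * (?f (k - 1, x) * layer n \<sigma> (k - 2) x)) / sqrt (2 ^ n)"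
      unfolding forrelation_layer[OF k] Suc layer.simps hadamard_def lay ..
    also have "\<dots> = (\<Sum>x\<in>cube n. chi n x y * layer n \<sigma> (k - 2) x / sqrt (2 ^ n) * g (k - 1, x))"
      unfolding sum_divide_distrib using fJ by (intro sum.cong refl) (simp add: free_points_def)
    also have "\<dots> = project ?J ?B (direction k n \<sigma>) g p"
    proof -
      have "k \<noteq> k - 1" using k by simp
      then have "direction k n \<sigma> p (k - 1, x) = chi n x y * layer n \<sigma> (k - 2) x / sqrt (2 ^ n)" for x
        by (simp only: direction_def p fst_conv snd_conv if_False)
      then show ?thesis using 3 by (simp add: project_def sum_free_points)
    qed
    finally show ?thesis using 3 p split by (auto simp: extend_forrelated_def merge_def)
  next
    case 4
    then show ?thesis using split by (auto simp: extend_forrelated_def merge_def)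
  qed
qed

section \<open>Comparison of the two laws for one fixed strategy\<close>

locale forrelation_run =
  fixes k n T :: nat and nq :: "nat \<Rightarrow> (nat \<Rightarrow> real) \<Rightarrow> point"
  assumes k: "2 \<le> k" and n: "1 \<le> n"
    and nq_meas: "\<And>t. t < T \<Longrightarrow> nq t \<in> Pi\<^sub>M {..<t} (\<lambda>_. borel) \<rightarrow>\<^sub>M count_space (points k n)"

sublocale forrelation_run \<subseteq> correlated "points k n" "coord_law k" nq T "gauss_points k n" "covariance k n"
proof (intro correlated.intro adaptive.intro correlated_axioms.intro)
  show "finite (points k n)" by simp
  show "prob_space (coord_law k p)" "sets (coord_law k p) = sets borel" for p
    by (simp_all add: prob_space_coord_law sets_coord_law)
  show "nq t \<in> Pi\<^sub>M {..<t} (\<lambda>_. borel) \<rightarrow>\<^sub>M count_space (points k n)" if "t < T" for t by (rule nq_meas[OF that])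
  show "gauss_points k n \<subseteq> points k n" using points_split[OF k] by blast
  show "(\<integral>\<^sup>+z. ennreal (exp (m * z - m\<^sup>2 / 2)) \<partial>coord_law k p) \<le> 1" for m p by (rule coord_law_subgaussian)
  have "(\<lambda>f. direction k n f p j) \<in> borel_measurable (uniform_law k n)" for p j
    unfolding direction_def using measurable_layer_uniform[of "k - 2" k n] by simp
  then show "(\<lambda>f. covariance k n f p q) \<in> borel_measurable (Pi\<^sub>M (points k n) (coord_law k))" for p q
    unfolding covariance_def gram_def uniform_law_def[symmetric] by simp
  show "covariance k n (f(r := z)) p q = covariance k n f p q" if "r \<in> gauss_points k n" for f p q r z
    by (rule covariance_cong) (use that points_split(2)[OF k] in auto)
  show "covariance k n f p q = covariance k n f q p" "covariance k n f p p = 0" for f p q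
    by (simp_all add: covariance_def gram_commute)
qed

context forrelation_run
begin

abbreviation B :: "point set" where "B \<equiv> gauss_points k n"
abbreviation S :: "point set" where "S \<equiv> points (k - 2) n"
abbreviation J :: "point set" where "J \<equiv> free_points k n"

text \<open>The exponent of \<open>gauss_project_density_ge\<close> with the queried set taken from
  the run itself; the first sum there appears as \<open>energy\<close>, and each inner sum as a
  \<open>pull\<close>.\<close>

definition weight :: "(point \<Rightarrow> real) \<Rightarrow> real" where
  "weight f = energy f T - (\<Sum>p\<in>B. if visited f T p then (pull f T p)\<^sup>2 else 0)"

lemma measurable_weight: "weight \<in> borel_measurable law"
proof -
  have "(\<lambda>f. if visited f T p then (pull f T p)\<^sup>2 else 0) \<in> borel_measurable law" if p: "p \<in> B" for p
  proof -
    note [measurable] = measurable_pull[OF order_refl p]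
    have [measurable]: "Measurable.pred law (\<lambda>f. visited f T p)" using B_subset p by (intro pred_visited) auto
    show ?thesis by measurable
  qed
  then show ?thesis unfolding weight_def
    by (intro borel_measurable_diff borel_measurable_sum measurable_energy[OF order_refl])
qed

lemma weight_ge:
  assumes "tame a \<tau> f"
  shows "- (\<tau> + real T * a\<^sup>2) \<le> weight f"
proof -
  have "(pull f T p)\<^sup>2 \<le> a\<^sup>2" if "p \<in> B" for p
    using assms that unfolding tame_def by (metis abs_ge_zero power2_abs power_mono order_refl)
  then have "qsum B (\<lambda>_ p f. (pull f T p)\<^sup>2) f T \<le> real T * a\<^sup>2"
    by (intro qsum_le) auto
  then have "(\<Sum>p\<in>B. if visited f T p then (pull f T p)\<^sup>2 else 0) \<le> real T * a\<^sup>2"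
    unfolding qsum_visited .
  then show ?thesis using assms unfolding weight_def tame_def by linarith
qed

lemma card_visited: "card {p \<in> B. visited f T p} \<le> T"
proof -
  have "{p \<in> B. visited f T p} \<subseteq> query f ` {..<T}" unfolding visited_def by blast
  then have "card {p \<in> B. visited f T p} \<le> card (query f ` {..<T})" by (intro card_mono) auto
  also have "\<dots> \<le> T" using card_image_le[of "{..<T}" "query f"] by simp
  finally show ?thesis .
qed

lemma PiM_gauss_points: "Pi\<^sub>M B (coord_law k) = gauss B" and PiM_free_points: "Pi\<^sub>M J (coord_law k) = gauss J"
  using k by (auto intro!: PiM_cong simp: coord_law_def gauss_points_def free_points_def)

lemma measurable_merge_fixed:
  assumes "\<sigma> \<in> space (Pi\<^sub>M S (coord_law k))"
  shows "(\<lambda>b. merge S B (\<sigma>, b)) \<in> gauss B \<rightarrow>\<^sub>M law"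
proof -
  have "Pair \<sigma> \<in> gauss B \<rightarrow>\<^sub>M Pi\<^sub>M S (coord_law k) \<Otimes>\<^sub>M Pi\<^sub>M B (coord_law k)"
    unfolding PiM_gauss_points by (rule measurable_Pair1'[OF assms])
  from measurable_compose[OF this measurable_merge] show ?thesis
    by (simp flip: points_split(1)[OF k])
qed

lemma density_step:
  assumes \<sigma>: "\<sigma> \<in> space (Pi\<^sub>M S (coord_law k))" and ty: "typical (k - 2) n \<sigma>"
    and T: "real T * (10 * ln (2 ^ n) / sqrt (2 ^ n)) \<le> 1 / 2"
    and A: "{f \<in> space law. P (run f T)} \<in> sets law"
  shows "(\<integral>\<^sup>+b. indicator {f. P (run f T)} (merge S B (\<sigma>, b)) * ennreal (exp (weight (merge S B (\<sigma>, b)))) \<partial>gauss B)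
    \<le> (\<integral>\<^sup>+g. indicator {f. P (run f T)} (merge S B (\<sigma>, project J B (direction k n \<sigma>) g)) \<partial>gauss J)"
proof -
  define m where "m b = merge S B (\<sigma>, b)" for b :: "point \<Rightarrow> real"
  let ?v = "direction k n \<sigma>"
  define V where "V b = {p \<in> B. visited (m b) T p}" for b
  define F where "F W b = (if P (run (m b) T) \<and> V b = W then 1 else 0 :: ennreal)" for W b
  have m_meas: "m \<in> gauss B \<rightarrow>\<^sub>M law" unfolding m_def by (rule measurable_merge_fixed[OF \<sigma>])
  have mB: "m b p = b p" if "p \<in> B" for b p using that points_split(2)[OF k, of n] by (auto simp: m_def merge_def)
  have mS: "m b p = \<sigma> p" if "p \<in> S" for b p using that by (simp add: m_def merge_def)
  have cov: "covariance k n (m b) p q = covariance k n \<sigma> p q" for b p q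
    by (rule covariance_cong) (rule mS)
  have F_meas: "F W \<in> borel_measurable (gauss B)" if W: "W \<subseteq> B" for W
  proof -
    have 1: "{b \<in> space (gauss B). P (run (m b) T)} \<in> sets (gauss B)"
    proof -
      have "{b \<in> space (gauss B). P (run (m b) T)} = m -` {f \<in> space law. P (run f T)} \<inter> space (gauss B)"
        using measurable_space[OF m_meas] by auto
      then show ?thesis using measurable_sets[OF m_meas A] by simp
    qed
    have "{b \<in> space (gauss B). visited (m b) T p \<longleftrightarrow> p \<in> W} \<in> sets (gauss B)" if p: "p \<in> B" for p
    proof -
      have "Measurable.pred law (\<lambda>f. visited f T p)" using B_subset p by (intro pred_visited) auto
      from measurable_compose[OF m_meas this] have [measurable]: "Measurable.pred (gauss B) (\<lambda>b. visited (m b) T p)" .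
      show ?thesis by measurable
    qed
    then have "{b \<in> space (gauss B). \<forall>p\<in>B. visited (m b) T p \<longleftrightarrow> p \<in> W} \<in> sets (gauss B)"
      by (intro sets.sets_Collect_finite_All) auto
    from sets.sets_Collect_conj[OF this 1]
    have "{b \<in> space (gauss B). P (run (m b) T) \<and> (\<forall>p\<in>B. visited (m b) T p \<longleftrightarrow> p \<in> W)} \<in> sets (gauss B)" .
    moreover have "V b = W \<longleftrightarrow> (\<forall>p\<in>B. visited (m b) T p \<longleftrightarrow> p \<in> W)" for b
      using W by (auto simp: V_def)
    ultimately have [measurable]: "Measurable.pred (gauss B) (\<lambda>b. P (run (m b) T) \<and> V b = W)" by (simp add: pred_def)
    show ?thesis unfolding F_def by measurable
  qed
  \<comment> \<open>The set \<open>V b\<close> certifies itself: changing coordinates outside it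
    changes neither the run nor the visited set. Hence \<open>F W\<close> depends only on the
    coordinates in \<open>W\<close>, although the strategy is adaptive.\<close>
  have agree: "run (m b') T = run (m b) T \<and> V b' = V b"
    if b: "b \<in> space (gauss B)" "b' \<in> space (gauss B)" "\<And>p. p \<in> V b \<Longrightarrow> b p = b' p" for b b'
  proof -
    have eq: "m b p = m b' p" if p: "visited (m b) T p" for p
    proof -
      obtain s where "s < T" "p = query (m b) s" using p by (auto simp: visited_def)
      then have "p \<in> points k n" using query_in measurable_space[OF m_meas b(1)] by simp
      then consider "p \<in> S" | "p \<in> B" using points_split(1)[OF k] by blast
      then show ?thesis
      proof cases
        case 1
        then show ?thesis by (simp add: mS)
      next
        case 2
        then have "p \<in> V b" using p by (simp add: V_def)
        then show ?thesis using mB[OF 2] b(3) by simp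
      qed
    qed
    have "visited (m b') T p = visited (m b) T p" for p by (rule visited_cong[OF eq order_refl])
    then show ?thesis using run_cong[OF eq order_refl] by (simp add: V_def)
  qed
  have F_dep: "F W b = F W b'"
    if b: "b \<in> space (gauss B)" "b' \<in> space (gauss B)" "\<And>p. p \<in> W \<Longrightarrow> b p = b' p" for W b b'
  proof -
    have "P (run (m b') T) \<and> V b' = W" if "P (run (m b) T)" "V b = W"
      using agree[OF b(1,2)] b(3) that by simp
    moreover have "P (run (m b) T) \<and> V b = W" if "P (run (m b') T)" "V b' = W"
      using agree[OF b(2,1)] b(3) that by simp
    ultimately show ?thesis unfolding F_def by auto
  qed
  have sum_F: "indicator {f. P (run f T)} (m b) = (\<Sum>W\<in>Pow B. F W b)" for b
  proof -
    have "V b \<in> Pow B" by (auto simp: V_def)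
    moreover have "(\<Sum>W\<in>Pow B. F W b) = (\<Sum>W\<in>Pow B. if W = V b then indicator {f. P (run f T)} (m b) else 0)"
      by (intro sum.cong) (auto simp: F_def)
    ultimately show ?thesis by simp
  qed
  have weight_m: "weight (m b) = (\<Sum>p\<in>W. b p * (\<Sum>q\<in>W. covariance k n \<sigma> p q * b q)) / 2 - (\<Sum>p\<in>W. (\<Sum>q\<in>W. covariance k n \<sigma> p q * b q)\<^sup>2)"
    if W: "V b = W" for b W
  proof -
    have sumV: "(\<Sum>p\<in>B. if visited (m b) T p then h p else 0) = (\<Sum>p\<in>W. h p)" for h :: "point \<Rightarrow> real"
      unfolding W[symmetric] V_def by (rule sum.inter_filter[symmetric]) simp
    have WB: "W \<subseteq> B" using W by (auto simp: V_def)
    have pull: "pull (m b) T p = (\<Sum>q\<in>W. covariance k n \<sigma> p q * b q)" for p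
      unfolding pull_def sumV cov using WB mB by (intro sum.cong) auto
    have "2 * energy (m b) T = (\<Sum>p\<in>W. b p * (\<Sum>q\<in>W. covariance k n \<sigma> p q * b q))"
      unfolding sum_visited_pull[symmetric] sumV pull using WB mB by (intro sum.cong) auto
    then show ?thesis unfolding weight_def sumV pull by simp
  qed
  have step: "(\<integral>\<^sup>+b. F W b * ennreal (exp (weight (m b))) \<partial>gauss B) \<le> (\<integral>\<^sup>+g. F W (project J B ?v g) \<partial>gauss J)"
    if W: "W \<subseteq> B" for W
  proof (cases "card W \<le> T")
    case True
    have "real (card W) * (10 * ln (2 ^ n) / sqrt (2 ^ n)) \<le> real T * (10 * ln (2 ^ n) / sqrt (2 ^ n))"
      using True by (intro mult_right_mono) auto
    then have card: "real (card W) * (10 * ln (2 ^ n) / sqrt (2 ^ n)) \<le> 1 / 2" using T by linarith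
    have "(\<integral>\<^sup>+b. F W b * ennreal (exp (weight (m b))) \<partial>gauss B) =
      (\<integral>\<^sup>+b. F W b * ennreal (exp ((\<Sum>p\<in>W. b p * (\<Sum>q\<in>W. covariance k n \<sigma> p q * b q)) / 2 - (\<Sum>p\<in>W. (\<Sum>q\<in>W. covariance k n \<sigma> p q * b q)\<^sup>2))) \<partial>gauss B)"
    proof (rule nn_integral_cong)
      fix b
      show "F W b * ennreal (exp (weight (m b))) =
        F W b * ennreal (exp ((\<Sum>p\<in>W. b p * (\<Sum>q\<in>W. covariance k n \<sigma> p q * b q)) / 2 - (\<Sum>p\<in>W. (\<Sum>q\<in>W. covariance k n \<sigma> p q * b q)\<^sup>2)))"
      proof (cases "V b = W")
        case True
        show ?thesis unfolding weight_m[OF True] ..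
      next
        case False
        then show ?thesis by (simp add: F_def)
      qed
    qed
    also have "\<dots> \<le> (\<integral>\<^sup>+g. F W (project J B ?v g) \<partial>gauss J)"
    proof (rule gauss_project_density_ge[OF finite_free_points finite_gauss_points W _ _ _ card F_meas[OF W] F_dep])
      show "gram J ?v p p = 1" if "p \<in> W" for p
        using ty W that by (intro gram_direction_unit[OF k]) (auto simp: typical_def)
      show "\<bar>gram J ?v p q\<bar> \<le> 10 * ln (2 ^ n) / sqrt (2 ^ n)" if "p \<in> W" "q \<in> W" "p \<noteq> q" for p q
        using abs_covariance_le[OF k n ty, of p q] W that by (auto simp: covariance_def)
      show "covariance k n \<sigma> p q = (if p = q then 0 else gram J ?v p q)" for p q by (rule covariance_def)
    qed auto
    finally show ?thesis .
  next
    \<comment> \<open>A run of \<open>T\<close> queries never visits more than \<open>T\<close>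
      points, so larger sets contribute nothing; the remaining ones satisfy the size condition of
      the density bound.\<close>
    case False
    then have "V b \<noteq> W" for b using card_visited[of "m b"] by (auto simp: V_def)
    then show ?thesis by (simp add: F_def)
  qed
  have FW_meas: "(\<lambda>b. F W b * ennreal (exp (weight (m b)))) \<in> borel_measurable (gauss B)" if "W \<in> Pow B" for W
  proof -
    have [measurable]: "F W \<in> borel_measurable (gauss B)" using that by (intro F_meas) auto
    have [measurable]: "(\<lambda>b. weight (m b)) \<in> borel_measurable (gauss B)"
      by (rule measurable_compose[OF m_meas measurable_weight])
    show ?thesis by measurable
  qed
  have FP_meas: "(\<lambda>g. F W (project J B ?v g)) \<in> borel_measurable (gauss J)" if "W \<in> Pow B" for W
    using that by (intro measurable_compose[OF measurable_project F_meas]) auto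
  have "(\<integral>\<^sup>+b. indicator {f. P (run f T)} (m b) * ennreal (exp (weight (m b))) \<partial>gauss B) =
      (\<Sum>W\<in>Pow B. \<integral>\<^sup>+b. F W b * ennreal (exp (weight (m b))) \<partial>gauss B)"
    unfolding sum_F sum_distrib_right by (rule nn_integral_sum) (rule FW_meas)
  also have "\<dots> \<le> (\<Sum>W\<in>Pow B. \<integral>\<^sup>+g. F W (project J B ?v g) \<partial>gauss J)"
    by (intro sum_mono step) auto
  also have "\<dots> = (\<integral>\<^sup>+g. indicator {f. P (run f T)} (m (project J B ?v g)) \<partial>gauss J)"
    unfolding sum_F by (rule nn_integral_sum[symmetric]) (rule FP_meas)
  finally show ?thesis unfolding m_def .
qed

end

section \<open>Measurability of the two input laws\<close>

lemma sets_typical: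
  assumes "m \<le> k"
  shows "{f \<in> space (uniform_law k n). typical m n f} \<in> sets (uniform_law k n)"
proof -
  let ?U = "uniform_law k n"
  note [measurable] = measurable_layer_uniform[OF assms]
  have 1: "{f \<in> space ?U. \<forall>x\<in>cube n. \<bar>layer n f m x\<bar> \<le> t} \<in> sets ?U" for t
  proof (rule sets.sets_Collect_finite_All)
    show "{f \<in> space ?U. \<bar>layer n f m x\<bar> \<le> t} \<in> sets ?U" for x by measurable
  qed simp
  have 2: "{f \<in> space ?U. \<forall>y\<in>cube n. \<forall>y'\<in>cube n. y \<noteq> y' \<longrightarrow> \<bar>correlation n f m y y'\<bar> \<le> t} \<in> sets ?U" for t
  proof (intro sets.sets_Collect_finite_All finite_cube)
    show "{f \<in> space ?U. y \<noteq> y' \<longrightarrow> \<bar>correlation n f m y y'\<bar> \<le> t} \<in> sets ?U" for y y'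
      unfolding correlation_def by measurable
  qed
  show ?thesis unfolding typical_def
    by (rule sets.sets_Collect_conj[OF sets.sets_Collect_conj[OF 2 1] sets_signs[OF assms]])
qed

lemma product_sigma_finite_coord_law: "product_sigma_finite (coord_law k)"
  by (simp add: product_sigma_finite_def prob_space_imp_sigma_finite prob_space_coord_law)

lemma measurable_extend_forrelated:
  assumes "2 \<le> k"
  shows "extend_forrelated k n \<in> Pi\<^sub>M (points (k - 1) n) (coord_law k) \<rightarrow>\<^sub>M Pi\<^sub>M (points k n) (\<lambda>_. borel)"
  unfolding extend_forrelated_def
proof (rule measurable_restrict)
  fix p assume p: "p \<in> points k n"
  have comp: "(\<lambda>f. f q) \<in> borel_measurable (Pi\<^sub>M (points (k - 1) n) (coord_law k))" if "q \<in> points (k - 1) n" for q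
    using measurable_component_singleton[OF that, of "coord_law k"] measurable_cong_sets[OF refl sets_coord_law] by blast
  show "(\<lambda>f. if fst p = k then forrelation k n f (snd p) else f p) \<in> borel_measurable (Pi\<^sub>M (points (k - 1) n) (coord_law k))"
  proof (cases "fst p = k")
    case True
    have "(\<lambda>f. layer n f (k - 1) (snd p)) \<in> borel_measurable (Pi\<^sub>M (points (k - 1) n) (coord_law k))"
      by (intro measurable_layer comp) (auto simp: points_def)
    then show ?thesis using True by (simp add: forrelation_layer[OF assms])
  next
    case False
    then have "p \<in> points (k - 1) n" using p by (auto simp: points_def)
    then show ?thesis using False comp by simp
  qed
qed

lemma prob_space_forrelated_law: "2 \<le> k \<Longrightarrow> prob_space (forrelated_law k n)"
  unfolding forrelated_law_def
  by (intro prob_space.prob_space_distr prob_space_PiM prob_space_coord_law measurable_extend_forrelated)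

lemma sets_uniform_law: "sets (uniform_law k n) = sets (Pi\<^sub>M (points k n) (\<lambda>_. borel))"
  unfolding uniform_law_def by (intro sets_PiM_cong) (auto simp: sets_coord_law)

lemma sets_forrelated_law: "sets (forrelated_law k n) = sets (Pi\<^sub>M (points k n) (\<lambda>_. borel))"
  by (simp add: forrelated_law_def)

lemma space_forrelated_law: "space (forrelated_law k n) = space (uniform_law k n)"
  using sets_eq_imp_space_eq[OF sets_uniform_law] sets_eq_imp_space_eq[OF sets_forrelated_law] by metis

context forrelation_run
begin

lemma law_uniform: "law = uniform_law k n"
  by (simp add: uniform_law_def)

text \<open>Both laws draw the same signs, so the density comparison is made for each typical sign
  pattern and then integrated. Tameness is spent first, on bounding the weight from below;
  afterwards only typicality and the event itself remain.\<close>

lemma forrelated_ge: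
  assumes T: "real T * (10 * ln (2 ^ n) / sqrt (2 ^ n)) \<le> 1 / 2"
    and A: "{f \<in> space law. P (run f T)} \<in> sets law"
  shows "exp (- (\<tau> + real T * a\<^sup>2)) * measure law {f \<in> space law. typical (k - 2) n f \<and> tame a \<tau> f \<and> P (run f T)}
    \<le> measure (forrelated_law k n) {f \<in> space law. P (run f T)}"
proof -
  interpret F: prob_space "forrelated_law k n" by (rule prob_space_forrelated_law[OF k])
  interpret U: prob_space law by (intro prob_space_PiM prob_M)
  interpret product_sigma_finite "coord_law k" by (rule product_sigma_finite_coord_law)
  let ?E = "{f \<in> space law. P (run f T)}" and ?x = "extend_forrelated k n"
  let ?G = "{f \<in> space law. typical (k - 2) n f \<and> P (run f T)}"
  let ?H = "{f \<in> space law. typical (k - 2) n f \<and> tame a \<tau> f \<and> P (run f T)}"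
  let ?\<delta> = "\<tau> + real T * a\<^sup>2"
  have typ_sets: "{f \<in> space law. typical (k - 2) n f} \<in> sets law"
    using sets_typical[of "k - 2" k n] unfolding law_uniform by simp
  have G: "?G \<in> sets law" by (rule sets.sets_Collect_conj[OF A typ_sets])
  have H: "?H \<in> sets law" by (rule sets.sets_Collect_conj[OF sets.sets_Collect_conj[OF A sets_tame] typ_sets])
  have E_F: "?E \<in> sets (forrelated_law k n)" using A unfolding sets_forrelated_law law_uniform sets_uniform_law .
  have x_meas: "?x \<in> Pi\<^sub>M (points (k - 1) n) (coord_law k) \<rightarrow>\<^sub>M law"
    using measurable_extend_forrelated[OF k] measurable_cong_sets[OF refl sets_uniform_law] unfolding law_uniform by blast
  have "ennreal (exp (- ?\<delta>)) * emeasure law ?H = (\<integral>\<^sup>+f. ennreal (exp (- ?\<delta>)) * indicator ?H f \<partial>law)"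
    using H by (simp add: nn_integral_cmult)
  also have "\<dots> \<le> (\<integral>\<^sup>+f. indicator ?G f * ennreal (exp (weight f)) \<partial>law)"
  proof (rule nn_integral_mono)
    fix f
    show "ennreal (exp (- ?\<delta>)) * indicator ?H f \<le> indicator ?G f * ennreal (exp (weight f))"
    proof (cases "f \<in> ?H")
      case True
      then have "- ?\<delta> \<le> weight f" by (intro weight_ge) simp
      then have "ennreal (exp (- ?\<delta>)) \<le> ennreal (exp (weight f))" by (intro ennreal_leI) simp
      then show ?thesis using True by simp
    qed simp
  qed
  also have "\<dots> = (\<integral>\<^sup>+\<sigma>. \<integral>\<^sup>+b. indicator ?G (merge S B (\<sigma>, b)) * ennreal (exp (weight (merge S B (\<sigma>, b)))) \<partial>gauss B \<partial>Pi\<^sub>M S (coord_law k))"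
  proof -
    have m: "(\<lambda>f. indicator ?G f * ennreal (exp (weight f))) \<in> borel_measurable law"
    proof -
      note [measurable] = measurable_weight G
      show ?thesis by measurable
    qed
    have eq: "law = Pi\<^sub>M (S \<union> B) (coord_law k)" by (simp only: points_split(1)[OF k, of n, symmetric])
    show ?thesis
      by (rule product_nn_integral_fold[OF points_split(2)[OF k] finite_points finite_gauss_points m[unfolded eq],
            folded eq, unfolded PiM_gauss_points])
  qed
  also have "\<dots> \<le> (\<integral>\<^sup>+\<sigma>. \<integral>\<^sup>+g. indicator ?E (?x (merge S J (\<sigma>, g))) \<partial>gauss J \<partial>Pi\<^sub>M S (coord_law k))"
  proof (rule nn_integral_mono)
    fix \<sigma> assume \<sigma>: "\<sigma> \<in> space (Pi\<^sub>M S (coord_law k))"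
    have ty: "typical (k - 2) n (merge S B (\<sigma>, b)) = typical (k - 2) n \<sigma>" for b
      by (rule typical_cong) (auto simp: merge_def points_def)
    have sp: "merge S B (\<sigma>, b) \<in> space law" if "b \<in> space (gauss B)" for b
      by (rule measurable_space[OF measurable_merge_fixed[OF \<sigma>] that])
    show "(\<integral>\<^sup>+b. indicator ?G (merge S B (\<sigma>, b)) * ennreal (exp (weight (merge S B (\<sigma>, b)))) \<partial>gauss B)
        \<le> (\<integral>\<^sup>+g. indicator ?E (?x (merge S J (\<sigma>, g))) \<partial>gauss J)"
    proof (cases "typical (k - 2) n \<sigma>")
      case True
      have "(\<integral>\<^sup>+b. indicator ?G (merge S B (\<sigma>, b)) * ennreal (exp (weight (merge S B (\<sigma>, b)))) \<partial>gauss B) =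
        (\<integral>\<^sup>+b. indicator {f. P (run f T)} (merge S B (\<sigma>, b)) * ennreal (exp (weight (merge S B (\<sigma>, b)))) \<partial>gauss B)"
        using sp ty True by (intro nn_integral_cong) (simp add: indicator_def)
      also have "\<dots> \<le> (\<integral>\<^sup>+g. indicator {f. P (run f T)} (merge S B (\<sigma>, project J B (direction k n \<sigma>) g)) \<partial>gauss J)"
        by (rule density_step[OF \<sigma> True T A])
      also have "\<dots> = (\<integral>\<^sup>+g. indicator ?E (?x (merge S J (\<sigma>, g))) \<partial>gauss J)"
      proof (rule nn_integral_cong)
        fix g assume g: "g \<in> space (gauss J)"
        have "project J B (direction k n \<sigma>) g \<in> space (gauss B)" by (rule measurable_space[OF measurable_project g])
        then show "indicator {f. P (run f T)} (merge S B (\<sigma>, project J B (direction k n \<sigma>) g)) = (indicator ?E (?x (merge S J (\<sigma>, g))) :: ennreal)"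
          unfolding extend_forrelated_project[OF k \<sigma> g] using sp by (simp add: indicator_def)
      qed
      finally show ?thesis .
    next
      case False
      then show ?thesis using ty by (simp add: indicator_def)
    qed
  qed
  also have "\<dots> = (\<integral>\<^sup>+f. indicator ?E (?x f) \<partial>Pi\<^sub>M (points (k - 1) n) (coord_law k))"
  proof -
    have m: "(\<lambda>f. indicator ?E (?x f) :: ennreal) \<in> borel_measurable (Pi\<^sub>M (points (k - 1) n) (coord_law k))"
      by (rule measurable_compose[OF x_meas borel_measurable_indicator[OF A]])
    have eq: "Pi\<^sub>M (points (k - 1) n) (coord_law k) = Pi\<^sub>M (S \<union> J) (coord_law k)"
      by (simp only: points_split(3)[OF k, of n, symmetric])
    show ?thesis
      by (rule product_nn_integral_fold[OF points_split(4)[OF k] finite_points finite_free_points m[unfolded eq],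
            folded eq, unfolded PiM_free_points, symmetric])
  qed
  also have "\<dots> = (\<integral>\<^sup>+f. indicator ?E f \<partial>forrelated_law k n)"
    unfolding forrelated_law_def
    using E_F by (intro nn_integral_distr[symmetric] measurable_extend_forrelated[OF k] borel_measurable_indicator) (simp add: sets_forrelated_law)
  also have "\<dots> = emeasure (forrelated_law k n) ?E" using E_F by simp
  finally show ?thesis
    by (simp add: U.emeasure_eq_measure F.emeasure_eq_measure flip: ennreal_mult)
qed

lemma card_gauss_points: "card B = 2 * 2 ^ n"
  using k by (simp add: gauss_points_def card_cartesian_product card_cube)

lemma forrelated_close_aux:
  assumes T: "real T * (10 * ln (2 ^ n) / sqrt (2 ^ n)) \<le> 1 / 2" and nonneg: "0 \<le> a" "0 \<le> \<tau>"
    and v: "0 < v" "real T * (10 * ln (2 ^ n) / sqrt (2 ^ n))\<^sup>2 \<le> v" and w: "0 < w" "real T * a\<^sup>2 \<le> w"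
    and A: "{f \<in> space law. P (run f T)} \<in> sets law"
  shows "measure law {f \<in> space law. P (run f T)} - measure (forrelated_law k n) {f \<in> space law. P (run f T)}
    \<le> \<tau> + w + 6 / 2 ^ n + 4 * (real T + 1) * 2 ^ n * exp (- a\<^sup>2 / (2 * v)) + 2 * exp (- \<tau>\<^sup>2 / (2 * w))"
proof -
  interpret U: prob_space law by (intro prob_space_PiM prob_M)
  let ?e = "10 * ln (2 ^ n) / sqrt (2 ^ n) :: real"
  let ?E = "{f \<in> space law. P (run f T)}"
  let ?N = "{f \<in> space law. \<not> typical (k - 2) n f}"
  let ?M = "{f \<in> space law. small_correlations ?e f \<and> \<not> tame a \<tau> f}"
  let ?H = "{f \<in> space law. typical (k - 2) n f \<and> tame a \<tau> f \<and> P (run f T)}"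
  have typ_sets: "{f \<in> space law. typical (k - 2) n f} \<in> sets law"
    using sets_typical[of "k - 2" k n] unfolding law_uniform by simp
  have H: "?H \<in> sets law" by (rule sets.sets_Collect_conj[OF sets.sets_Collect_conj[OF A sets_tame] typ_sets])
  have N: "?N \<in> sets law" by (rule sets.sets_Collect_neg[OF typ_sets])
  have M: "?M \<in> sets law"
    by (rule sets.sets_Collect_conj[OF sets.sets_Collect_neg[OF sets_tame] sets_small_correlations])
  \<comment> \<open>Typical signs have small correlations by \<open>abs_covariance_le\<close>, so an
    input of the event outside \<open>?H\<close> is either atypical or counted in
    \<open>?M\<close>.\<close>
  have "?E \<subseteq> ?H \<union> ?N \<union> ?M"
    using abs_covariance_le[OF k n] unfolding small_correlations_def by blast
  then have "measure law ?E \<le> measure law (?H \<union> ?N \<union> ?M)" using H N M by (intro U.finite_measure_mono) auto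
  also have "\<dots> \<le> measure law (?H \<union> ?N) + measure law ?M" using H N M by (intro measure_Un_le) auto
  also have "measure law (?H \<union> ?N) \<le> measure law ?H + measure law ?N" using H N by (intro measure_Un_le) auto
  also have "measure law ?N \<le> 6 / 2 ^ n" using measure_not_typical[OF n, of k] unfolding law_uniform .
  also have "measure law ?M \<le> 2 * (real T + 1) * real (card B) * exp (- a\<^sup>2 / (2 * v)) + 2 * exp (- \<tau>\<^sup>2 / (2 * w))"
    by (rule not_tame_le[OF v w nonneg])
  finally have 1: "measure law ?E \<le> measure law ?H + 6 / 2 ^ n + 4 * (real T + 1) * 2 ^ n * exp (- a\<^sup>2 / (2 * v)) + 2 * exp (- \<tau>\<^sup>2 / (2 * w))"
    by (simp add: card_gauss_points algebra_simps)
  have "measure law ?H - (\<tau> + w) \<le> exp (- (\<tau> + real T * a\<^sup>2)) * measure law ?H"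
  proof -
    let ?d = "\<tau> + real T * a\<^sup>2"
    have "1 - ?d \<le> exp (- ?d)" using exp_ge_add_one_self[of "- ?d"] by (simp only: diff_conv_add_uminus)
    then have "(1 - ?d) * measure law ?H \<le> exp (- ?d) * measure law ?H" by (intro mult_right_mono) auto
    moreover have "?d * measure law ?H \<le> ?d * 1" using nonneg by (intro mult_left_mono) auto
    ultimately show ?thesis using w by (simp add: left_diff_distrib)
  qed
  also have "\<dots> \<le> measure (forrelated_law k n) ?E" by (rule forrelated_ge[OF T A])
  finally show ?thesis using 1 by linarith
qed

lemma forrelated_close:
  assumes L: "20 \<le> ln (2 ^ n :: real)" and T: "real T < sqrt (2 ^ n) / ln (2 ^ n) powr (7 / 2)"
    and A: "{f \<in> space law. P (run f T)} \<in> sets law"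
  shows "\<bar>measure (forrelated_law k n) {f \<in> space law. P (run f T)} - measure law {f \<in> space law. P (run f T)}\<bar> \<le> 5000 / ln (2 ^ n)"
proof -
  define L where "L = ln (2 ^ n :: real)"
  define N where "N = (2 ^ n :: real)"
  define R where "R = L powr (7 / 2)"
  define e where "e = 10 * L / sqrt N"
  define T0 where "T0 = sqrt N / R"
  have L20: "20 \<le> L" using L by (simp add: L_def)
  have N: "0 < N" "exp L = N" "1 \<le> N" by (simp_all add: N_def L_def)
  have "R * R = L powr (7 / 2 + 7 / 2)" unfolding R_def by (rule powr_add[symmetric])
  also have "\<dots> = L ^ 7" using L20 by (simp add: powr_numeral)
  finally have RR: "R * R = L ^ 7" .
  have "L powr 2 \<le> R" unfolding R_def using L20 by (intro powr_mono) auto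
  then have RL2: "L\<^sup>2 \<le> R" using L20 by (simp add: powr_numeral)
  \<comment> \<open>The threshold 20 for L is chosen for this inequality: with
    \<open>T0 * e = 10 * L / R\<close> it gives the density condition
    \<open>T * e \<le> 1 / 2\<close>.\<close>
  have RL: "20 * L \<le> R"
  proof -
    have "20 * L \<le> L * L" using L20 by (intro mult_right_mono) auto
    then show ?thesis using RL2 by (simp add: power2_eq_square)
  qed
  have R0: "0 < R" using RL L20 by linarith
  have T0: "real T \<le> T0" "0 < T0" using T N R0 by (auto simp: T0_def R_def L_def N_def)
  have e0: "0 < e" using L20 N by (simp add: e_def)
  have T0e: "T0 * e = 10 * L / R" using N R0 by (simp add: T0_def e_def)
  \<comment> \<open>\<open>v\<close> bounds the quadratic variation of a pull and \<open>w\<close>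
    that of the energy. The factor 8 in \<open>a\<close> makes
    \<open>a\<^sup>2 / (2 * v) = 4 * L\<close>, so each pull exceeds \<open>a\<close> with
    probability at most 2 / N^4, which beats the union over points and times.\<close>
  define v where "v = T0 * e\<^sup>2"
  define a where "a = sqrt (8 * L * v)"
  define w where "w = T0 * a\<^sup>2"
  have v: "0 < v" using T0 e0 by (simp add: v_def)
  have a2: "a\<^sup>2 = 8 * L * v" using v L20 by (simp add: a_def)
  have a0: "0 < a" using v L20 by (simp add: a_def)
  have w: "0 < w" using T0 a0 by (simp add: w_def)
  \<comment> \<open>\<open>w\<close> equals
    \<open>8 * L * (T0 * e)\<^sup>2 = 800 * L ^ 3 / R\<^sup>2\<close>, and
    \<open>R\<^sup>2 = L ^ 7\<close>. A deviation of the energy by 1 / L then has exponent L^2 /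
    1600, which tends to infinity.\<close>
  have w_eq: "w = 800 / L ^ 4"
  proof -
    have "w = 8 * L * (T0 * e) * (T0 * e)" unfolding w_def a2 v_def by (simp add: power2_eq_square)
    also have "\<dots> = 800 * L ^ 3 / (R * R)" unfolding T0e by (simp add: power3_eq_cube)
    also have "\<dots> = 800 / L ^ 4" unfolding RR using L20 by (simp add: field_simps flip: power_add)
    finally show ?thesis .
  qed
  have Te: "real T * e \<le> 1 / 2"
  proof -
    have "real T * e \<le> T0 * e" using T0 e0 by (intro mult_right_mono) auto
    also have "\<dots> \<le> 1 / 2" unfolding T0e using RL R0 by (simp add: field_simps)
    finally show ?thesis .
  qed
  have Tv: "real T * e\<^sup>2 \<le> v" unfolding v_def using T0 by (intro mult_right_mono) auto
  have Tw: "real T * a\<^sup>2 \<le> w" unfolding w_def using T0 by (intro mult_right_mono) auto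
  \<comment> \<open>Only a total of order 1 / L is aimed at, so exponential savings may be weakened
    to reciprocals; the constants 1, 800, 6, 8 and 3200 add up to less than 5000.\<close>
  have exp_le: "exp (- x) \<le> 1 / x" if "0 < x" for x :: real
  proof -
    have "x \<le> exp x" using exp_ge_add_one_self[of x] by linarith
    then show ?thesis using that by (simp add: exp_minus field_simps)
  qed
  have b1: "6 / N \<le> 6 / L" using exp_le[of L] L20 N by (simp add: exp_minus field_simps)
  have b2: "4 * (real T + 1) * N * exp (- a\<^sup>2 / (2 * v)) \<le> 8 / L"
  proof -
    have "a\<^sup>2 / (2 * v) = 4 * L" unfolding a2 using v by simp
    then have "exp (- a\<^sup>2 / (2 * v)) = exp (- L) * exp (- L) * exp (- L) * exp (- L)"
      by (simp flip: exp_add)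
    then have eq: "exp (- a\<^sup>2 / (2 * v)) = (1 / N) * (1 / N) * (1 / N) * (1 / N)"
      using N by (simp add: exp_minus inverse_eq_divide)
    have "sqrt N \<le> N" using N by (intro real_le_lsqrt) (auto simp: power2_eq_square)
    moreover have "T0 \<le> sqrt N"
    proof -
      have "1 \<le> R" using RL L20 by linarith
      then have "sqrt N / R \<le> sqrt N / 1" using N by (intro divide_left_mono) auto
      then show ?thesis by (simp add: T0_def)
    qed
    ultimately have "real T + 1 \<le> 2 * N" using T0 N by linarith
    then have "4 * (real T + 1) * N * exp (- a\<^sup>2 / (2 * v)) \<le> 4 * (2 * N) * N * exp (- a\<^sup>2 / (2 * v))"
      using N by (intro mult_right_mono mult_left_mono) auto
    also have "\<dots> = 8 * (1 / N) * (1 / N)" unfolding eq using N by simp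
    also have "\<dots> \<le> 8 * (1 / L) * 1"
    proof (intro mult_mono)
      show "1 / N \<le> 1 / L" using exp_le[of L] L20 N by (simp add: exp_minus field_simps)
    qed (use N L20 in auto)
    finally show ?thesis by simp
  qed
  have b3: "2 * exp (- (1 / L)\<^sup>2 / (2 * w)) \<le> 3200 / L"
  proof -
    have "(1 / L)\<^sup>2 / (2 * w) = L\<^sup>2 / 1600"
      unfolding w_eq using L20 by (simp add: field_simps power2_eq_square power4_eq_xxxx)
    then have "2 * exp (- (1 / L)\<^sup>2 / (2 * w)) = 2 * exp (- (L\<^sup>2 / 1600))" by simp
    also have "\<dots> \<le> 2 * (1 / (L\<^sup>2 / 1600))" using L20 by (intro mult_left_mono exp_le) auto
    also have "\<dots> = 3200 / (L * L)" by (simp add: power2_eq_square)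
    also have "\<dots> \<le> 3200 / (L * 1)" using L20 by (intro divide_left_mono mult_left_mono) auto
    finally show ?thesis by simp
  qed
  have b4: "w \<le> 800 / L"
  proof -
    have "L ^ 1 \<le> L ^ 4" using L20 by (intro power_increasing) auto
    then show ?thesis unfolding w_eq using L20 by (intro divide_left_mono) auto
  qed
  have aux: "measure law {f \<in> space law. Q (run f T)} - measure (forrelated_law k n) {f \<in> space law. Q (run f T)} \<le> 5000 / L"
    if "{f \<in> space law. Q (run f T)} \<in> sets law" for Q
  proof -
    have "measure law {f \<in> space law. Q (run f T)} - measure (forrelated_law k n) {f \<in> space law. Q (run f T)}
      \<le> 1 / L + w + 6 / N + 4 * (real T + 1) * N * exp (- a\<^sup>2 / (2 * v)) + 2 * exp (- (1 / L)\<^sup>2 / (2 * w))"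
      unfolding N_def
    proof (rule forrelated_close_aux[OF _ _ _ v _ w Tw that])
      show "real T * (10 * ln (2 ^ n) / sqrt (2 ^ n)) \<le> 1 / 2" using Te by (simp add: e_def L_def N_def)
      show "real T * (10 * ln (2 ^ n) / sqrt (2 ^ n))\<^sup>2 \<le> v" using Tv by (simp add: e_def L_def N_def)
    qed (use a0 L20 in auto)
    also have "\<dots> \<le> 1 / L + 800 / L + 6 / L + 8 / L + 3200 / L"
      using b1 b2 b3 b4 by (intro add_mono) auto
    also have "\<dots> \<le> 5000 / L" using L20 by (simp add: field_simps)
    finally show ?thesis .
  qed
  interpret F: prob_space "forrelated_law k n" by (rule prob_space_forrelated_law[OF k])
  interpret U: prob_space law by (intro prob_space_PiM prob_M)
  have nA: "{f \<in> space law. \<not> P (run f T)} \<in> sets law" by (rule sets.sets_Collect_neg[OF A])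
  have space: "space (forrelated_law k n) = space law" by (simp add: space_forrelated_law law_uniform)
  have A_F: "{f \<in> space law. P (run f T)} \<in> sets (forrelated_law k n)"
    using A unfolding sets_forrelated_law law_uniform sets_uniform_law .
  have compl: "{f \<in> space law. \<not> P (run f T)} = space law - {f \<in> space law. P (run f T)}" by auto
  have "measure law {f \<in> space law. \<not> P (run f T)} = 1 - measure law {f \<in> space law. P (run f T)}"
    unfolding compl by (rule U.prob_compl[OF A])
  moreover have "measure (forrelated_law k n) {f \<in> space law. \<not> P (run f T)} = 1 - measure (forrelated_law k n) {f \<in> space law. P (run f T)}"
    unfolding compl using F.prob_compl[OF A_F] by (simp add: space)
  ultimately show ?thesis using aux[OF A] aux[of "\<lambda>x. \<not> P x", OF nA] unfolding L_def by linarith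
qed

end

section \<open>Averaging over the seed\<close>

lemma measurable_answers:
  assumes A: "randomized_algorithm k n T A" and D: "sets D = sets (Pi\<^sub>M (points k n) (\<lambda>_. borel :: real measure))"
  shows "t \<le> T \<Longrightarrow> (\<lambda>w. answers A (fst w) (snd w) t) \<in> seed A \<Otimes>\<^sub>M D \<rightarrow>\<^sub>M Pi\<^sub>M {..<t} (\<lambda>_. borel)"
proof (induction t)
  case 0
  then show ?case by (intro measurable_PiM_single') (auto simp: PiE_def)
next
  case (Suc t)
  have ans: "(\<lambda>w. answers A (fst w) (snd w) t) \<in> seed A \<Otimes>\<^sub>M D \<rightarrow>\<^sub>M Pi\<^sub>M {..<t} (\<lambda>_. borel)"
    using Suc by simp
  have "(\<lambda>w. (fst w, answers A (fst w) (snd w) t)) \<in> seed A \<Otimes>\<^sub>M D \<rightarrow>\<^sub>M seed A \<Otimes>\<^sub>M Pi\<^sub>M {..<t} (\<lambda>_. borel)"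
    by (rule measurable_Pair[OF measurable_fst ans])
  moreover have "next_query A t \<in> seed A \<Otimes>\<^sub>M Pi\<^sub>M {..<t} (\<lambda>_. borel) \<rightarrow>\<^sub>M count_space (points k n)"
    using A Suc.prems by (auto simp: randomized_algorithm_def)
  ultimately have q: "(\<lambda>w. next_query A t (fst w, answers A (fst w) (snd w) t)) \<in> seed A \<Otimes>\<^sub>M D \<rightarrow>\<^sub>M count_space (points k n)"
    by (rule measurable_compose)
  have comp: "(\<lambda>w. snd w p) \<in> borel_measurable (seed A \<Otimes>\<^sub>M D)" if "p \<in> points k n" for p
  proof -
    have "(\<lambda>f. f p) \<in> borel_measurable D"
      using measurable_component_singleton[OF that, of "\<lambda>_. borel :: real measure"] measurable_cong_sets[OF D refl] by blast
    then show ?thesis by (rule measurable_compose[OF measurable_snd])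
  qed
  have "(\<lambda>w. snd w (next_query A t (fst w, answers A (fst w) (snd w) t))) \<in> borel_measurable (seed A \<Otimes>\<^sub>M D)"
    by (rule measurable_compose_countable'[where f="\<lambda>p w. snd w p", OF comp q]) (auto intro: countable_finite)
  then show ?case unfolding answers.simps
    using ans by (intro measurable_fun_upd[where J="{..<t}"]) auto
qed

text \<open>Conditioning on the seed, by Tonelli. Stated for a general law on the inputs, so that
  the forrelated and the uniform law are treated at once.\<close>

lemma emeasure_accept:
  assumes A: "randomized_algorithm k n T A" and D: "prob_space D" "sets D = sets (Pi\<^sub>M (points k n) (\<lambda>_. borel))"
  shows "ennreal (accept_prob T A D) = (\<integral>\<^sup>+r. emeasure D {f \<in> space D. accept A (r, answers A r f T)} \<partial>seed A)"
    and "r \<in> space (seed A) \<Longrightarrow> {f \<in> space D. accept A (r, answers A r f T)} \<in> sets D"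
    and "(\<lambda>r. emeasure D {f \<in> space D. accept A (r, answers A r f T)}) \<in> borel_measurable (seed A)"
proof -
  interpret D: prob_space D by fact
  interpret R: prob_space "seed A" using A by (simp add: randomized_algorithm_def)
  interpret P: pair_prob_space "seed A" D ..
  let ?E = "{w \<in> space (seed A \<Otimes>\<^sub>M D). accept A (fst w, answers A (fst w) (snd w) T)}"
  have acc: "accept A \<in> seed A \<Otimes>\<^sub>M Pi\<^sub>M {..<T} (\<lambda>_. borel) \<rightarrow>\<^sub>M count_space UNIV"
    using A by (simp add: randomized_algorithm_def)
  have "Measurable.pred (seed A \<Otimes>\<^sub>M D) (\<lambda>w. accept A (fst w, answers A (fst w) (snd w) T))"
    by (rule measurable_compose[OF measurable_Pair[OF measurable_fst measurable_answers[OF A D(2) order_refl]] acc])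
  then have E: "?E \<in> sets (seed A \<Otimes>\<^sub>M D)" by (simp add: pred_def)
  have slice: "Pair r -` ?E = {f \<in> space D. accept A (r, answers A r f T)}" if "r \<in> space (seed A)" for r
    using that by (auto simp: space_pair_measure)
  have "ennreal (accept_prob T A D) = emeasure (seed A \<Otimes>\<^sub>M D) ?E"
    by (simp add: accept_prob_def P.emeasure_eq_measure)
  also have "\<dots> = (\<integral>\<^sup>+r. emeasure D (Pair r -` ?E) \<partial>seed A)"
    by (rule D.emeasure_pair_measure_alt[OF E])
  also have "\<dots> = (\<integral>\<^sup>+r. emeasure D {f \<in> space D. accept A (r, answers A r f T)} \<partial>seed A)"
    by (intro nn_integral_cong arg_cong[where f="emeasure D"] slice)
  finally show "ennreal (accept_prob T A D) = (\<integral>\<^sup>+r. emeasure D {f \<in> space D. accept A (r, answers A r f T)} \<partial>seed A)" .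
  show "{f \<in> space D. accept A (r, answers A r f T)} \<in> sets D" if "r \<in> space (seed A)"
    using sets_Pair1[OF E, of r] slice[OF that] by simp
  have "(\<lambda>r. emeasure D (Pair r -` ?E)) \<in> borel_measurable (seed A)"
    by (rule D.measurable_emeasure_Pair[OF E])
  then show "(\<lambda>r. emeasure D {f \<in> space D. accept A (r, answers A r f T)}) \<in> borel_measurable (seed A)"
    by (rule measurable_cong[THEN iffD1, rotated]) (rule arg_cong[where f="emeasure D"], rule slice)
qed

lemma accept_prob_close:
  assumes k: "2 \<le> k" and n: "1 \<le> n" and A: "randomized_algorithm k n T A"
    and L: "20 \<le> ln (2 ^ n :: real)" and T: "real T < sqrt (2 ^ n) / ln (2 ^ n) powr (7 / 2)"
  shows "\<bar>accept_prob T A (forrelated_law k n) - accept_prob T A (uniform_law k n)\<bar> \<le> 5000 / ln (2 ^ n)"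
proof -
  let ?F = "forrelated_law k n" and ?U = "uniform_law k n" and ?\<eta> = "5000 / ln (2 ^ n) :: real"
  interpret F: prob_space ?F by (rule prob_space_forrelated_law[OF k])
  interpret U: prob_space ?U by (rule prob_space_uniform_law)
  interpret R: prob_space "seed A" using A by (simp add: randomized_algorithm_def)
  note acc_F = emeasure_accept[OF A F.prob_space_axioms sets_forrelated_law]
  note acc_U = emeasure_accept[OF A U.prob_space_axioms sets_uniform_law]
  let ?a = "\<lambda>D r. emeasure D {f \<in> space D. accept A (r, answers A r f T)}"
  have \<eta>: "0 \<le> ?\<eta>" using L by simp
  have close: "\<bar>measure ?F {f \<in> space ?F. accept A (r, answers A r f T)} - measure ?U {f \<in> space ?U. accept A (r, answers A r f T)}\<bar> \<le> ?\<eta>"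
    if r: "r \<in> space (seed A)" for r
  proof -
    \<comment> \<open>With the seed fixed, the algorithm is a deterministic strategy and
      \<open>answers\<close> is its \<open>run\<close>. The bound on the bias is uniform in the seed
      and therefore survives averaging.\<close>
    let ?nq = "\<lambda>t a. next_query A t (r, a)"
    have nq: "?nq t \<in> Pi\<^sub>M {..<t} (\<lambda>_. borel) \<rightarrow>\<^sub>M count_space (points k n)" if "t < T" for t
    proof (rule measurable_compose[OF measurable_Pair1'[OF r]])
      show "next_query A t \<in> seed A \<Otimes>\<^sub>M Pi\<^sub>M {..<t} (\<lambda>_. borel) \<rightarrow>\<^sub>M count_space (points k n)"
        using A that by (simp add: randomized_algorithm_def)
    qed
    interpret forrelation_run k n T ?nq
      by (rule forrelation_run.intro[OF k n nq])
    have ans: "answers A r f t = run f t" for f t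
      by (induction t) simp_all
    show ?thesis
      using forrelated_close[OF L T, of "\<lambda>x. accept A (r, x)"] acc_U(2)[OF r]
      unfolding ans space_forrelated_law law_uniform .
  qed
  have meas_F: "?a ?F \<in> borel_measurable (seed A)" and meas_U: "?a ?U \<in> borel_measurable (seed A)"
    using acc_F(3) acc_U(3) by auto
  have "ennreal (accept_prob T A ?F) \<le> (\<integral>\<^sup>+r. ?a ?U r + ennreal ?\<eta> \<partial>seed A)"
    unfolding acc_F(1)
  proof (rule nn_integral_mono)
    fix r assume "r \<in> space (seed A)"
    from close[OF this] show "?a ?F r \<le> ?a ?U r + ennreal ?\<eta>"
      using \<eta> by (simp add: F.emeasure_eq_measure U.emeasure_eq_measure ennreal_leI flip: ennreal_plus)
  qed
  also have "\<dots> = ennreal (accept_prob T A ?U) + ennreal ?\<eta>"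
    using meas_U by (simp add: nn_integral_add acc_U(1) R.emeasure_space_1)
  finally have 1: "accept_prob T A ?F \<le> accept_prob T A ?U + ?\<eta>"
    using \<eta> by (simp add: accept_prob_def flip: ennreal_plus)
  have "ennreal (accept_prob T A ?U) \<le> (\<integral>\<^sup>+r. ?a ?F r + ennreal ?\<eta> \<partial>seed A)"
    unfolding acc_U(1)
  proof (rule nn_integral_mono)
    fix r assume "r \<in> space (seed A)"
    from close[OF this] show "?a ?U r \<le> ?a ?F r + ennreal ?\<eta>"
      using \<eta> by (simp add: F.emeasure_eq_measure U.emeasure_eq_measure ennreal_leI flip: ennreal_plus)
  qed
  also have "\<dots> = ennreal (accept_prob T A ?F) + ennreal ?\<eta>"
    using meas_F by (simp add: nn_integral_add acc_F(1) R.emeasure_space_1)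
  finally have 2: "accept_prob T A ?U \<le> accept_prob T A ?F + ?\<eta>"
    using \<eta> by (simp add: accept_prob_def flip: ennreal_plus)
  show ?thesis using 1 2 by linarith
qed

theorem theorem39:
  fixes k :: nat and \<epsilon> :: real
  assumes "k \<ge> 2" and "\<epsilon> > 0"
  shows "\<exists>c>0. \<forall>\<^sub>F n in sequentially. \<forall>T (A :: 'r algorithm).
           decides_real_forrelation k n \<epsilon> T A \<longrightarrow>
           real T \<ge> c * (sqrt (2 ^ n) / ln (2 ^ n) powr (7 / 2))"
proof (intro exI[of _ 1] conjI)
  \<comment> \<open>Since ln 2 is at least 1 / 2, every \<open>n > m\<close> has
    \<open>ln (2 ^ n) > 20 + 5000 / \<epsilon>\<close>. The first summand meets the requirement of
    \<open>accept_prob_close\<close>; the second pushes its bound 5000 / ln N below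
    \<epsilon>.\<close>
  define m where "m = nat \<lceil>2 * (20 + 5000 / \<epsilon>)\<rceil>"
  show "\<forall>\<^sub>F n in sequentially. \<forall>T (A :: 'r algorithm). decides_real_forrelation k n \<epsilon> T A \<longrightarrow>
      real T \<ge> 1 * (sqrt (2 ^ n) / ln (2 ^ n) powr (7 / 2))"
    using eventually_gt_at_top[of m]
  proof (rule eventually_mono, intro allI impI)
    fix n T and A :: "'r algorithm"
    assume n: "m < n" and A: "decides_real_forrelation k n \<epsilon> T A"
    have "2 * (20 + 5000 / \<epsilon>) \<le> real m" unfolding m_def by linarith
    then have "2 * (20 + 5000 / \<epsilon>) < real n" using n by linarith
    then have "20 + 5000 / \<epsilon> < real n * (1 / 2)" by simp
    also have "real n * (1 / 2) \<le> real n * ln 2" using ln2_ge_two_thirds by (intro mult_left_mono) auto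
    also have "real n * ln 2 = ln (2 ^ n)" by (simp add: ln_realpow)
    finally have L: "20 + 5000 / \<epsilon> < ln (2 ^ n :: real)" .
    moreover have "0 < 5000 / \<epsilon>" using assms by simp
    ultimately have L20: "20 \<le> ln (2 ^ n :: real)" and "5000 / \<epsilon> < ln (2 ^ n)" by linarith+
    moreover have "0 < ln (2 ^ n :: real)" using L20 by linarith
    ultimately have small: "5000 / ln (2 ^ n) < \<epsilon>"
      using assms(2) by (simp only: pos_divide_less_eq mult.commute)
    show "real T \<ge> 1 * (sqrt (2 ^ n) / ln (2 ^ n) powr (7 / 2))"
    proof (rule ccontr)
      assume "\<not> ?thesis"
      then have T: "real T < sqrt (2 ^ n) / ln (2 ^ n) powr (7 / 2)" by simp
      have "\<bar>accept_prob T A (forrelated_law k n) - accept_prob T A (uniform_law k n)\<bar> \<le> 5000 / ln (2 ^ n)"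
        using A n assms by (intro accept_prob_close L20 T) (auto simp: decides_real_forrelation_def)
      then show False using A small by (auto simp: decides_real_forrelation_def)
    qed
  qed
qed simp

end
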